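(* Each ${\cal U}(d)$ is invariant under the $\pi'_l$ action restricted to $\mathfrak{sl}(2,\mathbb C)\times\mathfrak{sl}(2,\mathbb C)$, and we have the following decompositions into irreducible components, $l=0,\frac12,1,\frac32,\dots$: $${\cal U}(2l)=(V_{l+\frac12}\boxtimes V_l)\oplus(V_{l-\frac12}\boxtimes V_l)\oplus(V_{l-\frac12}\boxtimes V_{l-1}),$$ $${\cal U}(-2l-1)=(V_l\boxtimes V_{l+\frac12})\oplus(V_l\boxtimes V_{l-\frac12})\oplus(V_{l-1}\boxtimes V_{l-\frac12}).$$ Similarly, each ${\cal U}'(d)$ is invariant under the $\pi'_r$ action restricted to $\mathfrak{sl}(2,\mathbb C)\times\mathfrak{sl}(2,\mathbb C)$, and for $l=0,\frac12,1,\frac32,\dots$ $${\cal U}'(2l)=(V_l\boxtimes V_{l+\frac12})\oplus(V_l\boxtimes V_{l-\frac12})\oplus(V_{l-1}\boxtimes V_{l-\frac12}),$$ $${\cal U}'(-2l-1)=(V_{l+\frac12}\boxtimes V_l)\oplus(V_{l-\frac12}\boxtimes V_l)\oplus(V_{l-\frac12}\boxtimes V_{l-1}).$$ In particular, $\dim_{\mathbb C}{\cal U}(d)=\dim_{\mathbb C}{\cal U}'(d)=3d^2+3d+2$ for all $d\in\mathbb Z$.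
   Context: $\mathbb H_{\mathbb C}=\mathbb C\otimes_{\mathbb R}\mathbb H$ is identified with $2\times2$ complex matrices $Z=z^0e_0+z^1e_1+z^2e_2+z^3e_3$, $z^j\in\mathbb C$, with $e_0=1$, $e_1=\bigl(\begin{smallmatrix}0&-i\\-i&0\end{smallmatrix}\bigr)$, $e_2=\bigl(\begin{smallmatrix}0&-1\\1&0\end{smallmatrix}\bigr)$, $e_3=\bigl(\begin{smallmatrix}-i&0\\0&i\end{smallmatrix}\bigr)$; $N(Z)=\det Z$; $\operatorname{Re}A=\frac12\operatorname{Tr}A$. $\mathbb S$, $\mathbb S'$ are the spaces of complex $2$-columns and $2$-rows. $\nabla=e_0\partial_{z^0}-e_1\partial_{z^1}-e_2\partial_{z^2}-e_3\partial_{z^3}$, $\square=\sum_j\partial_{z^j}^2$, $g\overleftarrow\nabla$ is $\nabla$ acting from the right. ${\cal U}=\{f\in\mathbb C[z^0,z^1,z^2,z^3,N(Z)^{-1}]\otimes\mathbb S;\nabla\square f=0\}$, ${\cal U}'=\{g\in\mathbb C[z^0,z^1,z^2,z^3,N(Z)^{-1}]\otimes\mathbb S';(\square g)\overleftarrow\nabla=0\}$; ${\cal U}(d)$, ${\cal U}'(d)$ are the subspaces of functions homogeneous of degree $d\in\mathbb Z$. $\mathfrak{gl}(2,\mathbb H_{\mathbb C})$ acts on ${\cal U}$ and ${\cal U}'$ by differentiating $(\pi'_l(h)f)(Z)=\frac{a'-Zc'}{N(a'-Zc')}f\bigl((a'-Zc')^{-1}(-b'+Zd')\bigr)$ and $(\pi'_r(h)g)(Z)=g\bigl((aZ+b)(cZ+d)^{-1}\bigr)\frac{cZ+d}{N(cZ+d)}$,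 $h=\bigl(\begin{smallmatrix}a'&b'\\c'&d'\end{smallmatrix}\bigr)$, $h^{-1}=\bigl(\begin{smallmatrix}a&b\\c&d\end{smallmatrix}\bigr)$. $\mathfrak{sl}(2,\mathbb C)\times\mathfrak{sl}(2,\mathbb C)$ is the subalgebra of $\bigl(\begin{smallmatrix}A&0\\0&D\end{smallmatrix}\bigr)$ with $\operatorname{Re}A=\operatorname{Re}D=0$. $V_l$ is the irreducible $\mathfrak{sl}(2,\mathbb C)$-module of dimension $2l+1$; in $V_p\boxtimes V_q$ the first factor is acted on by $A$, the second by $D$. Convention: $V_j=0$ for $j<0$ (and the corresponding external product is $0$). *)

theory Defs
  imports "HOL-Analysis.Analysis" "HOL-Library.Function_Algebras"
begin

section \<open>Complexified quaternions\<close>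

type_synonym HC = "complex^2^2"

definition cscale :: "complex \<Rightarrow> complex^'n^'m \<Rightarrow> complex^'n^'m" where
  "cscale c A = (\<chi> i j. c * A $ i $ j)"

definition unit_e :: "nat \<Rightarrow> HC" where
  "unit_e j =
    [mat 1,
     vector [vector [0, - \<i>], vector [- \<i>, 0]],
     vector [vector [0, - 1], vector [1, 0]],
     vector [vector [- \<i>, 0], vector [0, \<i>]]] ! j"

text \<open>The coordinates \<open>z\<^sup>0, z\<^sup>1, z\<^sup>2, z\<^sup>3\<close> with respect to the basis \<^const>\<open>unit_e\<close>;
  see \<open>quaternion_expansion\<close> and \<open>coord_unique\<close> below.\<close>

definition coord :: "nat \<Rightarrow> HC \<Rightarrow> complex" where
  "coord j Z =
    [(Z $ 1 $ 1 + Z $ 2 $ 2) / 2,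
     \<i> * (Z $ 1 $ 2 + Z $ 2 $ 1) / 2,
     (Z $ 2 $ 1 - Z $ 1 $ 2) / 2,
     \<i> * (Z $ 1 $ 1 - Z $ 2 $ 2) / 2] ! j"

lemma quaternion_expansion: "Z = (\<Sum>j<4. cscale (coord j Z) (unit_e j))"
  by (simp add: vec_eq_iff forall_2 cscale_def coord_def unit_e_def mat_def
      eval_nat_numeral lessThan_Suc vector_2 field_simps)

lemma coord_unique:
  assumes "k < 4"
  shows "coord k (\<Sum>j<4. cscale (z j) (unit_e j)) = z k"
proof -
  have "k = 0 \<or> k = 1 \<or> k = 2 \<or> k = 3" using assms by auto
  then show ?thesis
    by (elim disjE) (simp_all add: cscale_def coord_def unit_e_def mat_def
      eval_nat_numeral lessThan_Suc vector_2 field_simps)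
qed

lemma det_eq_sum_squares: "det Z = (\<Sum>j<4. (coord j Z)\<^sup>2)"
  by (simp add: det_2 coord_def eval_nat_numeral lessThan_Suc field_simps)

definition quat_Re :: "HC \<Rightarrow> complex" where
  "quat_Re A = trace A / 2"


section \<open>Functions on the invertible elements\<close>

text \<open>Functions on the open set where \<^term>\<open>det Z \<noteq> 0\<close> are represented by total functions
  that vanish off this set, so that equality of such functions is equality in HOL.
  Elements of \<open>\<complex>[z\<^sup>0, z\<^sup>1, z\<^sup>2, z\<^sup>3, N(Z)\<^sup>-\<^sup>1]\<close> are identified with the functions they define;
  no information is lost since this set is Zariski dense.\<close>

definition on_units :: "(HC \<Rightarrow> 'a::zero) \<Rightarrow> HC \<Rightarrow> 'a" where
  "on_units f Z = (if det Z = 0 then 0 else f Z)"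

inductive_set laurent_ring :: "(HC \<Rightarrow> complex) set" where
  const: "on_units (\<lambda>Z. c) \<in> laurent_ring"
| coord: "j < 4 \<Longrightarrow> on_units (coord j) \<in> laurent_ring"
| inverse_det: "on_units (\<lambda>Z. inverse (det Z)) \<in> laurent_ring"
| add: "f \<in> laurent_ring \<Longrightarrow> g \<in> laurent_ring \<Longrightarrow> (\<lambda>Z. f Z + g Z) \<in> laurent_ring"
| mult: "f \<in> laurent_ring \<Longrightarrow> g \<in> laurent_ring \<Longrightarrow> (\<lambda>Z. f Z * g Z) \<in> laurent_ring"

text \<open>Columns and rows of length two are both elements of \<^typ>\<open>complex^2\<close>; matrices act on columns
  by \<open>*v\<close> and on rows by \<open>v*\<close>.\<close>

definition laurent_vectors :: "(HC \<Rightarrow> complex^2) set" where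
  "laurent_vectors = {f. \<forall>k. (\<lambda>Z. f Z $ k) \<in> laurent_ring}"

definition partial :: "nat \<Rightarrow> (HC \<Rightarrow> complex^2) \<Rightarrow> HC \<Rightarrow> complex^2" where
  "partial j f Z = (\<chi> k. deriv (\<lambda>w. f (Z + cscale w (unit_e j)) $ k) 0)"

definition box :: "(HC \<Rightarrow> complex^2) \<Rightarrow> HC \<Rightarrow> complex^2" where
  "box f Z = (\<Sum>j<4. partial j (partial j f) Z)"

definition nabla :: "(HC \<Rightarrow> complex^2) \<Rightarrow> HC \<Rightarrow> complex^2" where
  "nabla f Z = unit_e 0 *v partial 0 f Z - unit_e 1 *v partial 1 f Z
     - unit_e 2 *v partial 2 f Z - unit_e 3 *v partial 3 f Z"

definition nabla_right :: "(HC \<Rightarrow> complex^2) \<Rightarrow> HC \<Rightarrow> complex^2" where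
  "nabla_right g Z = partial 0 g Z v* unit_e 0 - partial 1 g Z v* unit_e 1
     - partial 2 g Z v* unit_e 2 - partial 3 g Z v* unit_e 3"

definition homogeneous :: "int \<Rightarrow> (HC \<Rightarrow> complex^2) \<Rightarrow> bool" where
  "homogeneous d f \<longleftrightarrow>
     (\<forall>c Z. c \<noteq> 0 \<longrightarrow> det Z \<noteq> 0 \<longrightarrow> f (cscale c Z) = (c powi d) *s f Z)"

definition spaceU :: "(HC \<Rightarrow> complex^2) set" where
  "spaceU = {f \<in> laurent_vectors. \<forall>Z. det Z \<noteq> 0 \<longrightarrow> nabla (box f) Z = 0}"

definition spaceU' :: "(HC \<Rightarrow> complex^2) set" where
  "spaceU' = {g \<in> laurent_vectors. \<forall>Z. det Z \<noteq> 0 \<longrightarrow> nabla_right (box g) Z = 0}"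

definition U_deg :: "int \<Rightarrow> (HC \<Rightarrow> complex^2) set" where
  "U_deg d = {f \<in> spaceU. homogeneous d f}"

definition U'_deg :: "int \<Rightarrow> (HC \<Rightarrow> complex^2) set" where
  "U'_deg d = {g \<in> spaceU'. homogeneous d g}"


section \<open>The actions of the Lie algebra\<close>

type_synonym gl2HC = "complex^(2 + 2)^(2 + 2)"

definition blk11 :: "gl2HC \<Rightarrow> HC" where "blk11 h = (\<chi> i j. h $ Inl i $ Inl j)"
definition blk12 :: "gl2HC \<Rightarrow> HC" where "blk12 h = (\<chi> i j. h $ Inl i $ Inr j)"
definition blk21 :: "gl2HC \<Rightarrow> HC" where "blk21 h = (\<chi> i j. h $ Inr i $ Inl j)"
definition blk22 :: "gl2HC \<Rightarrow> HC" where "blk22 h = (\<chi> i j. h $ Inr i $ Inr j)"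

definition block_diag :: "HC \<Rightarrow> HC \<Rightarrow> gl2HC" where
  "block_diag A D = (\<chi> r s. case (r, s) of
      (Inl i, Inl j) \<Rightarrow> A $ i $ j
    | (Inr i, Inr j) \<Rightarrow> D $ i $ j
    | _ \<Rightarrow> 0)"

definition pi_l :: "gl2HC \<Rightarrow> (HC \<Rightarrow> complex^2) \<Rightarrow> HC \<Rightarrow> complex^2" where
  "pi_l h f Z =
    (let a' = blk11 h; b' = blk12 h; c' = blk21 h; d' = blk22 h; M = a' - Z ** c'
     in inverse (det M) *s (M *v f (matrix_inv M ** (- b' + Z ** d'))))"

definition pi_r :: "gl2HC \<Rightarrow> (HC \<Rightarrow> complex^2) \<Rightarrow> HC \<Rightarrow> complex^2" where
  "pi_r h g Z =
    (let k = matrix_inv h; a = blk11 k; b = blk12 k; c = blk21 k; d = blk22 k; M = c ** Z + d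
     in inverse (det M) *s (g ((a ** Z + b) ** matrix_inv M) v* M))"

definition matrix_exp :: "complex^'n^'n \<Rightarrow> complex^'n^'n" where
  "matrix_exp X = (\<Sum>k. (1 / fact k) *\<^sub>R (((**) X ^^ k) (mat 1)))"

definition differentiated ::
  "(gl2HC \<Rightarrow> (HC \<Rightarrow> complex^2) \<Rightarrow> HC \<Rightarrow> complex^2) \<Rightarrow> gl2HC \<Rightarrow> (HC \<Rightarrow> complex^2) \<Rightarrow> HC \<Rightarrow> complex^2"
  where
  "differentiated \<pi> X f =
     on_units (\<lambda>Z. vector_derivative (\<lambda>t. \<pi> (matrix_exp (t *\<^sub>R X)) f Z) (at 0))"

definition sl2 :: "HC set" where
  "sl2 = {A. quat_Re A = 0}"

definition sl2_sl2 :: "gl2HC set" where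
  "sl2_sl2 = {block_diag A D | A D. quat_Re A = 0 \<and> quat_Re D = 0}"


section \<open>Modules\<close>

text \<open>A complex vector space is a subspace, with respect to a scalar multiplication \<open>s\<close>,
  of an additive group.\<close>

definition scale_coords :: "complex \<Rightarrow> ('i \<Rightarrow> complex) \<Rightarrow> 'i \<Rightarrow> complex" where
  "scale_coords c v = (\<lambda>i. c * v i)"

definition scale_fun :: "complex \<Rightarrow> (HC \<Rightarrow> complex^2) \<Rightarrow> HC \<Rightarrow> complex^2" where
  "scale_fun c f = (\<lambda>Z. c *s f Z)"

lemma vector_space_scale_coords: "vector_space scale_coords"
  by unfold_locales (auto simp: scale_coords_def fun_eq_iff algebra_simps)

lemma vector_space_scale_fun: "vector_space scale_fun"
  by unfold_locales (auto simp: scale_fun_def fun_eq_iff vec_eq_iff algebra_simps)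

definition submodule ::
  "(complex \<Rightarrow> 'v \<Rightarrow> 'v) \<Rightarrow> 'g set \<Rightarrow> ('g \<Rightarrow> 'v \<Rightarrow> 'v) \<Rightarrow> 'v::ab_group_add set \<Rightarrow> bool" where
  "submodule s L \<rho> W \<longleftrightarrow> module.subspace s W \<and> (\<forall>X\<in>L. \<forall>w\<in>W. \<rho> X w \<in> W)"

definition irreducible_module ::
  "(complex \<Rightarrow> 'v \<Rightarrow> 'v) \<Rightarrow> 'g set \<Rightarrow> ('g \<Rightarrow> 'v \<Rightarrow> 'v) \<Rightarrow> 'v::ab_group_add set \<Rightarrow> bool" where
  "irreducible_module s L \<rho> W \<longleftrightarrow>
     submodule s L \<rho> W \<and> W \<noteq> {0} \<and>
     (\<forall>W'. W' \<subseteq> W \<and> submodule s L \<rho> W' \<longrightarrow> W' = {0} \<or> W' = W)"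

definition linear_on ::
  "(complex \<Rightarrow> 'v \<Rightarrow> 'v) \<Rightarrow> (complex \<Rightarrow> 'w \<Rightarrow> 'w) \<Rightarrow> 'v::ab_group_add set \<Rightarrow> ('v \<Rightarrow> 'w::ab_group_add) \<Rightarrow> bool"
  where
  "linear_on s t W \<phi> \<longleftrightarrow>
     (\<forall>v\<in>W. \<forall>w\<in>W. \<phi> (v + w) = \<phi> v + \<phi> w) \<and> (\<forall>c. \<forall>v\<in>W. \<phi> (s c v) = t c (\<phi> v))"

definition sl2_module ::
  "(complex \<Rightarrow> 'v \<Rightarrow> 'v) \<Rightarrow> (HC \<Rightarrow> 'v \<Rightarrow> 'v) \<Rightarrow> 'v::ab_group_add set \<Rightarrow> bool" where
  "sl2_module s \<rho> W \<longleftrightarrow>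
     submodule s sl2 \<rho> W \<and>
     (\<forall>A\<in>sl2. linear_on s s W (\<rho> A)) \<and>
     (\<forall>w\<in>W. \<forall>A\<in>sl2. \<forall>B\<in>sl2. \<rho> (A + B) w = \<rho> A w + \<rho> B w) \<and>
     (\<forall>w\<in>W. \<forall>A\<in>sl2. \<forall>c. \<rho> (cscale c A) w = s c (\<rho> A w)) \<and>
     (\<forall>w\<in>W. \<forall>A\<in>sl2. \<forall>B\<in>sl2. \<rho> (A ** B - B ** A) w = \<rho> A (\<rho> B w) - \<rho> B (\<rho> A w))"

definition coord_space :: "'i set \<Rightarrow> ('i \<Rightarrow> complex) set" where
  "coord_space I = {v. \<forall>i. i \<notin> I \<longrightarrow> v i = 0}"

text \<open>\<open>is_V k \<sigma>\<close>: the action \<open>\<sigma>\<close> makes the coordinate space of dimension \<open>k + 1\<close> into the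
  module \<open>V\<^sub>l\<close> with \<open>l = k / 2\<close>, which is unique up to isomorphism. Modules are thus indexed by
  the integer \<open>k = 2l\<close>. For \<open>k < 0\<close> the space is zero, as \<open>V\<^sub>l = 0\<close> for \<open>l < 0\<close>.\<close>

definition is_V :: "int \<Rightarrow> (HC \<Rightarrow> (nat \<Rightarrow> complex) \<Rightarrow> nat \<Rightarrow> complex) \<Rightarrow> bool" where
  "is_V k \<sigma> \<longleftrightarrow>
     sl2_module scale_coords \<sigma> (coord_space {..<nat (k + 1)}) \<and>
     (0 \<le> k \<longrightarrow> irreducible_module scale_coords sl2 \<sigma> (coord_space {..<nat (k + 1)}))"

text \<open>The action \<open>\<sigma>(A) \<otimes> 1 + 1 \<otimes> \<tau>(D)\<close> on the tensor product of two coordinate spaces, which is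
  the coordinate space indexed by pairs.\<close>

definition external_action ::
  "(HC \<Rightarrow> (nat \<Rightarrow> complex) \<Rightarrow> nat \<Rightarrow> complex) \<Rightarrow> (HC \<Rightarrow> (nat \<Rightarrow> complex) \<Rightarrow> nat \<Rightarrow> complex) \<Rightarrow>
   HC \<Rightarrow> HC \<Rightarrow> (nat \<times> nat \<Rightarrow> complex) \<Rightarrow> nat \<times> nat \<Rightarrow> complex" where
  "external_action \<sigma> \<tau> A D F =
     (\<lambda>(i, j). \<sigma> A (\<lambda>i'. F (i', j)) i + \<tau> D (\<lambda>j'. F (i, j')) j)"

text \<open>\<open>W\<close> is isomorphic to \<open>V\<^sub>l \<boxtimes> V\<^sub>m\<close> with \<open>l = p / 2\<close> and \<open>m = q / 2\<close>.\<close>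

definition iso_V_box_V ::
  "(gl2HC \<Rightarrow> (HC \<Rightarrow> complex^2) \<Rightarrow> HC \<Rightarrow> complex^2) \<Rightarrow> (HC \<Rightarrow> complex^2) set \<Rightarrow> int \<Rightarrow> int \<Rightarrow> bool"
  where
  "iso_V_box_V \<rho> W p q \<longleftrightarrow>
     (\<exists>\<sigma> \<tau> \<phi>. is_V p \<sigma> \<and> is_V q \<tau> \<and>
       (let T = coord_space ({..<nat (p + 1)} \<times> {..<nat (q + 1)}) in
         bij_betw \<phi> T W \<and> linear_on scale_coords scale_fun T \<phi> \<and>
         (\<forall>A\<in>sl2. \<forall>D\<in>sl2. \<forall>F\<in>T.
            \<phi> (external_action \<sigma> \<tau> A D F) = \<rho> (block_diag A D) (\<phi> F))))"

text \<open>\<open>W\<close> is the internal direct sum of submodules \<open>Ws ! i\<close>, the \<open>i\<close>-th one being isomorphic to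
  \<open>V\<^sub>l \<boxtimes> V\<^sub>m\<close> where \<open>(2l, 2m)\<close> is the \<open>i\<close>-th entry of the list, and irreducible unless it is
  zero by convention.\<close>

definition decomposes_into ::
  "(gl2HC \<Rightarrow> (HC \<Rightarrow> complex^2) \<Rightarrow> HC \<Rightarrow> complex^2) \<Rightarrow> (HC \<Rightarrow> complex^2) set \<Rightarrow> (int \<times> int) list \<Rightarrow> bool"
  where
  "decomposes_into \<rho> W pqs \<longleftrightarrow>
     (\<exists>Ws. length Ws = length pqs \<and>
       (\<forall>i<length pqs. case pqs ! i of (p, q) \<Rightarrow>
          submodule scale_fun sl2_sl2 \<rho> (Ws ! i) \<and> iso_V_box_V \<rho> (Ws ! i) p q \<and>
          (0 \<le> p \<and> 0 \<le> q \<longrightarrow> irreducible_module scale_fun sl2_sl2 \<rho> (Ws ! i))) \<and>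
       bij_betw (\<lambda>w. \<Sum>i<length pqs. w i) (\<Pi>\<^sub>E i\<in>{..<length pqs}. Ws ! i) W)"

end

theory Submission
  imports Defs
begin

text \<open>
  The equation \<open>\<nabla> \<box> f = 0\<close> can be solved by diagonalisation. The ring
  \<open>\<complex>[z\<^sup>0, z\<^sup>1, z\<^sup>2, z\<^sup>3, N\<^sup>-\<^sup>1]\<close> has a basis \<open>N\<^sup>r \<cdot> t\<close>, where \<open>t\<close> runs through the matrix coefficients of the symmetric powers
  of \<open>Z\<close>, which are harmonic polynomials. Let \<open>m\<close> be the degree of \<open>t\<close>. For functions with values in the columns, \<open>t\<close> is replaced by the
  coefficients of \<open>(x\<^sub>2, - x\<^sub>1)\<^sup>T (x Z y)\<^sup>m\<close> and of \<open>Z y (x Z y)\<^sup>m\<^sup>-\<^sup>1\<close>, with a row \<open>x\<close> and a column \<open>y\<close> of indeterminates. In the resulting basis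
  the degree operator has eigenvalues \<open>2 r + m\<close>, the operator \<open>N \<box>\<close> has eigenvalues \<open>4 r (r + 1 + m)\<close>, and \<open>Z \<nabla>\<close>, which has the
  same kernel as \<open>\<nabla>\<close>, has eigenvalues \<open>2 r\<close> on the first family and \<open>2 (r + 1 + m)\<close> on the second.

  That these functions span (\<open>laurent_vectors_subset_span\<close>) follows from the Clebsch-Gordan formulas for the product of a
  matrix entry and a matrix coefficient (\<open>mult_z11\<close> and its variants); that they are independent (\<open>bvec_independent\<close>) follows because the
  torus on both sides and \<open>Z \<nabla>\<close> separate them. Consequently \<open>\<nabla> \<box> f = 0\<close> holds for a combination of basis vectors if and only
  if it holds for each vector occurring in it, and in a given degree exactly three pairs consisting of a family and an exponent \<open>r\<close> remain
  (\<open>U_deg_eq\<close>, \<open>U_basis_eq\<close>), possibly with an empty range of indices.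

  The coefficients with respect to \<open>x\<close> and \<open>y\<close> are permuted up to scalars by the root vectors of the Lie algebra according to the
  standard formulas for \<open>V\<^sub>p\<^sub>/\<^sub>2\<close> and \<open>V\<^sub>q\<^sub>/\<^sub>2\<close> (\<open>box_basis_bvec\<close>), where \<open>p = m + 1\<close> or \<open>p = m - 1\<close> in the
  two families, and \<open>q = m\<close>. A family with these formulas spans an irreducible module of the required type, because its
  weights are distinct and the root vectors connect any two of them (locale \<open>box_module\<close>). Counting indices gives the dimension.

  The statements about rows follow by transposing the argument \<open>Z\<close>, which turns the action of \<open>(A, D)\<close> into that of
  \<open>(- D\<^sup>T, - A\<^sup>T)\<close> and thereby exchanges both factors.
\<close>

section \<open>Matrix coefficients\<close>

text \<open>\<open>mcoeff m i j Z\<close> is the coefficient of \<open>u\<^sup>i v\<^sup>j\<close> in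
\<open>(z\<^sub>1\<^sub>1 u v + z\<^sub>1\<^sub>2 u + z\<^sub>2\<^sub>1 v + z\<^sub>2\<^sub>2)\<^sup>m\<close>, that is, up to normalisation, a matrix coefficient of
the \<open>m\<close>-th symmetric power of the representation \<open>Z\<close> of \<open>GL(2)\<close>. Multiplying the generating function by
one more factor gives the recursion. The indices are integers so that shifts need no case distinction; outside
\<open>0 \<le> i, j \<le> m\<close> the value is \<open>0\<close>.\<close>

primrec mcoeff :: "nat \<Rightarrow> int \<Rightarrow> int \<Rightarrow> HC \<Rightarrow> complex" where
  "mcoeff 0 i j Z = (if i = 0 \<and> j = 0 then 1 else 0)"
| "mcoeff (Suc m) i j Z =
     Z $ 1 $ 1 * mcoeff m (i - 1) (j - 1) Z + Z $ 1 $ 2 * mcoeff m (i - 1) j Z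
   + Z $ 2 $ 1 * mcoeff m i (j - 1) Z + Z $ 2 $ 2 * mcoeff m i j Z"

lemma mcoeff_transpose: "mcoeff m i j (transpose Z) = mcoeff m j i Z"
  by (induction m arbitrary: i j) (auto simp: transpose_def)

lemma mcoeff_outside: "i < 0 \<or> j < 0 \<or> int m < i \<or> int m < j \<Longrightarrow> mcoeff m i j Z = 0"
  by (induction m arbitrary: i j) auto

text \<open>The four relations that follow express the derivatives with respect to \<open>u\<close> and \<open>v\<close> of the generating function.
The action of the Lie algebra and the product formulas are read off from them.\<close>

lemma mcoeff_row1:
  "of_int i * mcoeff (Suc m) i j Z =
   of_nat (Suc m) * (Z $ 1 $ 1 * mcoeff m (i - 1) (j - 1) Z + Z $ 1 $ 2 * mcoeff m (i - 1) j Z)"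
proof (induction m arbitrary: i j)
  case 0
  show ?case by (auto simp: algebra_simps)
next
  case (Suc m)
  have IH1: "of_int i * mcoeff (Suc m) (i - 1) j Z = mcoeff (Suc m) (i - 1) j Z +
     of_nat (Suc m) * (Z $ 1 $ 1 * mcoeff m (i - 2) (j - 1) Z + Z $ 1 $ 2 * mcoeff m (i - 2) j Z)" for j
    using Suc.IH[of "i - 1" j] by (simp add: algebra_simps del: mcoeff.simps)
  have "of_int i * mcoeff (Suc (Suc m)) i j Z =
     Z $ 1 $ 1 * (of_int i * mcoeff (Suc m) (i - 1) (j - 1) Z)
   + Z $ 1 $ 2 * (of_int i * mcoeff (Suc m) (i - 1) j Z)
   + Z $ 2 $ 1 * (of_int i * mcoeff (Suc m) i (j - 1) Z)
   + Z $ 2 $ 2 * (of_int i * mcoeff (Suc m) i j Z)"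
    by (simp only: mcoeff.simps(2)[of "Suc m"]) (simp only: algebra_simps)
  also have "\<dots> = of_nat (Suc (Suc m)) *
     (Z $ 1 $ 1 * mcoeff (Suc m) (i - 1) (j - 1) Z + Z $ 1 $ 2 * mcoeff (Suc m) (i - 1) j Z)"
    unfolding IH1 Suc.IH by (simp add: algebra_simps)
  finally show ?case .
qed

lemma mcoeff_row2:
  "(of_nat (Suc m) - of_int i) * mcoeff (Suc m) i j Z =
   of_nat (Suc m) * (Z $ 2 $ 1 * mcoeff m i (j - 1) Z + Z $ 2 $ 2 * mcoeff m i j Z)"
proof -
  have "(of_nat (Suc m) - of_int i) * mcoeff (Suc m) i j Z =
    of_nat (Suc m) * mcoeff (Suc m) i j Z - of_int i * mcoeff (Suc m) i j Z"
    by (simp only: left_diff_distrib)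
  then show ?thesis unfolding mcoeff_row1 by (simp add: algebra_simps)
qed

lemma mcoeff_col1:
  "of_int j * mcoeff (Suc m) i j Z =
   of_nat (Suc m) * (Z $ 1 $ 1 * mcoeff m (i - 1) (j - 1) Z + Z $ 2 $ 1 * mcoeff m i (j - 1) Z)"
  using mcoeff_row1[of j m i "transpose Z"] unfolding mcoeff_transpose by (simp add: transpose_def)

lemma mcoeff_col2:
  "(of_nat (Suc m) - of_int j) * mcoeff (Suc m) i j Z =
   of_nat (Suc m) * (Z $ 1 $ 2 * mcoeff m (i - 1) j Z + Z $ 2 $ 2 * mcoeff m i j Z)"
  using mcoeff_row2[of m j i "transpose Z"] unfolding mcoeff_transpose by (simp add: transpose_def)

text \<open>The Clebsch-Gordan rule for multiplication with a matrix entry: the product of a harmonic polynomial of degree \<open>m\<close>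
with a coordinate is harmonic of degree \<open>m + 1\<close> up to a multiple of \<open>N\<close>. Eliminating \<open>z\<^sub>1\<^sub>2 z\<^sub>2\<^sub>1 = z\<^sub>1\<^sub>1 z\<^sub>2\<^sub>2 - N\<close>
between one row relation and two column relations produces the correction term.
Together with its three variants, which follow by exchanging columns and by transposition, it shows that the products
\<open>N\<^sup>r \<cdot> mcoeff m i j\<close> span the Laurent ring.\<close>

lemma mult_z11:
  "(of_nat (Suc m))\<^sup>2 * (Z $ 1 $ 1 * mcoeff m i j Z) =
     of_int (i + 1) * of_int (j + 1) * mcoeff (Suc m) (i + 1) (j + 1) Z
     + of_nat (Suc m) * of_nat m * det Z * mcoeff (m - 1) i j Z"
proof (cases m)
  case 0
  then show ?thesis by (cases "i = - 1"; cases "j = - 1"; auto)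
next
  case (Suc n)
  have 1: "of_int (i + 1) * mcoeff (Suc m) (i + 1) (j + 1) Z =
      of_nat (Suc m) * (Z $ 1 $ 1 * mcoeff m i j Z + Z $ 1 $ 2 * mcoeff m i (j + 1) Z)"
    using mcoeff_row1[of "i + 1" m "j + 1" Z] by simp
  have 2: "of_int (j + 1) * mcoeff m i (j + 1) Z =
      of_nat m * (Z $ 1 $ 1 * mcoeff n (i - 1) j Z + Z $ 2 $ 1 * mcoeff n i j Z)"
    using mcoeff_col1[of "j + 1" n i Z] Suc by simp
  have 3: "(of_nat m - of_int j) * mcoeff m i j Z =
      of_nat m * (Z $ 1 $ 2 * mcoeff n (i - 1) j Z + Z $ 2 $ 2 * mcoeff n i j Z)"
    using mcoeff_col2[of n j i Z] Suc by simp
  have "of_int (i + 1) * of_int (j + 1) * mcoeff (Suc m) (i + 1) (j + 1) Z =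
      of_int (j + 1) * (of_int (i + 1) * mcoeff (Suc m) (i + 1) (j + 1) Z)"
    by (simp only: mult_ac)
  also have "\<dots> = of_nat (Suc m) * (of_int (j + 1) * Z $ 1 $ 1 * mcoeff m i j Z
       + Z $ 1 $ 2 * (of_int (j + 1) * mcoeff m i (j + 1) Z))"
    unfolding 1 by (simp only: algebra_simps)
  also have "\<dots> = of_nat (Suc m) * (of_int (j + 1) * Z $ 1 $ 1 * mcoeff m i j Z
       + Z $ 1 $ 1 * ((of_nat m - of_int j) * mcoeff m i j Z) - of_nat m * det Z * mcoeff n i j Z)"
    unfolding 2 3 det_2 by (simp only: algebra_simps)
  finally show ?thesis using Suc by (simp add: algebra_simps power2_eq_square del: mcoeff.simps)
qed

lemma mcoeff_swap_columns: "mcoeff m i j (\<chi> a b. Z $ a $ (if b = 1 then 2 else 1)) = mcoeff m i (int m - j) Z"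
proof (induction m arbitrary: i j)
  case (Suc m)
  have "int (Suc m) - j = int m - (j - 1)" "int m - (j - 1) - 1 = int m - j" by simp_all
  note e = this
  show ?case unfolding mcoeff.simps Suc.IH vec_lambda_beta e by (simp add: add_ac)
qed auto

lemma mult_z12:
  "(of_nat (Suc m))\<^sup>2 * (Z $ 1 $ 2 * mcoeff m i j Z) =
     of_int (i + 1) * (of_nat (Suc m) - of_int j) * mcoeff (Suc m) (i + 1) j Z
     - of_nat (Suc m) * of_nat m * det Z * mcoeff (m - 1) i (j - 1) Z"
  using mult_z11[of m "\<chi> a b. Z $ a $ (if b = 1 then 2 else 1)" i "int m - j"]
  unfolding mcoeff_swap_columns
  by (cases m) (simp_all add: det_2 algebra_simps del: mcoeff.simps)

lemma mult_z21:
  "(of_nat (Suc m))\<^sup>2 * (Z $ 2 $ 1 * mcoeff m i j Z) =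
     (of_nat (Suc m) - of_int i) * of_int (j + 1) * mcoeff (Suc m) i (j + 1) Z
     - of_nat (Suc m) * of_nat m * det Z * mcoeff (m - 1) (i - 1) j Z"
  using mult_z12[of m "transpose Z" j i] unfolding mcoeff_transpose
  by (simp add: transpose_def det_2 mult_ac del: mcoeff.simps)

lemma mult_z22:
  "(of_nat (Suc m))\<^sup>2 * (Z $ 2 $ 2 * mcoeff m i j Z) =
     (of_nat (Suc m) - of_int i) * (of_nat (Suc m) - of_int j) * mcoeff (Suc m) i j Z
     + of_nat (Suc m) * of_nat m * det Z * mcoeff (m - 1) (i - 1) (j - 1) Z"
  using mult_z21[of m "\<chi> a b. Z $ a $ (if b = 1 then 2 else 1)" i "int m - j"]
  unfolding mcoeff_swap_columns
  by (cases m) (simp_all add: det_2 algebra_simps del: mcoeff.simps)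

lemma mcoeff_scale_rows_cols:
  "mcoeff m i j (\<chi> a b. x $ a * y $ b * Z $ a $ b) =
     x $ 1 powi i * x $ 2 powi (int m - i) * y $ 1 powi j * y $ 2 powi (int m - j) * mcoeff m i j Z"
  if "x $ 1 \<noteq> 0" "x $ 2 \<noteq> 0" "y $ 1 \<noteq> 0" "y $ 2 \<noteq> 0"
proof (induction m arbitrary: i j)
  case 0
  then show ?case by simp
next
  case (Suc m)
  have step: "t powi k = t * t powi (k - 1)" if "t \<noteq> 0" for t :: complex and k
    using power_int_add_1'[of t "k - 1"] that by simp
  define X1 X2 Y1 Y2 where "X1 = x $ 1 powi (i - 1)" and "X2 = x $ 2 powi (int m - i)"
    and "Y1 = y $ 1 powi (j - 1)" and "Y2 = y $ 2 powi (int m - j)"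
  have [simp]: "x $ 1 powi (i - 1) = X1" "y $ 1 powi (j - 1) = Y1"
    "x $ 2 powi (int m - i) = X2" "y $ 2 powi (int m - j) = Y2"
    by (simp_all add: X1_def X2_def Y1_def Y2_def)
  have [simp]: "x $ 1 powi i = x $ 1 * X1" "y $ 1 powi j = y $ 1 * Y1"
    "x $ 2 powi (int m - (i - 1)) = x $ 2 * X2" "x $ 2 powi (1 + int m - i) = x $ 2 * X2"
    "y $ 2 powi (int m - (j - 1)) = y $ 2 * Y2" "y $ 2 powi (1 + int m - j) = y $ 2 * Y2"
    using that step[of "x $ 1" i] step[of "y $ 1" j]
      step[of "x $ 2" "int m - (i - 1)"] step[of "y $ 2" "int m - (j - 1)"]
    unfolding X1_def X2_def Y1_def Y2_def by (simp_all add: diff_diff_eq2 add.commute)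
  show ?case
    unfolding mcoeff.simps Suc.IH by simp (simp only: algebra_simps)
qed

text \<open>A point of determinant 1 at which no matrix coefficient with admissible indices vanishes: the recursion has only
nonnegative terms there, and at least one of its four predecessors is again admissible.\<close>

lemma mcoeff_positive:
  fixes Z :: HC
  assumes "Z $ 1 $ 1 = 2" "Z $ 1 $ 2 = 1" "Z $ 2 $ 1 = 1" "Z $ 2 $ 2 = 1"
  shows "0 \<le> Re (mcoeff m i j Z) \<and> (0 \<le> i \<and> i \<le> int m \<and> 0 \<le> j \<and> j \<le> int m \<longrightarrow> 0 < Re (mcoeff m i j Z))"
proof (induction m arbitrary: i j)
  case 0
  show ?case by auto
next
  case (Suc m)
  have ge: "0 \<le> Re (mcoeff m i j Z)" for i j using Suc.IH[of i j] by blast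
  have gt: "0 < Re (mcoeff m i j Z)" if "0 \<le> i" "i \<le> int m" "0 \<le> j" "j \<le> int m" for i j
    using Suc.IH[of i j] that by blast
  show ?case
  proof (intro conjI impI)
    show "0 \<le> Re (mcoeff (Suc m) i j Z)" using assms ge by simp
  next
    assume ij: "0 \<le> i \<and> i \<le> int (Suc m) \<and> 0 \<le> j \<and> j \<le> int (Suc m)"
    then consider "i \<le> int m" "j \<le> int m" | "i \<le> int m" "1 \<le> j" | "1 \<le> i" "j \<le> int m" | "1 \<le> i" "1 \<le> j"
      by linarith
    then show "0 < Re (mcoeff (Suc m) i j Z)"
    proof cases
      case 1
      then have "0 < Re (mcoeff m i j Z)" using ij by (intro gt) auto
      then show ?thesis using assms ge by (simp add: add_nonneg_pos)
    next
      case 2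
      then have "0 < Re (mcoeff m i (j - 1) Z)" using ij by (intro gt) auto
      then show ?thesis using assms ge by (simp add: add_nonneg_pos add_pos_nonneg)
    next
      case 3
      then have "0 < Re (mcoeff m (i - 1) j Z)" using ij by (intro gt) auto
      then show ?thesis using assms ge by (simp add: add_nonneg_pos add_pos_nonneg)
    next
      case 4
      then have "0 < Re (mcoeff m (i - 1) (j - 1) Z)" using ij by (intro gt) auto
      then show ?thesis using assms ge by (simp add: add_nonneg_pos add_pos_nonneg)
    qed
  qed
qed

section \<open>Complex gradients and the Laurent ring\<close>

definition pairing :: "HC \<Rightarrow> HC \<Rightarrow> complex" where
  "pairing G H = G $ 1 $ 1 * H $ 1 $ 1 + G $ 1 $ 2 * H $ 1 $ 2
     + G $ 2 $ 1 * H $ 2 $ 1 + G $ 2 $ 2 * H $ 2 $ 2"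

text \<open>Complex differentiability, with the derivative recorded as a matrix. The functions occurring here
are differentiable only on the open set of units, which is why the notion is pointwise.\<close>

definition has_grad :: "(HC \<Rightarrow> complex) \<Rightarrow> HC \<Rightarrow> HC \<Rightarrow> bool" where
  "has_grad g G Z \<longleftrightarrow> (g has_derivative pairing G) (at Z)"

lemma cscale_nth [simp]: "cscale c A $ i $ j = c * A $ i $ j"
  by (simp add: cscale_def)

lemma on_units_unit [simp]: "det Z \<noteq> 0 \<Longrightarrow> on_units f Z = f Z"
  by (simp add: on_units_def)

lemma open_units: "open {Z :: HC. det Z \<noteq> 0}"
proof -
  have "{Z :: HC. det Z \<noteq> 0} = - {Z. det Z = 0}" by auto
  moreover have "closed {Z :: HC. det Z = 0}"
    by (intro closed_Collect_eq continuous_on_const) (simp add: det_2 continuous_intros)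
  ultimately show ?thesis by (simp add: open_Compl)
qed

lemma has_grad_const: "has_grad (\<lambda>Z. c) 0 Z"
  by (simp add: has_grad_def pairing_def[abs_def])

lemma has_grad_entry: "has_grad (\<lambda>Z. Z $ a $ b) (\<chi> i j. if i = a \<and> j = b then 1 else 0) Z"
proof -
  have "((\<lambda>Z::HC. Z $ a $ b) has_derivative (\<lambda>H. H $ a $ b)) (at Z)"
    by (intro bounded_linear_imp_has_derivative bounded_linear_compose[OF bounded_linear_vec_nth]
        bounded_linear_vec_nth)
  moreover have "(\<lambda>H. H $ a $ b) = pairing (\<chi> i j. if i = a \<and> j = b then 1 else 0)"
    using exhaust_2[of a] exhaust_2[of b] by (auto simp: pairing_def fun_eq_iff)
  ultimately show ?thesis by (simp add: has_grad_def)
qed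

lemma has_grad_add:
  "has_grad g G Z \<Longrightarrow> has_grad h H Z \<Longrightarrow> has_grad (\<lambda>Z. g Z + h Z) (G + H) Z"
  unfolding has_grad_def
  by (drule (1) has_derivative_add) (simp add: pairing_def[abs_def] algebra_simps)

lemma has_grad_mult:
  "has_grad g G Z \<Longrightarrow> has_grad h H Z \<Longrightarrow>
     has_grad (\<lambda>Z. g Z * h Z) (cscale (g Z) H + cscale (h Z) G) Z"
  unfolding has_grad_def
  by (drule (1) has_derivative_mult) (simp add: pairing_def[abs_def] algebra_simps)

lemma has_grad_powi:
  "has_grad g G Z \<Longrightarrow> g Z \<noteq> 0 \<Longrightarrow>
     has_grad (\<lambda>Z. g Z powi r) (cscale (of_int r * g Z powi (r - 1)) G) Z"
  unfolding has_grad_def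
  by (drule has_derivative_power_int[rotated, where n = r]) (simp_all add: pairing_def[abs_def] algebra_simps)

lemma has_grad_eq: "has_grad g G Z \<Longrightarrow> G = G' \<Longrightarrow> has_grad g G' Z"
  by simp

lemma has_grad_cong:
  assumes "has_grad g G Z" "det Z \<noteq> 0" "\<And>Y. det Y \<noteq> 0 \<Longrightarrow> g Y = h Y"
  shows "has_grad h G Z"
  using assms(1) unfolding has_grad_def
  by (rule has_derivative_transform_within_open[OF _ open_units]) (use assms in auto)

definition cofactor :: "HC \<Rightarrow> HC" where
  "cofactor Z = vector [vector [Z $ 2 $ 2, - Z $ 2 $ 1], vector [- Z $ 1 $ 2, Z $ 1 $ 1]]"

lemma has_grad_det: "has_grad det (cofactor Z) Z"
proof -
  have "has_grad (\<lambda>Z. Z $ 1 $ 1 * Z $ 2 $ 2 + (- 1) * (Z $ 1 $ 2 * Z $ 2 $ 1)) (cofactor Z) Z"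
    by (rule has_grad_eq, (rule has_grad_add has_grad_mult has_grad_entry has_grad_const)+)
      (simp add: vec_eq_iff forall_2 cofactor_def)
  then show ?thesis by (simp add: det_2[abs_def])
qed

lemma pairing_units: "G $ a $ b = pairing G (\<chi> i j. if i = a \<and> j = b then 1 else 0)"
  using exhaust_2[of a] exhaust_2[of b] by (auto simp: pairing_def)

lemma has_grad_pairing: "has_grad (pairing K) K Z"
  unfolding pairing_def[abs_def]
  by (rule has_grad_eq, (rule has_grad_add has_grad_mult has_grad_entry has_grad_const)+)
    (simp add: vec_eq_iff forall_2)

text \<open>The partial derivative in the matrix entry \<open>(a, b)\<close>, cut off outside the units like the elements of the Laurent ring.\<close>

definition pd :: "2 \<Rightarrow> 2 \<Rightarrow> (HC \<Rightarrow> complex) \<Rightarrow> HC \<Rightarrow> complex" where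
  "pd a b g = on_units (\<lambda>Z. deriv (\<lambda>w. g (Z + cscale w (\<chi> i j. if i = a \<and> j = b then 1 else 0))) 0)"

lemma has_grad_line:
  assumes "has_grad g G Z"
  shows "((\<lambda>w. g (Z + cscale w E)) has_field_derivative pairing G E) (at 0)"
proof -
  have lin: "bounded_linear (\<lambda>w. cscale w E)"
  proof (rule linear_conv_bounded_linear[THEN iffD1])
    show "linear (\<lambda>w. cscale w E)"
      by (rule linearI) (auto simp: vec_eq_iff algebra_simps)
  qed
  have "((\<lambda>w. Z + cscale w E) has_derivative (\<lambda>w. cscale w E)) (at 0)"
    using has_derivative_add[OF has_derivative_const bounded_linear_imp_has_derivative[OF lin]]
    by simp
  moreover have "(g has_derivative pairing G) (at (Z + cscale 0 E))"
    using assms by (simp add: has_grad_def cscale_def zero_vec_def[symmetric])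
  ultimately have "((\<lambda>w. g (Z + cscale w E)) has_derivative (\<lambda>w. pairing G (cscale w E))) (at 0)"
    by (rule has_derivative_compose)
  moreover have "(\<lambda>w. pairing G (cscale w E)) = (*) (pairing G E)"
    by (auto simp: pairing_def fun_eq_iff algebra_simps)
  ultimately show ?thesis by (simp add: has_field_derivative_def)
qed

lemma pd_eq: "has_grad g G Z \<Longrightarrow> det Z \<noteq> 0 \<Longrightarrow> pd a b g Z = G $ a $ b"
  unfolding pd_def by (simp add: DERIV_imp_deriv[OF has_grad_line] pairing_units[symmetric])

lemma laurent_ring_unit_eq: "g \<in> laurent_ring \<Longrightarrow> det Z = 0 \<Longrightarrow> g Z = 0"
  by (induction rule: laurent_ring.induct) (auto simp: on_units_def)

lemma laurent_scale:
  assumes "g \<in> laurent_ring"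
  shows "(\<lambda>Z. c * g Z) \<in> laurent_ring"
proof -
  have "(\<lambda>Z. on_units (\<lambda>Z. c) Z * g Z) = (\<lambda>Z. c * g Z)"
    by (auto simp: fun_eq_iff on_units_def laurent_ring_unit_eq[OF assms])
  then show ?thesis using laurent_ring.mult[OF laurent_ring.const[of c] assms] by simp
qed

lemma laurent_zero: "(\<lambda>Z. 0) \<in> laurent_ring"
  using laurent_ring.const[of 0] by (simp add: on_units_def[abs_def])

lemma laurent_entry: "on_units (\<lambda>Z. Z $ a $ b) \<in> laurent_ring"
proof -
  have c: "(\<lambda>Z. p * on_units (coord j) Z + q * on_units (coord k) Z) \<in> laurent_ring"
    if "j < 4" "k < 4" for p q j k
    by (intro laurent_ring.add laurent_scale laurent_ring.coord that)
  have e: "on_units (\<lambda>Z. Z $ 1 $ 1) = (\<lambda>Z. 1 * on_units (coord 0) Z + (- \<i>) * on_units (coord 3) Z)"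
    "on_units (\<lambda>Z. Z $ 2 $ 2) = (\<lambda>Z. 1 * on_units (coord 0) Z + \<i> * on_units (coord 3) Z)"
    "on_units (\<lambda>Z. Z $ 1 $ 2) = (\<lambda>Z. (- \<i>) * on_units (coord 1) Z + (- 1) * on_units (coord 2) Z)"
    "on_units (\<lambda>Z. Z $ 2 $ 1) = (\<lambda>Z. (- \<i>) * on_units (coord 1) Z + 1 * on_units (coord 2) Z)"
    by (auto simp: on_units_def coord_def fun_eq_iff field_simps eval_nat_numeral)
  have "\<forall>a b. on_units (\<lambda>Z. Z $ a $ b) \<in> laurent_ring"
    unfolding forall_2 e by (intro conjI c) auto
  then show ?thesis by blast
qed

lemma laurent_mult_on_units:
  assumes "on_units g \<in> laurent_ring" "on_units h \<in> laurent_ring"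
  shows "on_units (\<lambda>Z. g Z * h Z) \<in> laurent_ring"
proof -
  have "on_units (\<lambda>Z. g Z * h Z) = (\<lambda>Z. on_units g Z * on_units h Z)"
    by (auto simp: fun_eq_iff on_units_def)
  then show ?thesis using laurent_ring.mult[OF assms] by simp
qed

lemma laurent_add_on_units:
  assumes "on_units g \<in> laurent_ring" "on_units h \<in> laurent_ring"
  shows "on_units (\<lambda>Z. g Z + h Z) \<in> laurent_ring"
proof -
  have "on_units (\<lambda>Z. g Z + h Z) = (\<lambda>Z. on_units g Z + on_units h Z)"
    by (auto simp: fun_eq_iff on_units_def)
  then show ?thesis using laurent_ring.add[OF assms] by simp
qed

lemma laurent_det: "on_units det \<in> laurent_ring"
proof -
  have "on_units (\<lambda>Z. Z $ 1 $ 1 * Z $ 2 $ 2 + (- 1) * (Z $ 1 $ 2 * Z $ 2 $ 1)) \<in> laurent_ring"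
    by (intro laurent_add_on_units laurent_mult_on_units laurent_entry laurent_ring.const)
  then show ?thesis by (simp add: det_2[abs_def])
qed

lemma laurent_power: "on_units g \<in> laurent_ring \<Longrightarrow> on_units (\<lambda>Z. g Z ^ n) \<in> laurent_ring"
  by (induction n) (auto intro: laurent_mult_on_units laurent_ring.const)

lemma laurent_det_powi: "on_units (\<lambda>Z. det Z powi r) \<in> laurent_ring"
  using laurent_power[OF laurent_det, of "nat r"] laurent_power[OF laurent_ring.inverse_det, of "nat (- r)"]
  by (cases "0 \<le> r") (simp_all add: power_int_def)

lemma laurent_mcoeff: "on_units (mcoeff m i j) \<in> laurent_ring"
proof (induction m arbitrary: i j)
  case 0
  show ?case by (auto simp: laurent_ring.const)
next
  case (Suc m)
  have "on_units (\<lambda>Z. Z $ 1 $ 1 * mcoeff m (i - 1) (j - 1) Z + Z $ 1 $ 2 * mcoeff m (i - 1) j Z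
   + Z $ 2 $ 1 * mcoeff m i (j - 1) Z + Z $ 2 $ 2 * mcoeff m i j Z) \<in> laurent_ring"
    by (intro laurent_add_on_units laurent_mult_on_units laurent_entry Suc.IH)
  then show ?case by simp
qed

lemma coord_eq_pairing:
  assumes "j < 4"
  shows "coord j = pairing (\<chi> a b. coord j (\<chi> p q. if p = a \<and> q = b then 1 else 0))"
proof -
  have "j = 0 \<or> j = 1 \<or> j = 2 \<or> j = 3" using assms by auto
  then show ?thesis by (elim disjE) (simp_all add: fun_eq_iff pairing_def coord_def field_simps)
qed

text \<open>The Laurent ring is closed under the four partial derivatives in the matrix entries. This makes iterated
derivatives harmless, and reduces the linearity of the differential operators to that of \<open>pd\<close>.\<close>

lemma laurent_has_grad:
  assumes "g \<in> laurent_ring"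
  shows "\<exists>G. (\<forall>a b. G a b \<in> laurent_ring) \<and> (\<forall>Z. det Z \<noteq> 0 \<longrightarrow> has_grad g (\<chi> a b. G a b Z) Z)"
  using assms
proof (induction rule: laurent_ring.induct)
  case (const c)
  have "has_grad (on_units (\<lambda>Z. c)) (\<chi> a b. 0) Z" if "det Z \<noteq> 0" for Z
    by (rule has_grad_cong[OF has_grad_eq[OF has_grad_const] that]) (simp_all add: vec_eq_iff)
  then show ?case by (intro exI[of _ "\<lambda>a b Z. 0"]) (auto intro: laurent_zero)
next
  case (coord j)
  have "has_grad (on_units (coord j)) (\<chi> a b. on_units (\<lambda>_. coord j (\<chi> p q. if p = a \<and> q = b then 1 else 0)) Z) Z"
    if "det Z \<noteq> 0" for Z
  proof (rule has_grad_cong[OF _ that])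
    show "has_grad (coord j) (\<chi> a b. on_units (\<lambda>_. coord j (\<chi> p q. if p = a \<and> q = b then 1 else 0)) Z) Z"
      using has_grad_pairing[of "\<chi> a b. coord j (\<chi> p q. if p = a \<and> q = b then 1 else 0)" Z] that
      by (simp flip: coord_eq_pairing[OF coord])
  qed simp
  then show ?case
    by (intro exI[of _ "\<lambda>a b. on_units (\<lambda>_. coord j (\<chi> p q. if p = a \<and> q = b then 1 else 0))"])
      (auto intro: laurent_ring.const)
next
  case inverse_det
  let ?G = "\<lambda>a b. on_units (\<lambda>Z. - 1 * (det Z powi (- 2) * cofactor Z $ a $ b))"
  have c: "on_units (\<lambda>Z. cofactor Z $ a $ b) \<in> laurent_ring" for a b
    using exhaust_2[of a] exhaust_2[of b] laurent_entry
      laurent_mult_on_units[OF laurent_ring.const laurent_entry, of "- 1"]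
    by (auto simp: cofactor_def)
  have "has_grad (on_units (\<lambda>Z. inverse (det Z))) (\<chi> a b. ?G a b Z) Z" if "det Z \<noteq> 0" for Z
    by (rule has_grad_cong[OF has_grad_eq[OF has_grad_powi[OF has_grad_det, where r = "- 1"]] that])
      (use that in \<open>simp_all add: vec_eq_iff power_int_minus\<close>)
  moreover have "?G a b \<in> laurent_ring" for a b
    by (intro laurent_mult_on_units c laurent_det_powi laurent_ring.const)
  ultimately show ?case by (intro exI[of _ ?G]) blast
next
  case (add f g)
  then obtain F G where F: "\<And>a b. F a b \<in> laurent_ring" "\<And>Z. det Z \<noteq> 0 \<Longrightarrow> has_grad f (\<chi> a b. F a b Z) Z"
    and G: "\<And>a b. G a b \<in> laurent_ring" "\<And>Z. det Z \<noteq> 0 \<Longrightarrow> has_grad g (\<chi> a b. G a b Z) Z" by blast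
  have "has_grad (\<lambda>Z. f Z + g Z) (\<chi> a b. F a b Z + G a b Z) Z" if "det Z \<noteq> 0" for Z
    using has_grad_add[OF F(2) G(2), OF that that] by (rule has_grad_eq) (simp add: vec_eq_iff)
  then show ?case
    by (intro exI[of _ "\<lambda>a b Z. F a b Z + G a b Z"]) (blast intro: laurent_ring.add F G)
next
  case (mult f g)
  then obtain F G where F: "\<And>a b. F a b \<in> laurent_ring" "\<And>Z. det Z \<noteq> 0 \<Longrightarrow> has_grad f (\<chi> a b. F a b Z) Z"
    and G: "\<And>a b. G a b \<in> laurent_ring" "\<And>Z. det Z \<noteq> 0 \<Longrightarrow> has_grad g (\<chi> a b. G a b Z) Z" by blast
  have "has_grad (\<lambda>Z. f Z * g Z) (\<chi> a b. f Z * G a b Z + g Z * F a b Z) Z" if "det Z \<noteq> 0" for Z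
    using has_grad_mult[OF F(2) G(2), OF that that] by (rule has_grad_eq) (simp add: vec_eq_iff)
  moreover have "(\<lambda>Z. f Z * G a b Z + g Z * F a b Z) \<in> laurent_ring" for a b
    by (intro laurent_ring.add laurent_ring.mult F G mult.hyps)
  ultimately show ?case
    by (intro exI[of _ "\<lambda>a b Z. f Z * G a b Z + g Z * F a b Z"]) blast
qed

lemma pd_laurent: "g \<in> laurent_ring \<Longrightarrow> pd a b g \<in> laurent_ring"
proof -
  assume "g \<in> laurent_ring"
  then obtain G where G: "\<And>a b. G a b \<in> laurent_ring" "\<And>Z. det Z \<noteq> 0 \<Longrightarrow> has_grad g (\<chi> a b. G a b Z) Z"
    using laurent_has_grad by blast
  have "pd a b g Z = G a b Z" for Z
    using pd_eq[OF G(2), of Z a b] laurent_ring_unit_eq[OF G(1), of Z a b]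
    by (cases "det Z = 0") (auto simp: pd_def on_units_def)
  then have "pd a b g = G a b" by blast
  then show ?thesis using G by simp
qed

lemma has_grad_pd: "g \<in> laurent_ring \<Longrightarrow> det Z \<noteq> 0 \<Longrightarrow> has_grad g (\<chi> a b. pd a b g Z) Z"
  using laurent_has_grad[of g] by (auto simp: pd_eq)

lemma pd_eqI:
  assumes "G a b \<in> laurent_ring" "\<And>Z. det Z \<noteq> 0 \<Longrightarrow> has_grad g (\<chi> a b. G a b Z) Z"
  shows "pd a b g = G a b"
proof
  fix Z
  show "pd a b g Z = G a b Z"
  proof (cases "det Z = 0")
    case True
    then show ?thesis using laurent_ring_unit_eq[OF assms(1)] by (simp add: pd_def on_units_def)
  next
    case False
    then show ?thesis using pd_eq[OF assms(2) False] by simp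
  qed
qed

lemma pd_add:
  assumes "g \<in> laurent_ring" "h \<in> laurent_ring"
  shows "pd a b (\<lambda>Z. g Z + h Z) = (\<lambda>Z. pd a b g Z + pd a b h Z)"
proof (rule pd_eqI[where G = "\<lambda>a b Z. pd a b g Z + pd a b h Z"])
  show "(\<lambda>Z. pd a b g Z + pd a b h Z) \<in> laurent_ring"
    using assms by (intro laurent_ring.add pd_laurent)
  show "has_grad (\<lambda>Z. g Z + h Z) (\<chi> a b. pd a b g Z + pd a b h Z) Z" if "det Z \<noteq> 0" for Z
    using has_grad_add[OF has_grad_pd[OF assms(1) that] has_grad_pd[OF assms(2) that]]
    by (rule has_grad_eq) (simp add: vec_eq_iff)
qed

lemma pd_scale:
  assumes "g \<in> laurent_ring"
  shows "pd a b (\<lambda>Z. c * g Z) = (\<lambda>Z. c * pd a b g Z)"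
proof (rule pd_eqI[where G = "\<lambda>a b Z. c * pd a b g Z"])
  show "(\<lambda>Z. c * pd a b g Z) \<in> laurent_ring"
    using assms by (intro laurent_scale pd_laurent)
  show "has_grad (\<lambda>Z. c * g Z) (\<chi> a b. c * pd a b g Z) Z" if "det Z \<noteq> 0" for Z
    using has_grad_mult[OF has_grad_const has_grad_pd[OF assms that]]
    by (rule has_grad_eq) (simp add: vec_eq_iff)
qed

section \<open>Powers of the determinant times matrix coefficients\<close>

text \<open>Euler's identity for a polynomial of degree \<open>m\<close>, in terms of its partial derivatives
\<open>m \<cdot> mcoeff (m - 1)\<close>. For \<open>m = 0\<close> both sides vanish thanks to the factor \<open>m\<close>, whatever \<open>m - 1\<close> means.\<close>

lemma mcoeff_euler:
  "of_nat m * (Z $ 1 $ 1 * mcoeff (m - 1) (i - 1) (j - 1) Z + Z $ 1 $ 2 * mcoeff (m - 1) (i - 1) j Z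
     + Z $ 2 $ 1 * mcoeff (m - 1) i (j - 1) Z + Z $ 2 $ 2 * mcoeff (m - 1) i j Z) = of_nat m * mcoeff m i j Z"
  by (cases m) simp_all

definition mcoeff_grad :: "nat \<Rightarrow> int \<Rightarrow> int \<Rightarrow> HC \<Rightarrow> HC" where
  "mcoeff_grad m i j Z = (\<chi> a b. of_nat m *
     mcoeff (m - 1) (if a = 1 then i - 1 else i) (if b = 1 then j - 1 else j) Z)"

lemma has_grad_mcoeff: "has_grad (mcoeff m i j) (mcoeff_grad m i j Z) Z"
proof (induction m arbitrary: i j)
  case 0
  have "(\<lambda>Z. mcoeff 0 i j Z) = (\<lambda>Z. if i = 0 \<and> j = 0 then 1 else 0)" by simp
  then show ?case using has_grad_const[of "if i = 0 \<and> j = 0 then 1 else 0" Z]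
    by (auto simp: mcoeff_grad_def zero_vec_def)
next
  case (Suc m)
  have "has_grad (\<lambda>Z. Z $ 1 $ 1 * mcoeff m (i - 1) (j - 1) Z + Z $ 1 $ 2 * mcoeff m (i - 1) j Z
   + Z $ 2 $ 1 * mcoeff m i (j - 1) Z + Z $ 2 $ 2 * mcoeff m i j Z) (mcoeff_grad (Suc m) i j Z) Z"
  proof (rule has_grad_eq, (rule has_grad_add has_grad_mult has_grad_entry Suc.IH)+)
    show "cscale (Z $ 1 $ 1) (mcoeff_grad m (i - 1) (j - 1) Z) +
      cscale (mcoeff m (i - 1) (j - 1) Z) (\<chi> i j. if i = 1 \<and> j = 1 then 1 else 0) +
      (cscale (Z $ 1 $ 2) (mcoeff_grad m (i - 1) j Z) +
       cscale (mcoeff m (i - 1) j Z) (\<chi> i j. if i = 1 \<and> j = 2 then 1 else 0)) +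
      (cscale (Z $ 2 $ 1) (mcoeff_grad m i (j - 1) Z) +
       cscale (mcoeff m i (j - 1) Z) (\<chi> i j. if i = 2 \<and> j = 1 then 1 else 0)) +
      (cscale (Z $ 2 $ 2) (mcoeff_grad m i j Z) +
       cscale (mcoeff m i j Z) (\<chi> i j. if i = 2 \<and> j = 2 then 1 else 0)) =
      mcoeff_grad (Suc m) i j Z"
      using mcoeff_euler[of m Z "i - 1" "j - 1"] mcoeff_euler[of m Z "i - 1" j]
        mcoeff_euler[of m Z i "j - 1"] mcoeff_euler[of m Z i j]
      by (simp add: vec_eq_iff forall_2 mcoeff_grad_def algebra_simps)
  qed
  then show ?case by simp
qed

definition Nmcoeff :: "int \<Rightarrow> nat \<Rightarrow> int \<Rightarrow> int \<Rightarrow> HC \<Rightarrow> complex" where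
  "Nmcoeff r m i j = on_units (\<lambda>Z. det Z powi r * mcoeff m i j Z)"

lemma Nmcoeff_laurent: "Nmcoeff r m i j \<in> laurent_ring"
  unfolding Nmcoeff_def by (intro laurent_mult_on_units laurent_det_powi laurent_mcoeff)

lemma Nmcoeff_outside: "i < 0 \<or> j < 0 \<or> int m < i \<or> int m < j \<Longrightarrow> Nmcoeff r m i j = (\<lambda>Z. 0)"
  by (auto simp: Nmcoeff_def on_units_def mcoeff_outside)

definition Nmcoeff_grad :: "int \<Rightarrow> nat \<Rightarrow> int \<Rightarrow> int \<Rightarrow> HC \<Rightarrow> HC" where
  "Nmcoeff_grad r m i j Z = cscale (det Z powi r) (mcoeff_grad m i j Z)
     + cscale (mcoeff m i j Z) (cscale (of_int r * det Z powi (r - 1)) (cofactor Z))"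

lemma has_grad_Nmcoeff: "det Z \<noteq> 0 \<Longrightarrow> has_grad (Nmcoeff r m i j) (Nmcoeff_grad r m i j Z) Z"
  unfolding Nmcoeff_grad_def
  by (rule has_grad_cong[OF has_grad_mult[OF has_grad_powi[OF has_grad_det] has_grad_mcoeff]])
    (simp_all add: Nmcoeff_def)

lemma pd_Nmcoeff: "det Z \<noteq> 0 \<Longrightarrow> pd a b (Nmcoeff r m i j) Z = Nmcoeff_grad r m i j Z $ a $ b"
  by (rule pd_eq[OF has_grad_Nmcoeff])

lemma powi_minus1: "x \<noteq> 0 \<Longrightarrow> x powi r = x * x powi (r - 1)" for x :: complex
  using power_int_add_1'[of x "r - 1"] by simp

text \<open>The polarisation operators \<open>\<Sum>\<^sub>a z\<^sub>c\<^sub>a \<partial>\<^sub>b\<^sub>a\<close> generate the left action of \<open>gl(2)\<close>, and move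
the first index only. The power of \<open>N\<close> contributes only to the diagonal ones, because \<open>N\<close> is
relatively invariant. Both the Dirac operator below and the left Lie algebra
action are combinations of these four operators.\<close>

lemma Nmcoeff_row:
  assumes "det Z \<noteq> 0"
  shows "Z $ 1 $ 1 * pd 1 1 (Nmcoeff r m i j) Z + Z $ 1 $ 2 * pd 1 2 (Nmcoeff r m i j) Z
      = (of_int r + of_int i) * Nmcoeff r m i j Z"
    and "Z $ 2 $ 1 * pd 2 1 (Nmcoeff r m i j) Z + Z $ 2 $ 2 * pd 2 2 (Nmcoeff r m i j) Z
      = (of_int r + of_nat m - of_int i) * Nmcoeff r m i j Z"
    and "Z $ 1 $ 1 * pd 2 1 (Nmcoeff r m i j) Z + Z $ 1 $ 2 * pd 2 2 (Nmcoeff r m i j) Z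
      = (of_int i + 1) * Nmcoeff r m (i + 1) j Z"
    and "Z $ 2 $ 1 * pd 1 1 (Nmcoeff r m i j) Z + Z $ 2 $ 2 * pd 1 2 (Nmcoeff r m i j) Z
      = (of_nat m - of_int i + 1) * Nmcoeff r m (i - 1) j Z"
proof -
  define D where "D = det Z powi (r - 1)"
  have D: "det Z powi r = det Z * D" unfolding D_def by (rule powi_minus1[OF assms])
  have r1: "of_int i * mcoeff m i j Z = of_nat m * (Z $ 1 $ 1 * mcoeff (m - 1) (i - 1) (j - 1) Z + Z $ 1 $ 2 * mcoeff (m - 1) (i - 1) j Z)" for i
    using mcoeff_row1[of i "m - 1" j Z] by (cases m) auto
  have r2: "(of_nat m - of_int i) * mcoeff m i j Z = of_nat m * (Z $ 2 $ 1 * mcoeff (m - 1) i (j - 1) Z + Z $ 2 $ 2 * mcoeff (m - 1) i j Z)" for i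
    using mcoeff_row2[of "m - 1" i j Z] by (cases m) auto
  note u = pd_Nmcoeff[OF assms] Nmcoeff_grad_def mcoeff_grad_def cofactor_def
    D D_def[symmetric]
  have *: "D * (Z $ 1 $ 1 * Z $ 2 $ 2) = D * (det Z + Z $ 1 $ 2 * Z $ 2 $ 1)" by (simp add: det_2)
  have "Z $ 1 $ 1 * pd 1 1 (Nmcoeff r m i j) Z + Z $ 1 $ 2 * pd 1 2 (Nmcoeff r m i j) Z =
    det Z * D * (of_nat m * (Z $ 1 $ 1 * mcoeff (m - 1) (i - 1) (j - 1) Z + Z $ 1 $ 2 * mcoeff (m - 1) (i - 1) j Z))
    + of_int r * D * det Z * mcoeff m i j Z"
    by (simp add: u) (simp add: det_2 algebra_simps)
  then show "Z $ 1 $ 1 * pd 1 1 (Nmcoeff r m i j) Z + Z $ 1 $ 2 * pd 1 2 (Nmcoeff r m i j) Z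
      = (of_int r + of_int i) * Nmcoeff r m i j Z"
    unfolding r1[symmetric] by (simp add: Nmcoeff_def assms D algebra_simps)
  have "Z $ 2 $ 1 * pd 2 1 (Nmcoeff r m i j) Z + Z $ 2 $ 2 * pd 2 2 (Nmcoeff r m i j) Z =
    det Z * D * (of_nat m * (Z $ 2 $ 1 * mcoeff (m - 1) i (j - 1) Z + Z $ 2 $ 2 * mcoeff (m - 1) i j Z))
    + of_int r * D * det Z * mcoeff m i j Z"
    by (simp add: u) (simp add: det_2 algebra_simps)
  then show "Z $ 2 $ 1 * pd 2 1 (Nmcoeff r m i j) Z + Z $ 2 $ 2 * pd 2 2 (Nmcoeff r m i j) Z
      = (of_int r + of_nat m - of_int i) * Nmcoeff r m i j Z"
    unfolding r2[symmetric] by (simp add: Nmcoeff_def assms D algebra_simps)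
  have "Z $ 1 $ 1 * pd 2 1 (Nmcoeff r m i j) Z + Z $ 1 $ 2 * pd 2 2 (Nmcoeff r m i j) Z =
    det Z * D * (of_nat m * (Z $ 1 $ 1 * mcoeff (m - 1) i (j - 1) Z + Z $ 1 $ 2 * mcoeff (m - 1) i j Z))"
    by (simp add: u) (simp add: algebra_simps)
  then show "Z $ 1 $ 1 * pd 2 1 (Nmcoeff r m i j) Z + Z $ 1 $ 2 * pd 2 2 (Nmcoeff r m i j) Z
      = (of_int i + 1) * Nmcoeff r m (i + 1) j Z"
    using r1[of "i + 1"] by (simp add: Nmcoeff_def assms D)
  have "Z $ 2 $ 1 * pd 1 1 (Nmcoeff r m i j) Z + Z $ 2 $ 2 * pd 1 2 (Nmcoeff r m i j) Z =
    det Z * D * (of_nat m * (Z $ 2 $ 1 * mcoeff (m - 1) (i - 1) (j - 1) Z + Z $ 2 $ 2 * mcoeff (m - 1) (i - 1) j Z))"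
    by (simp add: u) (simp add: algebra_simps)
  then show "Z $ 2 $ 1 * pd 1 1 (Nmcoeff r m i j) Z + Z $ 2 $ 2 * pd 1 2 (Nmcoeff r m i j) Z
      = (of_nat m - of_int i + 1) * Nmcoeff r m (i - 1) j Z"
    using r2[of "i - 1"] by (simp add: Nmcoeff_def assms D diff_diff_eq2 algebra_simps)
qed

lemma Nmcoeff_transpose: "Nmcoeff r m i j (transpose Z) = Nmcoeff r m j i Z"
  by (simp add: Nmcoeff_def on_units_def mcoeff_transpose det_transpose)

lemma pd_Nmcoeff_transpose:
  "det Z \<noteq> 0 \<Longrightarrow> pd a b (Nmcoeff r m i j) (transpose Z) = pd b a (Nmcoeff r m j i) Z"
  by (simp add: pd_Nmcoeff det_transpose Nmcoeff_grad_def mcoeff_grad_def mcoeff_transpose cofactor_def)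
    (use exhaust_2[of a] exhaust_2[of b] in \<open>auto simp: transpose_def\<close>)

lemma Nmcoeff_col:
  assumes "det Z \<noteq> 0"
  shows "Z $ 1 $ 1 * pd 1 1 (Nmcoeff r m i j) Z + Z $ 2 $ 1 * pd 2 1 (Nmcoeff r m i j) Z
      = (of_int r + of_int j) * Nmcoeff r m i j Z"
    and "Z $ 1 $ 2 * pd 1 2 (Nmcoeff r m i j) Z + Z $ 2 $ 2 * pd 2 2 (Nmcoeff r m i j) Z
      = (of_int r + of_nat m - of_int j) * Nmcoeff r m i j Z"
    and "Z $ 1 $ 1 * pd 1 2 (Nmcoeff r m i j) Z + Z $ 2 $ 1 * pd 2 2 (Nmcoeff r m i j) Z
      = (of_int j + 1) * Nmcoeff r m i (j + 1) Z"
    and "Z $ 1 $ 2 * pd 1 1 (Nmcoeff r m i j) Z + Z $ 2 $ 2 * pd 2 1 (Nmcoeff r m i j) Z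
      = (of_nat m - of_int j + 1) * Nmcoeff r m i (j - 1) Z"
proof -
  have "det (transpose Z) \<noteq> 0" and "transpose Z $ a $ b = Z $ b $ a" for a b
    using assms by (simp_all add: det_transpose) (simp add: transpose_def)
  note * = Nmcoeff_row[OF this(1), of r m j i, unfolded Nmcoeff_transpose pd_Nmcoeff_transpose[OF assms] this(2)]
  show "Z $ 1 $ 1 * pd 1 1 (Nmcoeff r m i j) Z + Z $ 2 $ 1 * pd 2 1 (Nmcoeff r m i j) Z
      = (of_int r + of_int j) * Nmcoeff r m i j Z" by (rule *)
  show "Z $ 1 $ 2 * pd 1 2 (Nmcoeff r m i j) Z + Z $ 2 $ 2 * pd 2 2 (Nmcoeff r m i j) Z
      = (of_int r + of_nat m - of_int j) * Nmcoeff r m i j Z" by (rule *)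
  show "Z $ 1 $ 1 * pd 1 2 (Nmcoeff r m i j) Z + Z $ 2 $ 1 * pd 2 2 (Nmcoeff r m i j) Z
      = (of_int j + 1) * Nmcoeff r m i (j + 1) Z" by (rule *)
  show "Z $ 1 $ 2 * pd 1 1 (Nmcoeff r m i j) Z + Z $ 2 $ 2 * pd 2 1 (Nmcoeff r m i j) Z
      = (of_nat m - of_int j + 1) * Nmcoeff r m i (j - 1) Z" by (rule *)
qed

text \<open>The operator \<open>\<box>\<close> in the matrix entries, where it is \<open>4 (\<partial>\<^sub>1\<^sub>1 \<partial>\<^sub>2\<^sub>2 - \<partial>\<^sub>1\<^sub>2 \<partial>\<^sub>2\<^sub>1)\<close>, written symmetrically
because the coordinate form yields both orders of differentiation.\<close>

definition laplace :: "(HC \<Rightarrow> complex) \<Rightarrow> HC \<Rightarrow> complex" where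
  "laplace g Z = 2 * (pd 1 1 (pd 2 2 g) Z + pd 2 2 (pd 1 1 g) Z - pd 1 2 (pd 2 1 g) Z - pd 2 1 (pd 1 2 g) Z)"

lemma has_grad_pd_Nmcoeff:
  assumes "det Z \<noteq> 0"
  shows "has_grad (pd a b (Nmcoeff r m i j))
     (cscale (det Z powi r * of_nat m) (mcoeff_grad (m - 1) (if a = 1 then i - 1 else i) (if b = 1 then j - 1 else j) Z)
      + cscale (mcoeff (m - 1) (if a = 1 then i - 1 else i) (if b = 1 then j - 1 else j) Z)
          (cscale (of_nat m * (of_int r * det Z powi (r - 1))) (cofactor Z))
      + (cscale (of_int r * det Z powi (r - 1) * cofactor Z $ a $ b) (mcoeff_grad m i j Z)
      + cscale (mcoeff m i j Z * cofactor Z $ a $ b) (cscale (of_int r * (of_int (r - 1) * det Z powi (r - 2))) (cofactor Z))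
      + cscale (mcoeff m i j Z * (of_int r * det Z powi (r - 1)))
         (\<chi> p q. if a = b then (if p \<noteq> a \<and> q \<noteq> b then 1 else 0) else if p = b \<and> q = a then - 1 else 0))) Z"
proof -
  let ?i = "if a = 1 then i - 1 else i" and ?j = "if b = 1 then j - 1 else j"
  let ?K = "\<chi> p q. if a = b then (if p \<noteq> a \<and> q \<noteq> b then 1 else 0) else if p = b \<and> q = a then - 1 else 0"
  have c: "has_grad (\<lambda>Z. cofactor Z $ a $ b) ?K Z"
  proof -
    have "(\<lambda>Z. cofactor Z $ a $ b) = pairing ?K"
      using exhaust_2[of a] exhaust_2[of b] by (auto simp: pairing_def cofactor_def)
    then show ?thesis using has_grad_pairing[of ?K Z] by simp
  qed
  have "has_grad (\<lambda>Z. det Z powi r * (of_nat m * mcoeff (m - 1) ?i ?j Z)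
      + mcoeff m i j Z * ((of_int r * det Z powi (r - 1)) * cofactor Z $ a $ b)) 
     (cscale (det Z powi r) (cscale (of_nat m) (mcoeff_grad (m - 1) ?i ?j Z) + cscale (mcoeff (m - 1) ?i ?j Z) 0)
      + cscale (of_nat m * mcoeff (m - 1) ?i ?j Z) (cscale (of_int r * det Z powi (r - 1)) (cofactor Z))
      + (cscale (mcoeff m i j Z) (cscale (of_int r * det Z powi (r - 1)) ?K
      + cscale (cofactor Z $ a $ b) (cscale (of_int r) (cscale (of_int (r - 1) * det Z powi (r - 1 - 1)) (cofactor Z)) + cscale (det Z powi (r - 1)) 0))
      + cscale (of_int r * det Z powi (r - 1) * cofactor Z $ a $ b) (mcoeff_grad m i j Z))) Z"
    by (intro has_grad_add has_grad_mult has_grad_powi has_grad_det has_grad_mcoeff has_grad_const c assms)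
  then show ?thesis
  proof (rule has_grad_cong[OF has_grad_eq assms])
    fix Y :: HC assume "det Y \<noteq> 0"
    then show "det Y powi r * (of_nat m * mcoeff (m - 1) ?i ?j Y)
      + mcoeff m i j Y * ((of_int r * det Y powi (r - 1)) * cofactor Y $ a $ b) = pd a b (Nmcoeff r m i j) Y"
      by (simp add: pd_Nmcoeff Nmcoeff_grad_def mcoeff_grad_def)
  qed (simp add: vec_eq_iff algebra_simps)
qed

text \<open>The matrix coefficients are harmonic, since \<open>\<partial>\<^sub>1\<^sub>1 \<partial>\<^sub>2\<^sub>2\<close> and \<open>\<partial>\<^sub>1\<^sub>2 \<partial>\<^sub>2\<^sub>1\<close> shift both indices in the same way.
By the product rule and Euler's identity only the derivatives falling on \<open>N\<^sup>r\<close> survive.\<close>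

lemma laplace_Nmcoeff:
  assumes "det Z \<noteq> 0"
  shows "laplace (Nmcoeff r m i j) Z = 4 * of_int r * (of_int r + 1 + of_nat m) * Nmcoeff (r - 1) m i j Z"
proof -
  define D where "D = det Z powi (r - 2)"
  have D1: "det Z powi (r - 1) = det Z * D" unfolding D_def using powi_minus1[OF assms, of "r - 1"] by simp
  have D0: "det Z powi r = det Z * (det Z * D)" using powi_minus1[OF assms, of r] D1 by simp
  have pd2: "pd p q (pd a b (Nmcoeff r m i j)) Z =
     det Z powi r * of_nat m * mcoeff_grad (m - 1) (if a = 1 then i - 1 else i) (if b = 1 then j - 1 else j) Z $ p $ q
      + mcoeff (m - 1) (if a = 1 then i - 1 else i) (if b = 1 then j - 1 else j) Z *
          ((of_nat m * (of_int r * det Z powi (r - 1))) * cofactor Z $ p $ q)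
      + ((of_int r * det Z powi (r - 1) * cofactor Z $ a $ b) * mcoeff_grad m i j Z $ p $ q
      + (mcoeff m i j Z * cofactor Z $ a $ b) * ((of_int r * (of_int (r - 1) * D)) * cofactor Z $ p $ q)
      + (mcoeff m i j Z * (of_int r * det Z powi (r - 1))) *
         (if a = b then (if p \<noteq> a \<and> q \<noteq> b then 1 else 0) else if p = b \<and> q = a then - 1 else 0))"
    for p q a b
    by (subst pd_eq[OF has_grad_pd_Nmcoeff[OF assms] assms]) (simp add: D_def algebra_simps)
  define T where "T = (\<lambda>i j. mcoeff (m - 1) i j Z)"
  have eul: "of_nat m * (Z $ 1 $ 1 * T (i - 1) (j - 1) + Z $ 1 $ 2 * T (i - 1) j
     + Z $ 2 $ 1 * T i (j - 1) + Z $ 2 $ 2 * T i j) = of_nat m * mcoeff m i j Z"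
    unfolding T_def by (rule mcoeff_euler)
  have "laplace (Nmcoeff r m i j) Z =
     4 * (of_int r * det Z * D * (of_nat m * (Z $ 1 $ 1 * T (i - 1) (j - 1) + Z $ 1 $ 2 * T (i - 1) j
     + Z $ 2 $ 1 * T i (j - 1) + Z $ 2 $ 2 * T i j)))
     + 4 * (2 * of_int r * det Z * D * mcoeff m i j Z)
     + 4 * (of_int r * (of_int r - 1) * (Z $ 1 $ 1 * Z $ 2 $ 2 - Z $ 1 $ 2 * Z $ 2 $ 1) * D * mcoeff m i j Z)"
    unfolding laplace_def pd2 D0 D1
    by (simp add: mcoeff_grad_def cofactor_def T_def) (simp add: algebra_simps)
  also have "Z $ 1 $ 1 * Z $ 2 $ 2 - Z $ 1 $ 2 * Z $ 2 $ 1 = det Z" by (simp add: det_2)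
  finally show ?thesis
    unfolding eul by (simp add: Nmcoeff_def assms D1 algebra_simps)
qed

section \<open>The Laplace and Dirac operators\<close>

lemma partial_nth:
  assumes "\<And>k. has_grad (\<lambda>Z. f Z $ k) (G k) Z"
  shows "partial j f Z $ k = pairing (G k) (unit_e j)"
  unfolding partial_def by (simp add: DERIV_imp_deriv[OF has_grad_line[OF assms]])

lemma nabla_nth:
  assumes "\<And>k. has_grad (\<lambda>Z. f Z $ k) (G k) Z"
  shows "nabla f Z $ a = 2 * (G 1 $ 1 $ a + G 2 $ 2 $ a)"
  unfolding nabla_def using exhaust_2[of a]
  by (auto simp: matrix_vector_mult_def sum_2 partial_nth[OF assms] pairing_def unit_e_def mat_def
      eval_nat_numeral algebra_simps)

lemma nabla_right_nth:
  assumes "\<And>k. has_grad (\<lambda>Z. f Z $ k) (G k) Z"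
  shows "nabla_right f Z $ b = 2 * (G 1 $ b $ 1 + G 2 $ b $ 2)"
  unfolding nabla_right_def using exhaust_2[of b]
  by (auto simp: vector_matrix_mult_def sum_2 partial_nth[OF assms] pairing_def unit_e_def mat_def
      eval_nat_numeral algebra_simps)

lemma laurent_vectorsD: "f \<in> laurent_vectors \<Longrightarrow> (\<lambda>Z. f Z $ k) \<in> laurent_ring"
  by (simp add: laurent_vectors_def)

lemma has_grad_pairing_pd:
  assumes "\<And>a b. g a b \<in> laurent_ring" "det Z \<noteq> 0"
  shows "has_grad (\<lambda>Z. pairing (\<chi> a b. g a b Z) E) (\<chi> p q. pairing (\<chi> a b. pd p q (g a b) Z) E) Z"
  unfolding pairing_def vec_lambda_beta
  by (rule has_grad_eq, (rule has_grad_add has_grad_mult has_grad_pd has_grad_const assms)+)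
    (simp add: vec_eq_iff algebra_simps)

text \<open>The change from the quaternion coordinates to the matrix entries for a second-order operator.\<close>

lemma sum_pairing_unit_e:
  fixes X :: "2 \<Rightarrow> 2 \<Rightarrow> 2 \<Rightarrow> 2 \<Rightarrow> complex"
  defines "P j \<equiv> pairing (\<chi> p q. pairing (\<chi> a b. X p q a b) (unit_e j)) (unit_e j)"
  shows "P 0 + P 1 + P 2 + P 3 = 2 * (X 1 1 2 2 + X 2 2 1 1 - X 1 2 2 1 - X 2 1 1 2)"
proof -
  have ii: "\<i> * (\<i> * x) = - x" for x
    by (simp flip: mult.assoc)
  have "pairing M (unit_e 0) = M $ 1 $ 1 + M $ 2 $ 2" for M
    by (simp add: pairing_def unit_e_def mat_def)
  then have 0: "P 0 = X 1 1 1 1 + X 1 1 2 2 + X 2 2 1 1 + X 2 2 2 2"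
    unfolding P_def by simp
  have "pairing M (unit_e 1) = - (\<i> * (M $ 1 $ 2 + M $ 2 $ 1))" for M
    by (simp add: pairing_def unit_e_def distrib_left mult.commute)
  then have 1: "P 1 = - (X 1 2 1 2 + X 1 2 2 1 + X 2 1 1 2 + X 2 1 2 1)"
    unfolding P_def by (simp add: right_diff_distrib ii)
  have "pairing M (unit_e 2) = M $ 2 $ 1 - M $ 1 $ 2" for M
    by (simp add: pairing_def unit_e_def)
  then have 2: "P 2 = X 1 2 1 2 - X 1 2 2 1 - X 2 1 1 2 + X 2 1 2 1"
    unfolding P_def by simp
  have "pairing M (unit_e 3) = \<i> * (M $ 2 $ 2 - M $ 1 $ 1)" for M
    by (simp add: pairing_def unit_e_def right_diff_distrib mult.commute)
  then have 3: "P 3 = - (X 1 1 1 1) + X 1 1 2 2 + X 2 2 1 1 - X 2 2 2 2"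
    unfolding P_def by (simp add: right_diff_distrib ii)
  show ?thesis unfolding 0 1 2 3 by simp
qed

text \<open>The inner partial derivatives are total functions with no meaning outside the units. As the units form an
open set, they may be replaced by elements of the Laurent ring before differentiating again.\<close>

lemma box_nth:
  assumes "f \<in> laurent_vectors" "det Z \<noteq> 0"
  shows "box f Z $ k = laplace (\<lambda>Z. f Z $ k) Z"
proof -
  have g: "has_grad (\<lambda>Z. partial j f Z $ k)
     (\<chi> p q. pairing (\<chi> a b. pd p q (pd a b (\<lambda>Z. f Z $ k)) Z) (unit_e j)) Z" for j k
  proof (rule has_grad_cong[OF has_grad_pairing_pd assms(2)])
    fix Y :: HC assume "det Y \<noteq> 0"
    then show "pairing (\<chi> a b. pd a b (\<lambda>Z. f Z $ k) Y) (unit_e j) = partial j f Y $ k"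
      by (intro partial_nth[symmetric, where G = "\<lambda>k. \<chi> a b. pd a b (\<lambda>Z. f Z $ k) Y"] has_grad_pd
          laurent_vectorsD assms)
  qed (intro pd_laurent laurent_vectorsD assms assms)+
  have four: "(\<Sum>j<4. F j) = F 0 + F 1 + F 2 + F (3 :: nat)" for F :: "nat \<Rightarrow> complex^2"
    by (simp add: eval_nat_numeral lessThan_Suc)
  show ?thesis
    unfolding box_def four vector_add_component partial_nth[OF g] sum_pairing_unit_e laplace_def
    by simp
qed

lemma laplace_laurent: "g \<in> laurent_ring \<Longrightarrow> laplace g \<in> laurent_ring"
proof -
  assume g: "g \<in> laurent_ring"
  have "(\<lambda>Z. 2 * (pd 1 1 (pd 2 2 g) Z + pd 2 2 (pd 1 1 g) Z + (- 1) * pd 1 2 (pd 2 1 g) Z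
      + (- 1) * pd 2 1 (pd 1 2 g) Z)) \<in> laurent_ring"
    by (intro laurent_scale laurent_ring.add pd_laurent g)
  then show ?thesis by (simp add: laplace_def[abs_def] algebra_simps)
qed

lemma laplace_add: "g \<in> laurent_ring \<Longrightarrow> h \<in> laurent_ring \<Longrightarrow>
    laplace (\<lambda>Z. g Z + h Z) = (\<lambda>Z. laplace g Z + laplace h Z)"
  by (simp add: laplace_def[abs_def] pd_add pd_laurent algebra_simps)

lemma laplace_scale: "g \<in> laurent_ring \<Longrightarrow> laplace (\<lambda>Z. c * g Z) = (\<lambda>Z. c * laplace g Z)"
  by (simp add: laplace_def[abs_def] pd_scale pd_laurent algebra_simps)

lemma laplace_Nmcoeff_eq:
  "laplace (Nmcoeff r m i j) = (\<lambda>Z. 4 * of_int r * (of_int r + 1 + of_nat m) * Nmcoeff (r - 1) m i j Z)"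
proof
  fix Z
  show "laplace (Nmcoeff r m i j) Z = 4 * of_int r * (of_int r + 1 + of_nat m) * Nmcoeff (r - 1) m i j Z"
    using laurent_ring_unit_eq[OF laplace_laurent[OF Nmcoeff_laurent]]
    by (cases "det Z = 0") (simp_all add: laplace_Nmcoeff, simp add: Nmcoeff_def on_units_def)
qed

definition vlaplace :: "(HC \<Rightarrow> complex^2) \<Rightarrow> HC \<Rightarrow> complex^2" where
  "vlaplace f Z = (\<chi> k. laplace (\<lambda>Y. f Y $ k) Z)"

text \<open>The product \<open>Z \<nabla> / 2\<close>. Since \<open>Z\<close> is invertible on the units it has the same kernel as \<open>\<nabla>\<close>, but it preserves the degree and,
unlike \<open>\<nabla>\<close>, is diagonalisable.\<close>

definition euler_dirac :: "(HC \<Rightarrow> complex^2) \<Rightarrow> HC \<Rightarrow> complex^2" where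
  "euler_dirac f Z = Z *v (\<chi> a. \<Sum>b\<in>UNIV. pd b a (\<lambda>Y. f Y $ b) Z)"

lemma vlaplace_laurent: "f \<in> laurent_vectors \<Longrightarrow> vlaplace f \<in> laurent_vectors"
  by (simp add: laurent_vectors_def vlaplace_def laplace_laurent)

lemma laurent_vectors_eq_0: "f \<in> laurent_vectors \<Longrightarrow> det Z = 0 \<Longrightarrow> f Z = 0"
  using laurent_ring_unit_eq[OF laurent_vectorsD] by (simp add: vec_eq_iff)

lemma spaceU_iff:
  "f \<in> spaceU \<longleftrightarrow> f \<in> laurent_vectors \<and> (\<forall>Z a. (\<Sum>b\<in>UNIV. pd b a (\<lambda>Y. vlaplace f Y $ b) Z) = 0)"
proof -
  have "nabla (box f) Z $ a = 2 * (\<Sum>b\<in>UNIV. pd b a (\<lambda>Y. vlaplace f Y $ b) Z)"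
    if f: "f \<in> laurent_vectors" and Z: "det Z \<noteq> 0" for Z a
  proof -
    have "has_grad (\<lambda>Z. box f Z $ k) (\<chi> a b. pd a b (\<lambda>Y. vlaplace f Y $ k) Z) Z" for k
      by (rule has_grad_cong[OF has_grad_pd[OF _ Z] Z])
        (auto simp: vlaplace_laurent f laurent_vectorsD box_nth vlaplace_def laplace_laurent)
    from nabla_nth[OF this] show ?thesis by (simp add: sum_2)
  qed
  moreover have "pd b a (\<lambda>Y. vlaplace f Y $ b) Z = 0" if "det Z = 0" for Z a b
    using that by (simp add: pd_def on_units_def)
  ultimately show ?thesis
    unfolding spaceU_def vec_eq_iff
    by (auto; metis (mono_tags, lifting) mult_eq_0_iff sum.neutral zero_neq_numeral)
qed

lemma spaceU'_iff:
  "f \<in> spaceU' \<longleftrightarrow> f \<in> laurent_vectors \<and> (\<forall>Z a. (\<Sum>b\<in>UNIV. pd a b (\<lambda>Y. vlaplace f Y $ b) Z) = 0)"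
proof -
  have "nabla_right (box f) Z $ a = 2 * (\<Sum>b\<in>UNIV. pd a b (\<lambda>Y. vlaplace f Y $ b) Z)"
    if f: "f \<in> laurent_vectors" and Z: "det Z \<noteq> 0" for Z a
  proof -
    have "has_grad (\<lambda>Z. box f Z $ k) (\<chi> a b. pd a b (\<lambda>Y. vlaplace f Y $ k) Z) Z" for k
      by (rule has_grad_cong[OF has_grad_pd[OF _ Z] Z])
        (auto simp: vlaplace_laurent f laurent_vectorsD box_nth vlaplace_def laplace_laurent)
    from nabla_right_nth[OF this] show ?thesis by (simp add: sum_2)
  qed
  moreover have "pd a b (\<lambda>Y. vlaplace f Y $ b) Z = 0" if "det Z = 0" for Z a b
    using that by (simp add: pd_def on_units_def)
  ultimately show ?thesis
    unfolding spaceU'_def vec_eq_iff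
    by (auto; metis (mono_tags, lifting) mult_eq_0_iff sum.neutral zero_neq_numeral)
qed

lemma matrix_inv_left_inverse: "invertible A \<Longrightarrow> matrix_inv A ** A = mat 1"
  and matrix_inv_right_inverse: "invertible A \<Longrightarrow> A ** matrix_inv A = mat 1"
  using someI_ex[of "\<lambda>A'. A ** A' = mat 1 \<and> A' ** A = mat 1"]
  by (auto simp: invertible_def matrix_inv_def)

text \<open>For units \<open>Z\<close> multiplication by \<open>Z\<close> is injective, so \<open>\<nabla>\<close> may be replaced by its diagonalisable form.\<close>

lemma spaceU_iff_euler_dirac:
  "f \<in> spaceU \<longleftrightarrow> f \<in> laurent_vectors \<and> euler_dirac (vlaplace f) = 0"
proof -
  have "(\<forall>a. (\<Sum>b\<in>UNIV. pd b a (\<lambda>Y. vlaplace f Y $ b) Z) = 0) \<longleftrightarrow> euler_dirac (vlaplace f) Z = 0" for Z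
  proof
    assume "euler_dirac (vlaplace f) Z = 0"
    then have e: "Z *v (\<chi> a. \<Sum>b\<in>UNIV. pd b a (\<lambda>Y. vlaplace f Y $ b) Z) = 0"
      by (simp add: euler_dirac_def)
    show "\<forall>a. (\<Sum>b\<in>UNIV. pd b a (\<lambda>Y. vlaplace f Y $ b) Z) = 0"
    proof (cases "det Z = 0")
      case True
      then show ?thesis by (simp add: pd_def on_units_def)
    next
      case False
      then have "invertible Z" by (simp add: invertible_det_nz)
      then have "matrix_inv Z *v (Z *v v) = v" for v
        using matrix_inv_left_inverse[of Z] by (simp add: matrix_vector_mul_assoc)
      from this[of "\<chi> a. \<Sum>b\<in>UNIV. pd b a (\<lambda>Y. vlaplace f Y $ b) Z"] show ?thesis
        unfolding e by (simp add: vec_eq_iff)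
    qed
  qed (simp add: euler_dirac_def zero_vec_def[symmetric] matrix_vector_mult_0_right)
  then show ?thesis unfolding spaceU_iff by (auto simp: fun_eq_iff)
qed

lemma euler_dirac_add: "f \<in> laurent_vectors \<Longrightarrow> g \<in> laurent_vectors \<Longrightarrow>
    euler_dirac (f + g) = euler_dirac f + euler_dirac g"
  by (simp add: fun_eq_iff euler_dirac_def vec_eq_iff matrix_vector_mult_def pd_add laurent_vectorsD
      sum.distrib algebra_simps)

lemma euler_dirac_scale: "f \<in> laurent_vectors \<Longrightarrow>
    euler_dirac (scale_fun c f) = scale_fun c (euler_dirac f)"
  by (simp add: fun_eq_iff euler_dirac_def vec_eq_iff matrix_vector_mult_def pd_scale laurent_vectorsD
      scale_fun_def sum_distrib_left mult.left_commute)

lemma vlaplace_add: "f \<in> laurent_vectors \<Longrightarrow> g \<in> laurent_vectors \<Longrightarrow> vlaplace (f + g) = vlaplace f + vlaplace g"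
  by (simp add: fun_eq_iff vlaplace_def vec_eq_iff laplace_add laurent_vectorsD)

lemma vlaplace_scale: "f \<in> laurent_vectors \<Longrightarrow> vlaplace (scale_fun c f) = scale_fun c (vlaplace f)"
  by (simp add: fun_eq_iff vlaplace_def vec_eq_iff laplace_scale laurent_vectorsD scale_fun_def)

interpretation fs: vector_space scale_fun by (rule vector_space_scale_fun)

lemma subspace_laurent_vectors: "fs.subspace laurent_vectors"
  unfolding fs.subspace_def
  by (auto simp: laurent_vectors_def scale_fun_def laurent_zero intro: laurent_ring.add laurent_scale)

abbreviation lincomb :: "('a \<Rightarrow> 'v \<Rightarrow> 'w) \<Rightarrow> ('i \<Rightarrow> 'v) \<Rightarrow> 'i set \<Rightarrow> ('i \<Rightarrow> 'a) \<Rightarrow> 'w::comm_monoid_add" where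
  "lincomb s e I c \<equiv> \<Sum>x\<in>I. s (c x) (e x)"

lemma linear_on_sum:
  assumes s: "vector_space s" and t: "vector_space t" and W: "module.subspace s W" and lin: "linear_on s t W \<phi>"
    and e: "\<And>x. x \<in> I \<Longrightarrow> e x \<in> W"
  shows "\<phi> (lincomb s e I c) = (\<Sum>x\<in>I. t (c x) (\<phi> (e x)))"
proof -
  interpret S: vector_space s by (rule s)
  interpret T: vector_space t by (rule t)
  have W: "S.subspace W" by (rule W)
  have "\<phi> (s 0 0) = t 0 (\<phi> 0)" using lin S.subspace_0[OF W] unfolding linear_on_def by blast
  then have 0: "\<phi> 0 = 0" by simp
  have add: "\<phi> (v + w) = \<phi> v + \<phi> w" if "v \<in> W" "w \<in> W" for v w
    using lin that unfolding linear_on_def by blast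
  have sc: "\<phi> (s a v) = t a (\<phi> v)" if "v \<in> W" for a v
    using lin that unfolding linear_on_def by blast
  show ?thesis using e
  proof (induction I rule: infinite_finite_induct)
    case (insert x I)
    have "\<phi> (lincomb s e I c) = (\<Sum>x\<in>I. t (c x) (\<phi> (e x)))"
      by (rule insert.IH) (use insert.prems in blast)
    moreover have "\<phi> (s (c x) (e x) + lincomb s e I c) = \<phi> (s (c x) (e x)) + \<phi> (lincomb s e I c)"
      using insert.prems by (intro add S.subspace_sum[OF W] S.subspace_scale[OF W]) blast+
    moreover have "\<phi> (s (c x) (e x)) = t (c x) (\<phi> (e x))"
      using insert.prems by (intro sc) blast
    ultimately show ?case by (simp only: sum.insert[OF insert.hyps])
  qed (simp_all only: sum.empty sum.infinite not_False_eq_True 0)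
qed

lemma linear_sum_laurent:
  assumes "\<And>f g. f \<in> laurent_vectors \<Longrightarrow> g \<in> laurent_vectors \<Longrightarrow> T (f + g) = T f + T g"
    and "\<And>c f. f \<in> laurent_vectors \<Longrightarrow> T (scale_fun c f) = scale_fun c (T f)"
    and "\<And>x. x \<in> I \<Longrightarrow> e x \<in> laurent_vectors"
  shows "T (lincomb scale_fun e I c) = (\<Sum>x\<in>I. scale_fun (c x) (T (e x)))"
proof (rule linear_on_sum[OF vector_space_scale_fun vector_space_scale_fun subspace_laurent_vectors _ assms(3)])
  show "linear_on scale_fun scale_fun laurent_vectors T"
    using assms(1,2) unfolding linear_on_def by blast
qed

section \<open>A basis of eigenvectors\<close>

type_synonym idx = "bool \<times> int \<times> nat \<times> int \<times> int"

text \<open>Up to the power \<open>N\<^sup>r\<close>, the first family consists of the coefficients of \<open>(x\<^sub>2, - x\<^sub>1)\<^sup>T (x Z y)\<^sup>m\<close> for a row \<open>x\<close> and a column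
\<open>y\<close>, the second one, up to a scalar, of those of \<open>Z y (x Z y)\<^sup>m\<^sup>-\<^sup>1\<close>. They realise the two summands of
\<open>V\<^sub>m\<^sub>/\<^sub>2 \<otimes> V\<^sub>1\<^sub>/\<^sub>2\<close> in the left factor. The first index runs up to \<open>m + 1\<close> and \<open>m - 1\<close>, respectively,
the second one up to \<open>m\<close>.\<close>

fun bvec :: "idx \<Rightarrow> HC \<Rightarrow> complex^2" where
  "bvec (True, r, m, i, j) = (\<lambda>Z. vector [Nmcoeff r m i j Z, - Nmcoeff r m (i - 1) j Z])"
| "bvec (False, r, m, i, j) = (\<lambda>Z. vector [of_int (i + 1) * Nmcoeff r m (i + 1) j Z,
      of_int (int m - i) * Nmcoeff r m i j Z])"

lemma bvec_laurent: "bvec x \<in> laurent_vectors"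
proof -
  obtain k r m i j where x: "x = (k, r, m, i, j)" by (metis prod.exhaust)
  show ?thesis unfolding x laurent_vectors_def
    by (cases k) (auto simp: forall_2 intro: Nmcoeff_laurent laurent_scale laurent_scale[of _ "- 1", simplified])
qed

fun dirac_eigenvalue :: "idx \<Rightarrow> int" where
  "dirac_eigenvalue (k, r, m, i, j) = (if k then r else r + int m + 1)"

text \<open>At \<open>r = 0\<close> the first family is annihilated by \<open>\<nabla>\<close>, so that for general \<open>r\<close> only the derivative of \<open>N\<^sup>r\<close>
contributes. The two eigenvalues differ by \<open>m + 1\<close>, which tells the families apart.\<close>

lemma euler_dirac_bvec: "euler_dirac (bvec x) = scale_fun (of_int (dirac_eigenvalue x)) (bvec x)"
proof
  fix Z
  show "euler_dirac (bvec x) Z = scale_fun (of_int (dirac_eigenvalue x)) (bvec x) Z"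
  proof (cases "det Z = 0")
    case True
    then have "euler_dirac (bvec x) Z = 0"
      by (simp add: euler_dirac_def pd_def on_units_def zero_vec_def[symmetric] matrix_vector_mult_0_right)
    then show ?thesis using laurent_vectors_eq_0[OF bvec_laurent True] by (simp add: scale_fun_def)
  next
    case False
    obtain k r m i j where x: "x = (k, r, m, i, j)" by (metis prod.exhaust)
    have e: "euler_dirac f Z = vector
        [(Z $ 1 $ 1 * pd 1 1 (\<lambda>Y. f Y $ 1) Z + Z $ 1 $ 2 * pd 1 2 (\<lambda>Y. f Y $ 1) Z)
          + (Z $ 1 $ 1 * pd 2 1 (\<lambda>Y. f Y $ 2) Z + Z $ 1 $ 2 * pd 2 2 (\<lambda>Y. f Y $ 2) Z),
         (Z $ 2 $ 1 * pd 1 1 (\<lambda>Y. f Y $ 1) Z + Z $ 2 $ 2 * pd 1 2 (\<lambda>Y. f Y $ 1) Z)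
          + (Z $ 2 $ 1 * pd 2 1 (\<lambda>Y. f Y $ 2) Z + Z $ 2 $ 2 * pd 2 2 (\<lambda>Y. f Y $ 2) Z)]" for f
      by (simp add: euler_dirac_def vec_eq_iff forall_2 matrix_vector_mult_def sum_2 algebra_simps)
    show ?thesis
    proof (cases k)
      case True
      have n: "pd a b (\<lambda>Y. - Nmcoeff r m (i - 1) j Y) Z = - pd a b (Nmcoeff r m (i - 1) j) Z" for a b
        using pd_scale[OF Nmcoeff_laurent, of a b "- 1"] by simp
      have *: "- (t * p) - u * q = - (t * p + u * q)" for t p u q :: complex
        by simp
      show ?thesis
        using True unfolding e x
        by (simp add: n scale_fun_def vec_eq_iff forall_2 *
            Nmcoeff_row[OF False, of r m i j] Nmcoeff_row[OF False, of r m "i - 1" j])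
          (simp add: algebra_simps)
    next
      case k: False
      have *: "t * (c * p) + u * (c * q) = c * (t * p + u * q)" for t c p u q :: complex
        by (simp add: algebra_simps)
      show ?thesis
        using k unfolding e x
        by (simp add: pd_scale[OF Nmcoeff_laurent] scale_fun_def vec_eq_iff forall_2 *
            Nmcoeff_row[OF False, of r m i j] Nmcoeff_row[OF False, of r m "i + 1" j])
          (simp add: algebra_simps)
    qed
  qed
qed

lemma vlaplace_bvec: "vlaplace (bvec (k, r, m, i, j)) =
   scale_fun (of_int (4 * r * (r + 1 + int m))) (bvec (k, r - 1, m, i, j))"
proof -
  have n: "laplace (\<lambda>Y. - Nmcoeff r m (i - 1) j Y) Z = - laplace (Nmcoeff r m (i - 1) j) Z" for Z
    using laplace_scale[OF Nmcoeff_laurent, of "- 1"] by simp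
  show ?thesis
    by (cases k) (simp_all add: fun_eq_iff vlaplace_def vec_eq_iff forall_2 laplace_Nmcoeff_eq n scale_fun_def
        laplace_scale[OF Nmcoeff_laurent])
qed

text \<open>A subspace that is stable under enough diagonal operators contains the components of each of its
elements: multiplying by \<open>(T - w y) / (w x - w y)\<close> removes the component \<open>y\<close> and keeps \<open>x\<close>.
For the zero subspace this is the independence of eigenvectors, for a submodule it is the first half of a proof of irreducibility.\<close>

lemma (in vector_space) separated_component_mem:
  assumes W: "subspace W" and I: "finite I"
    and sep: "\<And>x y. x \<in> I \<Longrightarrow> y \<in> I \<Longrightarrow> x \<noteq> y \<Longrightarrow>
      \<exists>w. w x \<noteq> w y \<and> (\<forall>c. lincomb scale e I c \<in> W \<longrightarrow> (\<Sum>z\<in>I. scale (c z * w z) (e z)) \<in> W)"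
    and mem: "lincomb scale e I c \<in> W" and x: "x \<in> I"
  shows "scale (c x) (e x) \<in> W"
proof -
  have "\<exists>c'. c' x = c x \<and> (\<forall>y\<in>J. c' y = 0) \<and> (lincomb scale e I c') \<in> W"
    if "finite J" "J \<subseteq> I - {x}" for J
    using that
  proof (induction J rule: finite_induct)
    case empty
    show ?case using mem by auto
  next
    case (insert y J)
    then obtain c' where c': "c' x = c x" "\<forall>y\<in>J. c' y = 0" "lincomb scale e I c' \<in> W"
      by auto
    obtain w where w: "w x \<noteq> w y"
      "lincomb scale e I c' \<in> W \<longrightarrow> (\<Sum>z\<in>I. scale (c' z * w z) (e z)) \<in> W"
      using sep[OF x, of y] insert.prems by blast
    define c'' where "c'' z = c' z * (w z - w y) / (w x - w y)" for z
    have "scale (c'' z) (e z) = scale (1 / (w x - w y))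
        (scale (c' z * w z) (e z) - scale (w y) (scale (c' z) (e z)))" for z
      unfolding scale_scale scale_left_diff_distrib[symmetric]
      by (simp add: c''_def right_diff_distrib mult.commute diff_divide_distrib)
    then have "lincomb scale e I c'' = scale (1 / (w x - w y))
       ((\<Sum>z\<in>I. scale (c' z * w z) (e z)) - scale (w y) (lincomb scale e I c'))"
      by (simp only: scale_sum_right sum_subtractf[symmetric])
    also have "\<dots> \<in> W" using w c'(3) by (intro subspace_scale subspace_diff W) auto
    finally show ?case using c' w by (intro exI[of _ c'']) (auto simp: c''_def)
  qed
  from this[of "I - {x}"] obtain c' where c': "c' x = c x" "\<forall>y\<in>I - {x}. c' y = 0"
    "lincomb scale e I c' \<in> W" using I by auto
  have "lincomb scale e I c' = scale (c x) (e x)"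
    using c' x I by (simp add: sum.remove[of I x])
  then show ?thesis using c'(3) by simp
qed

lemma Nmcoeff_scale_rows_cols:
  assumes "x $ 1 \<noteq> 0" "x $ 2 \<noteq> 0" "y $ 1 \<noteq> 0" "y $ 2 \<noteq> 0"
  shows "Nmcoeff r m i j (\<chi> a b. x $ a * y $ b * Z $ a $ b) =
     x $ 1 powi (r + i) * x $ 2 powi (r + int m - i) * y $ 1 powi (r + j) * y $ 2 powi (r + int m - j)
       * Nmcoeff r m i j Z"
proof -
  have d: "det (\<chi> a b. x $ a * y $ b * Z $ a $ b) = x $ 1 * x $ 2 * y $ 1 * y $ 2 * det Z"
    by (simp add: det_2 algebra_simps)
  have p: "t powi (r + int m - k) = t powi r * t powi (int m - k)" if "t \<noteq> 0" for t :: complex and k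
    using power_int_add[of t r "int m - k"] that by (simp add: add_diff_eq)
  show ?thesis
    using assms
    by (simp add: Nmcoeff_def on_units_def d mcoeff_scale_rows_cols power_int_mult_distrib p power_int_add)
qed

fun row_weight1 row_weight2 col_weight :: "idx \<Rightarrow> int" where
  "row_weight1 (k, r, m, i, j) = r + i + (if k then 0 else 1)"
| "row_weight2 (k, r, m, i, j) = r + int m - i + (if k then 1 else 0)"
| "col_weight (k, r, m, i, j) = r + j"

text \<open>The action of the diagonal matrices \<open>x\<close> and \<open>y\<close> from the left and the right, including the action on the column \<open>f\<close>.
The entries of \<open>x\<close> appear exchanged in front because \<open>f\<close> is multiplied by the adjugate of \<open>x\<close>.\<close>

definition torus :: "complex^2 \<Rightarrow> complex^2 \<Rightarrow> (HC \<Rightarrow> complex^2) \<Rightarrow> HC \<Rightarrow> complex^2" where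
  "torus x y f Z = vector [x $ 2 * f (\<chi> a b. x $ a * y $ b * Z $ a $ b) $ 1,
      x $ 1 * f (\<chi> a b. x $ a * y $ b * Z $ a $ b) $ 2]"

lemma torus_bvec:
  assumes "x $ 1 \<noteq> 0" "x $ 2 \<noteq> 0" "y $ 1 \<noteq> 0" "y $ 2 \<noteq> 0"
  shows "torus x y (bvec v) = scale_fun (x $ 1 powi row_weight1 v * x $ 2 powi row_weight2 v *
     y $ 1 powi col_weight v * y $ 2 powi (row_weight1 v + row_weight2 v - 1 - col_weight v)) (bvec v)"
proof -
  obtain k r m i j where v: "v = (k, r, m, i, j)" by (metis prod.exhaust)
  have s: "t * t powi n = t powi (n + 1)" if "t \<noteq> 0" for t :: complex and n
    using that by (simp add: power_int_add_1')
  have a: "r + int m - i - 1 + 1 = r + int m - i" "r + (i - 1) + 1 = r + i"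
    "r + int m - (i - 1) = r + int m - i + 1" "r + int m - (i + 1) = r + int m - i - 1"
    "r + (i + 1) = r + i + 1" "r + i + (r + int m - i + 1) - 1 - (r + j) = r + int m - j"
    "r + i + 1 + (r + int m - i) - 1 - (r + j) = r + int m - j" by simp_all
  have t1: "x $ 1 powi (n + 1) = x $ 1 * x $ 1 powi n" "x $ 2 powi (n + 1) = x $ 2 * x $ 2 powi n" for n
    using s assms by simp_all
  have t2: "x $ 1 powi (r + i) = x $ 1 * x $ 1 powi (r + (i - 1))"
    "x $ 2 powi (r + int m - i) = x $ 2 * x $ 2 powi (r + int m - i - 1)"
    using t1(1)[of "r + (i - 1)"] t1(2)[of "r + int m - i - 1"] by simp_all
  show ?thesis
  proof (cases k)
    case True
    then show ?thesis unfolding v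
      by (simp add: fun_eq_iff vec_eq_iff forall_2 torus_def scale_fun_def Nmcoeff_scale_rows_cols[OF assms] a)
        (simp add: t1 t2 add_diff_eq)
  next
    case False
    then show ?thesis unfolding v
      by (simp add: fun_eq_iff vec_eq_iff forall_2 torus_def scale_fun_def Nmcoeff_scale_rows_cols[OF assms] a)
        (simp add: t1 t2 add_diff_eq)
  qed
qed

lemma torus_linear: "torus x y (f + g) = torus x y f + torus x y g"
  "torus x y (scale_fun c f) = scale_fun c (torus x y f)"
  by (simp_all add: fun_eq_iff torus_def vec_eq_iff forall_2 scale_fun_def algebra_simps)

definition valid :: "idx set" where
  "valid = {(k, r, m, i, j). 0 \<le> i \<and> i \<le> (if k then int m + 1 else int m - 1) \<and> 0 \<le> j \<and> j \<le> int m}"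

lemma bvec_nonzero: "v \<in> valid \<Longrightarrow> bvec v \<noteq> 0"
proof -
  assume v: "v \<in> valid"
  obtain k r m i j where e: "v = (k, r, m, i, j)" by (metis prod.exhaust)
  define Z :: HC where "Z = vector [vector [2, 1], vector [1, 1]]"
  have "det Z = 1" by (simp add: Z_def det_2)
  then have pos: "Nmcoeff r m i j Z \<noteq> 0" if "0 \<le> i" "i \<le> int m" "0 \<le> j" "j \<le> int m" for i j
    using mcoeff_positive[of Z m i j] that by (auto simp: Nmcoeff_def Z_def)
  show "bvec v \<noteq> 0"
  proof
    assume "bvec v = 0"
    then have 0: "bvec v Z $ 1 = 0" "bvec v Z $ 2 = 0" by simp_all
    show False
    \<comment> \<open>At the top index of the first family only the second component is nonzero.\<close>
    proof (cases "k \<and> i = int m + 1")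
      case True
      then show ?thesis using 0 v pos[of "i - 1" j] by (simp add: e valid_def)
    next
      case False
      have "0 \<le> i" "i \<le> int m" "0 \<le> j" "j \<le> int m"
        using v False by (auto simp: e valid_def split: if_splits)
      note nz = pos[OF this]
      show ?thesis
      proof (cases k)
        case True
        then show ?thesis using 0(1) nz by (simp add: e)
      next
        case False
        then have "of_int (int m - i) \<noteq> (0 :: complex)" using v unfolding of_int_eq_0_iff by (simp add: e valid_def)
        moreover have "of_int (int m - i) * Nmcoeff r m i j Z = 0" using 0(2) False by (simp add: e)
        ultimately show ?thesis using nz by simp
      qed
    qed
  qed
qed

lemma powi_2_inj: "(2 :: complex) powi a = 2 powi b \<longleftrightarrow> a = b"
proof
  assume "(2 :: complex) powi a = 2 powi b"
  then have "norm ((2 :: complex) powi a) = norm ((2 :: complex) powi b)" by simp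
  then have "(2 :: real) powi a = 2 powi b" by (simp add: norm_power_int)
  then show "a = b"
    using power_int_strict_increasing[of a b "2 :: real"] power_int_strict_increasing[of b a "2 :: real"]
    by (cases a b rule: linorder_cases) auto
qed simp

text \<open>Together the three weights and the eigenvalue of \<open>Z \<nabla>\<close> determine the index. Only the comparison of the two families needs an argument:
for equal degrees \<open>d = 2 r + m\<close> and equal eigenvalues \<open>r = r' + m' + 1\<close> one would get \<open>m + m' + 2 = 0\<close>.\<close>

lemma weights_separate:
  assumes "v \<in> valid" "v' \<in> valid" "row_weight1 v = row_weight1 v'" "row_weight2 v = row_weight2 v'"
    "col_weight v = col_weight v'" "dirac_eigenvalue v = dirac_eigenvalue v'"
  shows "v = v'"
proof -
  obtain k r m i j where v: "v = (k, r, m, i, j)" by (metis prod.exhaust)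
  obtain k' r' m' i' j' where v': "v' = (k', r', m', i', j')" by (metis prod.exhaust)
  show ?thesis using assms unfolding v v' by (cases k; cases k') auto
qed

lemma bvec_independent:
  assumes I: "finite I" "I \<subseteq> valid" and 0: "lincomb scale_fun bvec I c = 0" and v: "v \<in> I"
  shows "c v = 0"
proof -
  have "scale_fun (c v) (bvec v) \<in> {0}"
  proof (rule fs.separated_component_mem[where I = I])
    fix x y assume xy: "x \<in> I" "y \<in> I" "x \<noteq> y"
    have T: "(\<forall>c. lincomb scale_fun bvec I c \<in> {0} \<longrightarrow> (\<Sum>z\<in>I. scale_fun (c z * w z) (bvec z)) \<in> {0})"
      if T: "\<And>f g. f \<in> laurent_vectors \<Longrightarrow> g \<in> laurent_vectors \<Longrightarrow> T (f + g) = T f + T g"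
        "\<And>c f. f \<in> laurent_vectors \<Longrightarrow> T (scale_fun c f) = scale_fun c (T f)"
        and w: "\<And>v. T (bvec v) = scale_fun (w v) (bvec v)" for T w
    proof (intro allI impI)
      fix c assume "lincomb scale_fun bvec I c \<in> {0}"
      then have "lincomb scale_fun bvec I c = 0" by blast
      moreover have "T (lincomb scale_fun bvec I c) = (\<Sum>z\<in>I. scale_fun (c z) (T (bvec z)))"
        by (intro linear_sum_laurent T bvec_laurent)
      moreover have "T 0 = 0" 
        using linear_sum_laurent[of T "{}" bvec "\<lambda>_. 0", OF T bvec_laurent] by (simp only: sum.empty)
      ultimately show "(\<Sum>z\<in>I. scale_fun (c z * w z) (bvec z)) \<in> {0}"
        unfolding w fs.scale_scale by simp
    qed
    \<comment> \<open>A diagonal matrix with a single entry \<open>2\<close> and otherwise ones detects the corresponding weight.\<close>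
    consider "row_weight1 x \<noteq> row_weight1 y" | "row_weight2 x \<noteq> row_weight2 y"
      | "col_weight x \<noteq> col_weight y" | "dirac_eigenvalue x \<noteq> dirac_eigenvalue y"
      using weights_separate xy I by blast
    then show "\<exists>w. w x \<noteq> w y \<and> (\<forall>c. lincomb scale_fun bvec I c \<in> {0} \<longrightarrow> (\<Sum>z\<in>I. scale_fun (c z * w z) (bvec z)) \<in> {0})"
    proof cases
      case 1
      show ?thesis by (rule exI, rule conjI[rotated], rule T[OF torus_linear torus_bvec[where x = "vector [2, 1]" and y = "vector [1, 1]"]]) (use 1 in \<open>simp_all add: powi_2_inj\<close>)
    next
      case 2
      show ?thesis by (rule exI, rule conjI[rotated], rule T[OF torus_linear torus_bvec[where x = "vector [1, 2]" and y = "vector [1, 1]"]]) (use 2 in \<open>simp_all add: powi_2_inj\<close>)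
    next
      case 3
      show ?thesis by (rule exI, rule conjI[rotated], rule T[OF torus_linear torus_bvec[where x = "vector [1, 1]" and y = "vector [2, 1]"]]) (use 3 in \<open>simp_all add: powi_2_inj\<close>)
    next
      case 4
      show ?thesis
        by (rule exI, rule conjI[rotated], rule T[OF euler_dirac_add euler_dirac_scale euler_dirac_bvec]) (use 4 in simp_all)
    qed
  qed (use assms in simp_all)
  then have "scale_fun (c v) (bvec v) = 0" by simp
  then show ?thesis using bvec_nonzero[of v] v I by (simp only: fs.scale_eq_0_iff) blast
qed

text \<open>The span is built up one term at a time, which avoids finite index sets in the inductions that follow.\<close>

inductive_set Nmcoeff_span :: "(HC \<Rightarrow> complex) set" where
  zero: "(\<lambda>Z. 0) \<in> Nmcoeff_span"
| add: "g \<in> Nmcoeff_span \<Longrightarrow> (\<lambda>Z. c * Nmcoeff r m i j Z + g Z) \<in> Nmcoeff_span"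

lemma Nmcoeff_span_Nmcoeff: "(\<lambda>Z. c * Nmcoeff r m i j Z) \<in> Nmcoeff_span"
  using Nmcoeff_span.add[OF Nmcoeff_span.zero, of c r m i j] by simp

lemma Nmcoeff_span_add: "g \<in> Nmcoeff_span \<Longrightarrow> h \<in> Nmcoeff_span \<Longrightarrow> (\<lambda>Z. g Z + h Z) \<in> Nmcoeff_span"
  by (induction rule: Nmcoeff_span.induct) (auto simp: add.assoc intro: Nmcoeff_span.add)

lemma Nmcoeff_span_scale: "g \<in> Nmcoeff_span \<Longrightarrow> (\<lambda>Z. c * g Z) \<in> Nmcoeff_span"
  by (induction rule: Nmcoeff_span.induct)
    (auto simp: distrib_left mult.assoc[symmetric] intro: Nmcoeff_span.intros)

lemma Nmcoeff_span_mult: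
  assumes "\<And>r m i j. (\<lambda>Z. h Z * Nmcoeff r m i j Z) \<in> Nmcoeff_span" and "g \<in> Nmcoeff_span"
  shows "(\<lambda>Z. h Z * g Z) \<in> Nmcoeff_span"
  using assms(2)
proof (induction rule: Nmcoeff_span.induct)
  case zero
  show ?case by (simp add: Nmcoeff_span.zero)
next
  case (add g c r m i j)
  have "(\<lambda>Z. c * (h Z * Nmcoeff r m i j Z) + h Z * g Z) \<in> Nmcoeff_span"
    by (intro Nmcoeff_span_add Nmcoeff_span_scale add assms)
  then show ?case by (simp add: algebra_simps)
qed

lemma Nmcoeff_span_entry: "(\<lambda>Z. on_units (\<lambda>Z. Z $ a $ b) Z * Nmcoeff r m i j Z) \<in> Nmcoeff_span"
proof -
  have *: "(\<lambda>Z. on_units (\<lambda>Z. Z $ a $ b) Z * Nmcoeff r m i j Z) \<in> Nmcoeff_span"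
    if e: "\<And>Z. (of_nat (Suc m))\<^sup>2 * (Z $ a $ b * mcoeff m i j Z) =
        p * mcoeff (Suc m) i' j' Z + q * det Z * mcoeff (m - 1) i'' j'' Z" for p q i' j' i'' j''
  proof -
    have "on_units (\<lambda>Z. Z $ a $ b) Z * Nmcoeff r m i j Z = 
      p / (of_nat (Suc m))\<^sup>2 * Nmcoeff r (Suc m) i' j' Z + q / (of_nat (Suc m))\<^sup>2 * Nmcoeff (r + 1) (m - 1) i'' j'' Z" for Z
    proof (cases "det Z = 0")
      case False
      have "(of_nat (Suc m))\<^sup>2 \<noteq> (0 :: complex)" by (simp del: of_nat_Suc)
      then have "Z $ a $ b * mcoeff m i j Z = p / (of_nat (Suc m))\<^sup>2 * mcoeff (Suc m) i' j' Z
          + q / (of_nat (Suc m))\<^sup>2 * det Z * mcoeff (m - 1) i'' j'' Z"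
        using e[of Z] by (simp add: field_simps del: of_nat_Suc mcoeff.simps)
      then have "det Z powi r * (Z $ a $ b * mcoeff m i j Z) = det Z powi r * (p / (of_nat (Suc m))\<^sup>2 * mcoeff (Suc m) i' j' Z
          + q / (of_nat (Suc m))\<^sup>2 * det Z * mcoeff (m - 1) i'' j'' Z)" by simp
      then show ?thesis using False
        by (simp add: Nmcoeff_def power_int_add_1 del: of_nat_Suc mcoeff.simps) (simp add: algebra_simps del: of_nat_Suc mcoeff.simps)
    qed (simp add: on_units_def Nmcoeff_def)
    then show ?thesis by (simp only: Nmcoeff_span.add Nmcoeff_span_Nmcoeff)
  qed
  have "\<exists>p q i' j' i'' j''. \<forall>Z. (of_nat (Suc m))\<^sup>2 * (Z $ a $ b * mcoeff m i j Z) =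
        p * mcoeff (Suc m) i' j' Z + q * det Z * mcoeff (m - 1) i'' j'' Z"
  proof -
    have neg: "u - p * q * d * t = u + (- (p * q)) * d * t" for u p q d t :: complex by simp
    consider "a = 1" "b = 1" | "a = 1" "b = 2" | "a = 2" "b = 1" | "a = 2" "b = 2"
      using exhaust_2[of a] exhaust_2[of b] by blast
    then show ?thesis
    proof cases
      case 1
      show ?thesis unfolding 1 mult_z11 by (intro exI allI) (rule refl)
    next
      case 2
      show ?thesis unfolding 2 mult_z12 neg by (intro exI allI) (rule refl)
    next
      case 3
      show ?thesis unfolding 3 mult_z21 neg by (intro exI allI) (rule refl)
    next
      case 4
      show ?thesis unfolding 4 mult_z22 by (intro exI allI) (rule refl)
    qed
  qed
  then show ?thesis using * by blast
qed

text \<open>By the Clebsch-Gordan rules the span is stable under multiplication with every generator of the Laurent ring, hence with every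
element, and it contains the constant function \<open>1\<close>.\<close>

lemma laurent_ring_subset_Nmcoeff_span: "g \<in> laurent_ring \<Longrightarrow> g \<in> Nmcoeff_span"
proof -
  assume g: "g \<in> laurent_ring"
  have "\<forall>h\<in>Nmcoeff_span. (\<lambda>Z. g Z * h Z) \<in> Nmcoeff_span"
    using g
  proof (induction rule: laurent_ring.induct)
    case (const c)
    have "on_units (\<lambda>Z. c) Z * Nmcoeff r m i j Z = c * Nmcoeff r m i j Z" for r m i j Z
      by (simp add: on_units_def Nmcoeff_def)
    then have *: "(\<lambda>Z. on_units (\<lambda>Z. c) Z * Nmcoeff r m i j Z) \<in> Nmcoeff_span" for r m i j
      by (simp only: Nmcoeff_span_Nmcoeff)
    show ?case by (rule ballI, rule Nmcoeff_span_mult[OF *])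
  next
    case (coord j)
    obtain K where K: "coord j = pairing K" using coord_eq_pairing[OF coord] by blast
    have "(\<lambda>Z. K $ a $ b * (on_units (\<lambda>Z. Z $ a $ b) Z * Nmcoeff r m i l Z)) \<in> Nmcoeff_span" for a b r m i l
      by (intro Nmcoeff_span_scale Nmcoeff_span_entry)
    then have "(\<lambda>Z. K $ 1 $ 1 * (on_units (\<lambda>Z. Z $ 1 $ 1) Z * Nmcoeff r m i l Z)
        + K $ 1 $ 2 * (on_units (\<lambda>Z. Z $ 1 $ 2) Z * Nmcoeff r m i l Z)
        + K $ 2 $ 1 * (on_units (\<lambda>Z. Z $ 2 $ 1) Z * Nmcoeff r m i l Z)
        + K $ 2 $ 2 * (on_units (\<lambda>Z. Z $ 2 $ 2) Z * Nmcoeff r m i l Z)) \<in> Nmcoeff_span" for r m i l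
      by (intro Nmcoeff_span_add)
    moreover have "K $ 1 $ 1 * (on_units (\<lambda>Z. Z $ 1 $ 1) Z * Nmcoeff r m i l Z)
        + K $ 1 $ 2 * (on_units (\<lambda>Z. Z $ 1 $ 2) Z * Nmcoeff r m i l Z)
        + K $ 2 $ 1 * (on_units (\<lambda>Z. Z $ 2 $ 1) Z * Nmcoeff r m i l Z)
        + K $ 2 $ 2 * (on_units (\<lambda>Z. Z $ 2 $ 2) Z * Nmcoeff r m i l Z)
        = on_units (coord j) Z * Nmcoeff r m i l Z" for Z r m i l
      by (simp add: on_units_def K pairing_def algebra_simps)
    ultimately have *: "(\<lambda>Z. on_units (coord j) Z * Nmcoeff r m i l Z) \<in> Nmcoeff_span" for r m i l
      by simp
    show ?case by (rule ballI, rule Nmcoeff_span_mult[OF *])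
  next
    case inverse_det
    have "on_units (\<lambda>Z. inverse (det Z)) Z * Nmcoeff r m i j Z = 1 * Nmcoeff (r - 1) m i j Z" for r m i j Z
      using powi_minus1[of "det Z" r] by (simp add: on_units_def Nmcoeff_def)
    then have *: "(\<lambda>Z. on_units (\<lambda>Z. inverse (det Z)) Z * Nmcoeff r m i j Z) \<in> Nmcoeff_span" for r m i j
      using Nmcoeff_span_Nmcoeff[of 1] by simp
    show ?case by (rule ballI, rule Nmcoeff_span_mult[OF *])
  next
    case (add f g)
    then show ?case by (auto simp: distrib_right intro: Nmcoeff_span_add)
  next
    case (mult f g)
    then show ?case by (auto simp: mult.assoc)
  qed
  moreover have "(\<lambda>Z. 1 * Nmcoeff 0 0 0 0 Z) \<in> Nmcoeff_span" by (rule Nmcoeff_span_Nmcoeff)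
  moreover have "(\<lambda>Z. g Z * (1 * Nmcoeff 0 0 0 0 Z)) = g"
    using laurent_ring_unit_eq[OF g] by (auto simp: fun_eq_iff Nmcoeff_def on_units_def)
  ultimately show "g \<in> Nmcoeff_span" by metis
qed

text \<open>The functions \<open>(Nmcoeff r m i j, 0)\<close> and \<open>(0, Nmcoeff r m i j)\<close> are combinations of one vector of each family; the
determinant of this change of basis is \<open>m + 1\<close>.\<close>

lemma laurent_vectors_subset_span: "laurent_vectors \<subseteq> fs.span (bvec ` valid)"
proof -
  let ?S = "fs.span (bvec ` valid)"
  define emb :: "2 \<Rightarrow> (HC \<Rightarrow> complex) \<Rightarrow> HC \<Rightarrow> complex^2"
    where "emb k g Z = (\<chi> l. if l = k then g Z else 0)" for k g Z
  have val: "bvec v \<in> ?S" if "v \<in> valid" for v using that by (intro fs.span_base) auto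
  have b: "bvec (k, r, m, i, j) \<in> ?S" for k r m i j
  proof (cases "(k, r, m, i, j) \<in> valid")
    case False
    then have "bvec (k, r, m, i, j) = 0 \<or> \<not> k \<and> (i = - 1 \<or> i = int m)"
      by (cases k) (auto simp: valid_def fun_eq_iff vec_eq_iff forall_2 Nmcoeff_outside)
    moreover have "bvec (False, r, m, - 1, j) = 0" "bvec (False, r, m, int m, j) = 0"
      by (auto simp: fun_eq_iff vec_eq_iff forall_2 Nmcoeff_outside)
    ultimately show ?thesis using fs.span_zero by metis
  qed (rule val)
  have e: "emb k (Nmcoeff r m i j) \<in> ?S" for k r m i j
  proof -
    define M :: complex where "M = of_nat (Suc m)"
    have M: "M \<noteq> 0" unfolding M_def of_nat_eq_0_iff by simp
    have m: "of_nat m = M - 1" by (simp add: M_def)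
    have "emb 1 (Nmcoeff r m i j) = scale_fun ((M - of_int i) / M) (bvec (True, r, m, i, j))
      + scale_fun (1 / M) (bvec (False, r, m, i - 1, j))"
      using M by (simp add: fun_eq_iff vec_eq_iff forall_2 emb_def scale_fun_def m field_simps)
    moreover have "emb 2 (Nmcoeff r m i j) = scale_fun (1 / M) (bvec (False, r, m, i, j))
      + scale_fun (- (of_int i + 1) / M) (bvec (True, r, m, i + 1, j))"
      using M by (simp add: fun_eq_iff vec_eq_iff forall_2 emb_def scale_fun_def m field_simps)
    moreover have "scale_fun c (bvec (k, r, m, i, j)) + scale_fun c' (bvec (k', r', m', i', j')) \<in> ?S"
      for c c' k r m i j k' r' m' i' j' by (intro fs.span_add fs.span_scale b)
    ultimately show ?thesis using exhaust_2[of k] by metis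
  qed
  have emb: "emb k g \<in> ?S" if "g \<in> laurent_ring" for g k
    using laurent_ring_subset_Nmcoeff_span[OF that]
  proof (induction rule: Nmcoeff_span.induct)
    case zero
    have "emb k (\<lambda>Z. 0) = 0" by (simp add: fun_eq_iff vec_eq_iff emb_def)
    then show ?case using fs.span_zero by metis
  next
    case (add g c r m i j)
    have "emb k (\<lambda>Z. c * Nmcoeff r m i j Z + g Z) = scale_fun c (emb k (Nmcoeff r m i j)) + emb k g"
      by (simp add: fun_eq_iff vec_eq_iff emb_def scale_fun_def)
    moreover have "scale_fun c (emb k (Nmcoeff r m i j)) + emb k g \<in> ?S"
      by (intro fs.span_add fs.span_scale e add.IH)
    ultimately show ?case by metis
  qed
  show ?thesis
  proof
    fix f assume f: "f \<in> laurent_vectors"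
    have "f = emb 1 (\<lambda>Z. f Z $ 1) + emb 2 (\<lambda>Z. f Z $ 2)"
      by (simp add: fun_eq_iff vec_eq_iff emb_def forall_2)
    moreover have "\<dots> \<in> ?S" by (intro fs.span_add emb laurent_vectorsD f)
    ultimately show "f \<in> ?S" by metis
  qed
qed

section \<open>Homogeneous solutions\<close>

lemma sum_scale_fun_apply: "(lincomb scale_fun e I c) Z = (\<Sum>x\<in>I. c x *s e x Z)"
  by (induction I rule: infinite_finite_induct) (auto simp: scale_fun_def)

definition degree_of :: "idx \<Rightarrow> int" where
  "degree_of v = row_weight1 v + row_weight2 v - 1"

text \<open>Division by \<open>N\<close>, which is what \<open>\<box>\<close> does to a basis vector up to a scalar.\<close>

fun lower :: "idx \<Rightarrow> idx" where "lower (k, r, m, i, j) = (k, r - 1, m, i, j)"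

fun vlaplace_eigenvalue :: "idx \<Rightarrow> int" where
  "vlaplace_eigenvalue (k, r, m, i, j) = 4 * r * (r + 1 + int m)"

text \<open>The product of the eigenvalue of \<open>N \<box>\<close> and, after division by \<open>N\<close>, that of \<open>Z \<nabla> / 2\<close>. A basis vector solves
\<open>\<nabla> \<box> f = 0\<close> if and only if this number vanishes.\<close>

definition obstruction :: "idx \<Rightarrow> int" where
  "obstruction v = vlaplace_eigenvalue v * dirac_eigenvalue (lower v)"

lemma euler_dirac_vlaplace_bvec:
  "euler_dirac (vlaplace (bvec v)) = scale_fun (of_int (obstruction v)) (bvec (lower v))"
proof -
  obtain k r m i j where v: "v = (k, r, m, i, j)" by (metis prod.exhaust)
  have "vlaplace (bvec v) = scale_fun (of_int (vlaplace_eigenvalue v)) (bvec (lower v))"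
    unfolding v using vlaplace_bvec by simp
  then show ?thesis
    by (simp only: euler_dirac_scale[OF bvec_laurent] euler_dirac_bvec fs.scale_scale obstruction_def of_int_mult)
qed

lemma bvec_lower: "bvec v Z = det Z *s bvec (lower v) Z"
proof -
  obtain k r m i j where v: "v = (k, r, m, i, j)" by (metis prod.exhaust)
  have "Nmcoeff r m i j Z = det Z * Nmcoeff (r - 1) m i j Z" for i
    using powi_minus1[of "det Z" r] by (simp add: Nmcoeff_def on_units_def)
  then show ?thesis
    unfolding v by (cases k) (auto simp: vec_eq_iff forall_2)
qed

text \<open>Homogeneity expressed by a scalar matrix; the factor in front of \<open>f\<close> raises the exponent to \<open>d + 1\<close>.\<close>

lemma torus_scalar:
  assumes "f \<in> laurent_vectors" "homogeneous d f" "c \<noteq> 0"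
  shows "torus (vector [c, c]) (vector [1, 1]) f = scale_fun (c powi (d + 1)) f"
proof
  fix Z :: HC
  have e: "(\<chi> a b. vector [c, c] $ a * vector [1, 1] $ b * Z $ a $ b) = cscale c Z"
    by (simp add: vec_eq_iff forall_2)
  have "det (cscale c Z) = c * c * det Z" by (simp add: det_2 algebra_simps)
  then have "f (cscale c Z) = (c powi d) *s f Z"
    using assms laurent_vectors_eq_0[OF assms(1), of Z] laurent_vectors_eq_0[OF assms(1), of "cscale c Z"]
    by (cases "det Z = 0") (auto simp: homogeneous_def)
  then show "torus (vector [c, c]) (vector [1, 1]) f Z = scale_fun (c powi (d + 1)) f Z"
    using assms(3) unfolding torus_def e
    by (simp add: vec_eq_iff forall_2 scale_fun_def power_int_add_1')
qed

lemma homogeneous_bvec: "homogeneous (degree_of v) (bvec v)"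
  unfolding homogeneous_def
proof (intro allI impI)
  fix c and Z :: HC assume c: "(c :: complex) \<noteq> 0"
  have e: "(\<chi> a b. vector [c, c] $ a * vector [1, 1] $ b * Z $ a $ b) = cscale c Z"
    by (simp add: vec_eq_iff forall_2)
  have p: "c powi row_weight1 v * c powi row_weight2 v = c * c powi degree_of v"
    using c power_int_add_1'[of c "degree_of v"] by (simp add: degree_of_def power_int_add[symmetric])
  have "torus (vector [c, c]) (vector [1, 1]) (bvec v) Z = scale_fun (c * c powi degree_of v) (bvec v) Z"
    using torus_bvec[of "vector [c, c]" "vector [1, 1]" v] c by (simp add: p)
  then show "bvec v (cscale c Z) = (c powi degree_of v) *s bvec v Z"
    using c unfolding torus_def e by (simp add: vec_eq_iff forall_2 scale_fun_def)
qed

definition U_basis :: "int \<Rightarrow> idx set" where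
  "U_basis d = {v \<in> valid. degree_of v = d \<and> obstruction v = 0}"

lemma subspace_spaceU: "fs.subspace spaceU"
proof -
  have l0: "0 \<in> laurent_vectors" by (rule fs.subspace_0[OF subspace_laurent_vectors])
  have "euler_dirac (vlaplace (scale_fun 0 0)) = scale_fun 0 (euler_dirac (vlaplace 0))"
    by (simp only: vlaplace_scale[OF l0] euler_dirac_scale[OF vlaplace_laurent[OF l0]])
  then have "euler_dirac (vlaplace 0) = 0" by simp
  then show ?thesis
    unfolding fs.subspace_def Ball_def spaceU_iff_euler_dirac
    using fs.subspace_0[OF subspace_laurent_vectors] fs.subspace_add[OF subspace_laurent_vectors]
      fs.subspace_scale[OF subspace_laurent_vectors]
    by (simp add: vlaplace_add vlaplace_scale euler_dirac_add euler_dirac_scale vlaplace_laurent)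
qed

lemma subspace_U_deg: "fs.subspace (U_deg d)"
  using subspace_spaceU unfolding fs.subspace_def U_deg_def homogeneous_def
  by (auto simp: scale_fun_def vec_eq_iff algebra_simps)

lemma bvec_in_U_deg: "v \<in> U_basis d \<Longrightarrow> bvec v \<in> U_deg d"
  using homogeneous_bvec[of v]
  by (simp add: U_basis_def U_deg_def spaceU_iff_euler_dirac bvec_laurent euler_dirac_vlaplace_bvec)

lemma laurent_vectors_expansion:
  assumes "f \<in> laurent_vectors"
  obtains I c where "finite I" "I \<subseteq> valid" "f = lincomb scale_fun bvec I c"
proof -
  have "f \<in> fs.span (bvec ` valid)" using assms laurent_vectors_subset_span by blast
  then obtain T q where T: "finite T" "T \<subseteq> bvec ` valid" "f = (\<Sum>a\<in>T. scale_fun (q a) a)"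
    unfolding fs.span_explicit by blast
  obtain I where I: "I \<subseteq> valid" "inj_on bvec I" "T = bvec ` I"
    using T(2) by (meson subset_image_inj)
  have fin: "finite I" using T(1) I by (simp add: finite_image_iff)
  have "f = (\<Sum>v\<in>I. scale_fun (q (bvec v)) (bvec v))"
    unfolding T(3) I(3) by (simp add: sum.reindex[OF I(2)] o_def)
  then show thesis by (rule that[OF fin I(1)])
qed

text \<open>The operators \<open>N Z \<nabla> \<box>\<close> and the dilations are diagonal in the same basis, so the solutions of degree \<open>d\<close> are
spanned by the basis vectors that are themselves solutions of degree \<open>d\<close>.\<close>

lemma U_deg_eq:
  assumes fin: "finite (U_basis d)"
  shows "U_deg d = range (\<lambda>c. \<Sum>v\<in>U_basis d. scale_fun (c v) (bvec v))"
proof (intro equalityI subsetI)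
  fix f assume "f \<in> range (\<lambda>c. \<Sum>v\<in>U_basis d. scale_fun (c v) (bvec v))"
  then show "f \<in> U_deg d"
    by (auto intro!: fs.subspace_sum[OF subspace_U_deg] fs.subspace_scale[OF subspace_U_deg] bvec_in_U_deg)
next
  fix f assume f: "f \<in> U_deg d"
  then have L: "f \<in> laurent_vectors" and D: "euler_dirac (vlaplace f) = 0" and h: "homogeneous d f"
    by (auto simp: U_deg_def spaceU_iff_euler_dirac)
  obtain I c where I: "finite I" "I \<subseteq> valid" and fe: "f = lincomb scale_fun bvec I c"
    using laurent_vectors_expansion[OF L] by blast
  have deg: "degree_of v = d" if "v \<in> I" "c v \<noteq> 0" for v
  proof -
    \<comment> \<open>The dilation by \<open>2\<close> already determines the degree.\<close>
    define w where "w v = (2 :: complex) powi row_weight1 v * 2 powi row_weight2 v" for v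
    have "torus (vector [2, 2]) (vector [1, 1]) f = (\<Sum>v\<in>I. scale_fun (c v) (torus (vector [2, 2]) (vector [1, 1]) (bvec v)))"
      unfolding fe by (intro linear_sum_laurent torus_linear bvec_laurent)
    also have "\<dots> = (\<Sum>v\<in>I. scale_fun (c v * w v) (bvec v))"
      by (simp add: torus_bvec w_def)
    finally have "(\<Sum>v\<in>I. scale_fun (c v * w v) (bvec v)) = (\<Sum>v\<in>I. scale_fun (2 powi (d + 1)) (scale_fun (c v) (bvec v)))"
      unfolding torus_scalar[OF L h, of 2, simplified] fs.scale_sum_right[symmetric] fe[symmetric] by simp
    then have "(\<Sum>v\<in>I. scale_fun (c v * w v) (bvec v)) - (\<Sum>v\<in>I. scale_fun (2 powi (d + 1)) (scale_fun (c v) (bvec v))) = 0"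
      by simp
    then have "(\<Sum>v\<in>I. scale_fun (c v * w v - 2 powi (d + 1) * c v) (bvec v)) = 0"
      by (simp only: sum_subtractf[symmetric] fs.scale_scale fs.scale_left_diff_distrib)
    from bvec_independent[OF I this that(1)] have "w v = 2 powi (d + 1)" using that by simp
    then have "(2 :: complex) powi (row_weight1 v + row_weight2 v) = 2 powi (d + 1)"
      by (simp add: w_def power_int_add)
    then show ?thesis unfolding powi_2_inj by (simp add: degree_of_def)
  qed
  have obs: "obstruction v = 0" if "v \<in> I" "c v \<noteq> 0" for v
  proof -
    have "vlaplace f = (\<Sum>v\<in>I. scale_fun (c v) (vlaplace (bvec v)))"
      unfolding fe by (intro linear_sum_laurent vlaplace_add vlaplace_scale bvec_laurent)
    then have "euler_dirac (vlaplace f) = (\<Sum>v\<in>I. scale_fun (c v) (euler_dirac (vlaplace (bvec v))))"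
      using linear_sum_laurent[OF euler_dirac_add euler_dirac_scale vlaplace_laurent[OF bvec_laurent]] by simp
    then have 0: "(\<Sum>v\<in>I. scale_fun (c v * of_int (obstruction v)) (bvec (lower v))) = 0"
      unfolding D euler_dirac_vlaplace_bvec by simp
    \<comment> \<open>Multiplication by \<open>N\<close> undoes the shift of \<open>r\<close>, so that independence can be applied.\<close>
    have "(\<Sum>v\<in>I. scale_fun (c v * of_int (obstruction v)) (bvec v)) Z = 0" for Z
    proof -
      have "(\<Sum>v\<in>I. scale_fun (c v * of_int (obstruction v)) (bvec v)) Z =
        det Z *s (\<Sum>v\<in>I. scale_fun (c v * of_int (obstruction v)) (bvec (lower v))) Z"
        unfolding sum_scale_fun_apply vec.scale_sum_right
      proof (rule sum.cong)
        fix v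
        show "(c v * of_int (obstruction v)) *s bvec v Z = det Z *s ((c v * of_int (obstruction v)) *s bvec (lower v) Z)"
          by (subst bvec_lower) (simp add: vector_smult_assoc mult_ac)
      qed simp
      then show ?thesis unfolding 0 by simp
    qed
    then have "(\<Sum>v\<in>I. scale_fun (c v * of_int (obstruction v)) (bvec v)) = 0" by (simp add: fun_eq_iff)
    from bvec_independent[OF I this that(1)] that show ?thesis by simp
  qed
  define c' where "c' v = (if v \<in> I then c v else 0)" for v
  have "f = lincomb scale_fun bvec I c'" unfolding fe c'_def by simp
  also have "\<dots> = lincomb scale_fun bvec (I \<inter> U_basis d) c'"
    using I deg obs by (intro sum.mono_neutral_right) (auto simp: U_basis_def c'_def)
  also have "\<dots> = lincomb scale_fun bvec (U_basis d) c'"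
    using fin by (intro sum.mono_neutral_left) (auto simp: c'_def)
  finally show "f \<in> range (\<lambda>c. \<Sum>v\<in>U_basis d. scale_fun (c v) (bvec v))" by blast
qed

text \<open>The highest value of the first index in the two families.\<close>

definition width :: "bool \<Rightarrow> int \<Rightarrow> int" where
  "width k m = (if k then m + 1 else m - 1)"

text \<open>The parameter \<open>m\<close> is an integer here: for \<open>m < 0\<close> the block is empty, in accordance with \<open>V\<^sub>j = 0\<close> for \<open>j < 0\<close>.\<close>

definition block :: "bool \<times> int \<times> int \<Rightarrow> idx set" where
  "block b = (case b of (k, r, m) \<Rightarrow> {k} \<times> {r} \<times> {nat m} \<times> {0..width k m} \<times> {0..m})"

text \<open>The triples \<open>(k, r, m)\<close> of degree \<open>2 r + m = d\<close> with vanishing obstruction. For \<open>d \<ge> 0\<close> these are the functions of type \<open>h\<^sub>d\<close>,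
of both families, and \<open>N h\<^sub>d\<^sub>-\<^sub>2\<close>, of the first one, where \<open>h\<^sub>n\<close> stands for harmonic polynomials of degree \<open>n\<close>; for \<open>d < 0\<close> they are of type
\<open>N\<^sup>d h\<^sub>-\<^sub>d\<close>, of the second family, and \<open>N\<^sup>d\<^sup>+\<^sup>1 h\<^sub>-\<^sub>d\<^sub>-\<^sub>2\<close>, of both.\<close>

definition U_blocks :: "int \<Rightarrow> (bool \<times> int \<times> int) list" where
  "U_blocks d = (if 0 \<le> d then [(True, 0, d), (False, 0, d), (True, 1, d - 2)]
     else [(False, d, - d), (True, d + 1, - d - 2), (False, d + 1, - d - 2)])"

lemma U_basis_eq: "U_basis d = (\<Union>b\<in>set (U_blocks d). block b)"
proof -
  have "(k, r, m, i, j) \<in> U_basis d \<longleftrightarrow> (k, r, m, i, j) \<in> (\<Union>b\<in>set (U_blocks d). block b)" for k r m i j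
  proof -
    have "(k, r, m, i, j) \<in> U_basis d \<longleftrightarrow> 0 \<le> i \<and> i \<le> width k (int m) \<and> 0 \<le> j \<and> j \<le> int m \<and>
        2 * r + int m = d \<and> (r = 0 \<or> r + 1 + int m = 0 \<or> (if k then r = 1 else r + int m = 0))"
      by (auto simp: U_basis_def valid_def degree_of_def obstruction_def width_def)
    also have "\<dots> \<longleftrightarrow> (k, r, m, i, j) \<in> (\<Union>b\<in>set (U_blocks d). block b)"
      by (cases "0 \<le> d"; cases k) (auto simp: U_blocks_def block_def width_def)
    finally show ?thesis .
  qed
  then show ?thesis by auto
qed

section \<open>Modules with a weight basis\<close>

lemma subspace_range_combination:
  assumes "vector_space s"
  shows "module.subspace s (range (\<lambda>c. \<Sum>x\<in>I. s (c x) (e x)))"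
proof -
  interpret vector_space s by (rule assms)
  show ?thesis unfolding subspace_def
  proof (intro conjI ballI allI)
    show "0 \<in> range (\<lambda>c. \<Sum>x\<in>I. s (c x) (e x))" by (rule range_eqI[of _ _ "\<lambda>_. 0"]) simp
  next
    fix v w assume "v \<in> range (\<lambda>c. \<Sum>x\<in>I. s (c x) (e x))" "w \<in> range (\<lambda>c. \<Sum>x\<in>I. s (c x) (e x))"
    then obtain c d where vw: "v = lincomb s e I c" "w = lincomb s e I d" by blast
    show "v + w \<in> range (\<lambda>c. \<Sum>x\<in>I. s (c x) (e x))"
      unfolding vw sum.distrib[symmetric] scale_left_distrib[symmetric] by (rule range_eqI[of _ _ "\<lambda>x. c x + d x"]) simp
  next
    fix a v assume "v \<in> range (\<lambda>c. \<Sum>x\<in>I. s (c x) (e x))"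
    then obtain c where v: "v = lincomb s e I c" by blast
    show "s a v \<in> range (\<lambda>c. \<Sum>x\<in>I. s (c x) (e x))"
      unfolding v scale_sum_right scale_scale by (rule range_eqI[of _ _ "\<lambda>x. a * c x"]) simp
  qed
qed

lemma combination_single:
  assumes "vector_space s" "finite I" "x \<in> I"
  shows "(\<Sum>y\<in>I. s (if y = x then c else 0) (e y)) = s c (e x)"
proof -
  interpret vector_space s by (rule assms)
  have "(\<Sum>y\<in>I. s (if y = x then c else 0) (e y)) = (\<Sum>y\<in>I. if y = x then s c (e x) else 0)"
    by (rule sum.cong) auto
  then show ?thesis using assms by simp
qed

lemma submodule_of_combinations:
  assumes s: "vector_space s" and I: "finite I" and W: "W = range (\<lambda>c. \<Sum>x\<in>I. s (c x) (e x))"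
    and lin: "\<And>X. X \<in> L \<Longrightarrow> linear_on s s W (\<rho> X)"
    and inv: "\<And>X x. X \<in> L \<Longrightarrow> x \<in> I \<Longrightarrow> \<rho> X (e x) \<in> W"
  shows "submodule s L \<rho> W"
proof -
  interpret vector_space s by (rule s)
  have sub: "subspace W" unfolding W by (rule subspace_range_combination[OF s])
  have eW: "e x \<in> W" if "x \<in> I" for x
    unfolding W by (rule range_eqI[of _ _ "\<lambda>y. if y = x then 1 else 0"])
      (simp only: combination_single[OF s I that] scale_one)
  show ?thesis unfolding submodule_def
  proof (intro conjI ballI sub)
    fix X w assume X: "X \<in> L" and "w \<in> W"
    then obtain c where w: "w = lincomb s e I c" unfolding W by blast
    have "\<rho> X w = (\<Sum>x\<in>I. s (c x) (\<rho> X (e x)))"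
      unfolding w by (rule linear_on_sum[OF s s sub lin[OF X] eW])
    then show "\<rho> X w \<in> W"
      by (simp only:) (intro subspace_sum[OF sub] subspace_scale[OF sub] inv X)
  qed
qed

text \<open>If the weights of a basis are separated by operators from \<open>L\<close>, every nonzero submodule contains a basis vector;
if moreover any basis vector can be reached from any other by operators from \<open>L\<close>, it contains all of them.\<close>

lemma irreducible_of_weights:
  assumes s: "vector_space s" and I: "finite I" "I \<noteq> {}" and W: "W = range (\<lambda>c. \<Sum>x\<in>I. s (c x) (e x))"
    and lin: "\<And>X. X \<in> L \<Longrightarrow> linear_on s s W (\<rho> X)"
    and inv: "\<And>X x. X \<in> L \<Longrightarrow> x \<in> I \<Longrightarrow> \<rho> X (e x) \<in> W"
    and sep: "\<And>x y. x \<in> I \<Longrightarrow> y \<in> I \<Longrightarrow> x \<noteq> y \<Longrightarrow>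
      \<exists>X\<in>L. \<exists>w. w x \<noteq> w y \<and> (\<forall>z\<in>I. \<rho> X (e z) = s (w z) (e z))"
    and conn: "\<And>J. J \<subseteq> I \<Longrightarrow> J \<noteq> {} \<Longrightarrow>
      (\<And>x y X c. x \<in> J \<Longrightarrow> y \<in> I \<Longrightarrow> X \<in> L \<Longrightarrow> c \<noteq> 0 \<Longrightarrow> \<rho> X (e x) = s c (e y) \<Longrightarrow> y \<in> J) \<Longrightarrow> I \<subseteq> J"
    and nz: "\<And>x. x \<in> I \<Longrightarrow> e x \<noteq> 0"
  shows "irreducible_module s L \<rho> W"
proof -
  interpret vector_space s by (rule s)
  have sub: "subspace W" unfolding W by (rule subspace_range_combination[OF s])
  have eW: "e x \<in> W" if "x \<in> I" for x
    unfolding W by (rule range_eqI[of _ _ "\<lambda>y. if y = x then 1 else 0"])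
      (simp only: combination_single[OF s I(1) that] scale_one)
  have irr: "W' = W" if W': "W' \<subseteq> W" "submodule s L \<rho> W'" "W' \<noteq> {0}" for W'
  proof -
    have sub': "subspace W'" and inv': "\<And>X w. X \<in> L \<Longrightarrow> w \<in> W' \<Longrightarrow> \<rho> X w \<in> W'"
      using W'(2) unfolding submodule_def by blast+
    have "0 \<in> W'" by (rule subspace_0[OF sub'])
    then obtain w where w: "w \<in> W'" "w \<noteq> 0" using W'(3) by blast
    then obtain c where wc: "w = lincomb s e I c" using W'(1) unfolding W by blast
    then obtain x where x: "x \<in> I" "c x \<noteq> 0"
      using w(2) sum.neutral[of I "\<lambda>x. s (c x) (e x)"] by (metis scale_zero_left)
    have "s (c x) (e x) \<in> W'"
    proof (rule separated_component_mem[OF sub' I(1) _ _ x(1)])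
      show "lincomb s e I c \<in> W'" using w(1) wc by simp
      fix y z assume yz: "y \<in> I" "z \<in> I" "y \<noteq> z"
      obtain X w where X: "X \<in> L" "w y \<noteq> w z" "\<forall>z\<in>I. \<rho> X (e z) = s (w z) (e z)"
        using sep[OF yz] by blast
      have "(\<Sum>z\<in>I. s (c z * w z) (e z)) \<in> W'" if "lincomb s e I c \<in> W'" for c
      proof -
        have "\<rho> X (lincomb s e I c) = (\<Sum>z\<in>I. s (c z) (\<rho> X (e z)))"
          by (rule linear_on_sum[OF s s sub lin[OF X(1)] eW])
        also have "\<dots> = (\<Sum>z\<in>I. s (c z * w z) (e z))"
          using X(3) by (intro sum.cong) auto
        finally show ?thesis using inv'[OF X(1) that] by simp
      qed
      then show "\<exists>w. w y \<noteq> w z \<and> (\<forall>c. lincomb s e I c \<in> W' \<longrightarrow> (\<Sum>z\<in>I. s (c z * w z) (e z)) \<in> W')"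
        using X(2) by blast
    qed
    then have "s (1 / c x) (s (c x) (e x)) \<in> W'" by (rule subspace_scale[OF sub'])
    then have "e x \<in> W'" using x(2) by simp
    then have ne: "{x \<in> I. e x \<in> W'} \<noteq> {}" using x by blast
    have "I \<subseteq> {x \<in> I. e x \<in> W'}"
    proof (rule conn[OF _ ne])
      fix x y X c assume a: "x \<in> {x \<in> I. e x \<in> W'}" "y \<in> I" "X \<in> L" "c \<noteq> 0" "\<rho> X (e x) = s c (e y)"
      then have "s c (e y) \<in> W'" using inv'[of X "e x"] by simp
      then have "s (1 / c) (s c (e y)) \<in> W'" by (rule subspace_scale[OF sub'])
      then show "y \<in> {x \<in> I. e x \<in> W'}" using a by simp
    qed blast
    then have eW': "e x \<in> W'" if "x \<in> I" for x using that by blast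
    have "lincomb s e I c \<in> W'" for c
      by (rule subspace_sum[OF sub'], rule subspace_scale[OF sub'], rule eW')
    then have "W \<subseteq> W'" unfolding W by blast
    then show "W' = W" using W' by blast
  qed
  have "submodule s L \<rho> W" by (rule submodule_of_combinations[OF s I(1) W lin inv])
  moreover obtain x where x: "x \<in> I" using I(2) by blast
  have "W \<noteq> {0}" using eW[OF x] nz[OF x] by blast
  moreover have "\<forall>W'. W' \<subseteq> W \<and> submodule s L \<rho> W' \<longrightarrow> W' = {0} \<or> W' = W"
    using irr by blast
  ultimately show ?thesis
    unfolding irreducible_module_def by blast
qed

text \<open>The dual of the \<open>p\<close>-th symmetric power of the standard representation, in coordinates with respect to monomials.
On \<open>\<epsilon>\<^sub>i\<close> the entry \<open>A\<^sub>2\<^sub>1\<close> raises and \<open>A\<^sub>1\<^sub>2\<close> lowers the index; the coefficients vanish at the ends of the range.\<close>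

definition spin_action :: "nat \<Rightarrow> HC \<Rightarrow> (nat \<Rightarrow> complex) \<Rightarrow> nat \<Rightarrow> complex" where
  "spin_action p A v i = (if i \<le> p then
      - (A $ 1 $ 1 * of_nat i + A $ 2 $ 2 * (of_nat p - of_nat i)) * v i
      - A $ 2 $ 1 * of_nat i * v (i - 1) - A $ 1 $ 2 * (of_nat p - of_nat i) * v (Suc i) else 0)"

lemma sl2_iff: "A \<in> sl2 \<longleftrightarrow> A $ 2 $ 2 = - A $ 1 $ 1"
  by (simp add: sl2_def quat_Re_def trace_def sum_2 add_eq_0_iff)

lemma neg_transpose_sl2: "- transpose A \<in> sl2 \<longleftrightarrow> A \<in> sl2"
  by (simp add: sl2_iff transpose_def neg_eq_iff_add_eq_0 eq_neg_iff_add_eq_0)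

lemma spin_action_bracket: "spin_action p (A ** B - B ** A) v = spin_action p A (spin_action p B v) - spin_action p B (spin_action p A v)"
proof
  fix i
  show "spin_action p (A ** B - B ** A) v i = (spin_action p A (spin_action p B v) - spin_action p B (spin_action p A v)) i"
  proof (cases "i \<le> p")
    case False
    then show ?thesis by (simp add: spin_action_def)
  next
    case True
    show ?thesis
    proof (cases i)
      case 0
      then show ?thesis
        by (cases p) (simp_all add: spin_action_def matrix_matrix_mult_def sum_2 algebra_simps)
    next
      case (Suc j)
      have *: "(of_nat p - of_nat (Suc j)) * spin_action p A v (Suc (Suc j)) = (of_nat p - of_nat (Suc j)) * 
       (- (A $ 1 $ 1 * of_nat (Suc (Suc j)) + A $ 2 $ 2 * (of_nat p - of_nat (Suc (Suc j)))) * v (Suc (Suc j))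
      - A $ 2 $ 1 * of_nat (Suc (Suc j)) * v (Suc j) - A $ 1 $ 2 * (of_nat p - of_nat (Suc (Suc j))) * v (Suc (Suc (Suc j))))" for A
        using True Suc by (cases "Suc (Suc j) \<le> p") (simp_all add: spin_action_def not_le less_Suc_eq_le)
      have **: "spin_action p A v k = - (A $ 1 $ 1 * of_nat k + A $ 2 $ 2 * (of_nat p - of_nat k)) * v k
        - A $ 2 $ 1 * of_nat k * v (k - 1) - A $ 1 $ 2 * (of_nat p - of_nat k) * v (Suc k)" if "k \<le> p" for k A v
        using that by (simp add: spin_action_def)
      have j: "Suc j \<le> p" "j \<le> p" using True Suc by auto
      show ?thesis
        unfolding fun_diff_def Suc **[OF j(1)] mult.assoc * diff_Suc_1 **[OF j(2)]
        by (simp add: matrix_matrix_mult_def sum_2) (simp add: algebra_simps)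
    qed
  qed
qed

lemma interval_connected:
  assumes "x0 \<in> J" "x0 \<le> (p :: nat)" "\<And>x. x \<in> J \<Longrightarrow> x < p \<Longrightarrow> Suc x \<in> J" "\<And>x. x < p \<Longrightarrow> Suc x \<in> J \<Longrightarrow> x \<in> J"
    "y \<le> p"
  shows "y \<in> J"
proof -
  have up: "x0 + n \<in> J" if "x0 + n \<le> p" for n
    using that
  proof (induction n)
    case (Suc n)
    then show ?case using assms(3)[of "x0 + n"] by simp
  qed (use assms(1) in simp)
  have down: "x0 - n \<in> J" for n
  proof (induction n)
    case (Suc n)
    show ?case
    proof (cases "n < x0")
      case True
      then have "Suc (x0 - Suc n) = x0 - n" by simp
      then show ?thesis using assms(4)[of "x0 - Suc n"] Suc True assms(2) by simp
    next
      case False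
      then show ?thesis using Suc by simp
    qed
  qed (use assms(1) in simp)
  show ?thesis
    using up[of "y - x0"] down[of "x0 - y"] assms(5) by (cases "x0 \<le> y") auto
qed

abbreviation sl2_h :: HC where "sl2_h \<equiv> vector [vector [1, 0], vector [0, - 1]]"
abbreviation sl2_12 :: HC where "sl2_12 \<equiv> vector [vector [0, 1], vector [0, 0]]"
abbreviation sl2_21 :: HC where "sl2_21 \<equiv> vector [vector [0, 0], vector [1, 0]]"

lemma sl2_elements: "sl2_h \<in> sl2" "sl2_12 \<in> sl2" "sl2_21 \<in> sl2" "0 \<in> sl2"
  by (simp_all add: sl2_iff)

lemma coord_space_eq_combinations:
  assumes "finite I"
  shows "coord_space I = range (\<lambda>c. \<Sum>x\<in>I. scale_coords (c x) (\<lambda>i. if i = x then 1 else 0))"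
proof -
  have e: "(\<Sum>x\<in>I. scale_coords (c x) (\<lambda>i. if i = x then 1 else 0)) = (\<lambda>i. if i \<in> I then c i else 0)" for c
  proof
    fix i
    have "(\<Sum>x\<in>J. scale_coords (c x) (\<lambda>i. if i = x then 1 else 0)) i = (\<Sum>x\<in>J. c x * (if i = x then 1 else 0))" for J
      by (induction J rule: infinite_finite_induct) (auto simp: scale_coords_def)
    then show "(\<Sum>x\<in>I. scale_coords (c x) (\<lambda>i. if i = x then 1 else 0)) i = (if i \<in> I then c i else 0)"
      using assms by (simp add: if_distrib cong: if_cong)
  qed
  show ?thesis unfolding e
  proof (intro equalityI subsetI)
    fix v assume "v \<in> coord_space I"
    then show "v \<in> range (\<lambda>c i. if i \<in> I then c i else 0)"
      by (intro range_eqI[of _ _ v]) (auto simp: coord_space_def fun_eq_iff)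
  qed (auto simp: coord_space_def)
qed

lemma spin_action_coord_space: "v \<in> coord_space {..<nat (k + 1)} \<Longrightarrow> spin_action (nat k) A v \<in> coord_space {..<nat (k + 1)}"
  by (cases "0 \<le> k") (auto simp: coord_space_def spin_action_def)

lemma sl2_module_spin_action: "sl2_module scale_coords (spin_action (nat k)) (coord_space {..<nat (k + 1)})"
proof -
  interpret C: vector_space "scale_coords :: complex \<Rightarrow> (nat \<Rightarrow> complex) \<Rightarrow> nat \<Rightarrow> complex"
    by (rule vector_space_scale_coords)
  let ?W = "coord_space {..<nat (k + 1)} :: (nat \<Rightarrow> complex) set"
  have "C.subspace ?W"
    by (auto simp: C.subspace_def coord_space_def scale_coords_def)
  then have "submodule scale_coords sl2 (spin_action (nat k)) ?W"
    unfolding submodule_def using spin_action_coord_space by blast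
  moreover have "linear_on scale_coords scale_coords ?W (spin_action (nat k) A)" for A
    unfolding linear_on_def by (auto simp: fun_eq_iff spin_action_def scale_coords_def algebra_simps)
  moreover have "spin_action (nat k) (A + B) v = spin_action (nat k) A v + spin_action (nat k) B v" for A B v
    by (auto simp: fun_eq_iff spin_action_def algebra_simps)
  moreover have "spin_action (nat k) (cscale c A) v = scale_coords c (spin_action (nat k) A v)" for A c v
    by (auto simp: fun_eq_iff spin_action_def scale_coords_def algebra_simps)
  ultimately show ?thesis
    unfolding sl2_module_def using spin_action_bracket by blast
qed

lemma is_V_spin_action: "is_V k (spin_action (nat k))"
proof -
  define p where "p = nat k"
  let ?e = "\<lambda>x i :: nat. if i = x then 1 else (0 :: complex)"
  have "irreducible_module scale_coords sl2 (spin_action p) (coord_space {..<Suc p})"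
  proof (rule irreducible_of_weights[OF vector_space_scale_coords])
    show "coord_space {..<Suc p} = range (\<lambda>c. \<Sum>x<Suc p. scale_coords (c x) (?e x))"
      by (rule coord_space_eq_combinations) simp
    have mod: "sl2_module scale_coords (spin_action p) (coord_space {..<Suc p})"
      using sl2_module_spin_action[of "int p"] by (simp add: nat_add_distrib)
    then show "linear_on scale_coords scale_coords (coord_space {..<Suc p}) (spin_action p X)" if "X \<in> sl2" for X
      using that unfolding sl2_module_def by blast
    show "spin_action p X (?e x) \<in> coord_space {..<Suc p}" for X x
      by (auto simp: coord_space_def spin_action_def)
    show "\<exists>X\<in>sl2. \<exists>w. w x \<noteq> w y \<and> (\<forall>z\<in>{..<Suc p}. spin_action p X (?e z) = scale_coords (w z) (?e z))"
      if "x \<noteq> y" for x y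
      using that sl2_elements(1)
      by (intro bexI[of _ sl2_h] exI[of _ "\<lambda>z. of_nat p - 2 * of_nat z"])
        (auto simp: fun_eq_iff spin_action_def scale_coords_def)
    show "?e x \<noteq> 0" for x
    proof
      assume "?e x = 0"
      then have "?e x x = (0 :: nat \<Rightarrow> complex) x" by (rule fun_cong)
      then show False by simp
    qed
  next
    fix J assume J: "J \<subseteq> {..<Suc p}" "J \<noteq> {}" and cl: "\<And>x y X c. x \<in> J \<Longrightarrow> y \<in> {..<Suc p} \<Longrightarrow>
      X \<in> sl2 \<Longrightarrow> c \<noteq> 0 \<Longrightarrow> spin_action p X (?e x) = scale_coords c (?e y) \<Longrightarrow> y \<in> J"
    have up: "Suc x \<in> J" if "x \<in> J" "x < p" for x
    proof (rule cl[OF that(1) _ sl2_elements(3)])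
      show "spin_action p sl2_21 (?e x) = scale_coords (- of_nat (Suc x)) (?e (Suc x))"
        using that by (auto simp: fun_eq_iff spin_action_def scale_coords_def)
      show "- of_nat (Suc x) \<noteq> (0 :: complex)" by (simp del: of_nat_Suc)
    qed (use that in simp)
    have down: "x \<in> J" if "x < p" "Suc x \<in> J" for x
    proof (rule cl[OF that(2) _ sl2_elements(2)])
      show "spin_action p sl2_12 (?e (Suc x)) = scale_coords (of_nat x - of_nat p) (?e x)"
        using that by (auto simp: fun_eq_iff spin_action_def scale_coords_def)
      show "of_nat x - of_nat p \<noteq> (0 :: complex)" using that by simp
    qed (use that in simp)
    obtain x0 where x0: "x0 \<in> J" using J(2) by blast
    moreover have "x0 \<le> p" using x0 J(1) by (auto simp: less_Suc_eq_le)
    moreover note up down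
    ultimately have *: "y \<in> J" if "y \<le> p" for y
      using interval_connected that by blast
    show "{..<Suc p} \<subseteq> J"
    proof
      fix y assume "y \<in> {..<Suc p}"
      then show "y \<in> J" by (intro *) simp
    qed
  qed auto
  then show ?thesis
    unfolding is_V_def using sl2_module_spin_action[of k] by (simp add: p_def nat_add_distrib)
qed

text \<open>The map \<open>D \<mapsto> - D\<^sup>T\<close> is an automorphism of the Lie algebra, so twisting by it preserves irreducibility.\<close>

lemma is_V_dual:
  assumes "is_V k \<sigma>"
  shows "is_V k (\<lambda>D. \<sigma> (- transpose D))"
proof -
  let ?W = "coord_space {..<nat (k + 1)} :: (nat \<Rightarrow> complex) set"
  note t = neg_transpose_sl2
  have tt: "- transpose (- transpose D) = D" for D :: HC by (simp add: vec_eq_iff transpose_def)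
  have sub: "submodule scale_coords sl2 (\<lambda>D. \<sigma> (- transpose D)) W \<longleftrightarrow> submodule scale_coords sl2 \<sigma> W" for W
    unfolding submodule_def using t tt by metis
  have br: "- transpose (A ** B - B ** A) = (- transpose A) ** (- transpose B) - (- transpose B) ** (- transpose A)"
    "- transpose (A + B) = - transpose A + - transpose B" "- transpose (cscale c A) = cscale c (- transpose A)"
    for A B :: HC and c
    by (simp_all add: vec_eq_iff transpose_def matrix_matrix_mult_def sum_2 algebra_simps)
  have "sl2_module scale_coords \<sigma> ?W" using assms by (simp add: is_V_def)
  then have "sl2_module scale_coords (\<lambda>D. \<sigma> (- transpose D)) ?W"
    unfolding sl2_module_def sub br using t by blast
  moreover have "irreducible_module scale_coords sl2 (\<lambda>D. \<sigma> (- transpose D)) ?W" if "0 \<le> k"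
    using assms that unfolding is_V_def irreducible_module_def sub by blast
  ultimately show ?thesis by (simp add: is_V_def)
qed

text \<open>Summation by parts: acting on the coordinates amounts to acting on the basis vectors by the transposed
formula, provided the vectors just outside the range are zero.\<close>

lemma sum_spin_action:
  fixes \<beta> :: "int \<Rightarrow> complex"
  assumes "\<beta> (int p + 1) = 0" "\<beta> (- 1) = 0"
  shows "(\<Sum>i<Suc p. spin_action p A v i * \<beta> (int i)) = (\<Sum>i<Suc p. v i *
    (- (A $ 1 $ 1 * of_nat i + A $ 2 $ 2 * (of_nat p - of_nat i)) * \<beta> (int i)
     - A $ 2 $ 1 * (of_nat i + 1) * \<beta> (int i + 1)
     - A $ 1 $ 2 * (of_nat p - of_nat i + 1) * \<beta> (int i - 1)))"
proof -
  have up: "(\<Sum>i<Suc p. of_nat i * v (i - 1) * \<beta> (int i)) = (\<Sum>i<Suc p. v i * ((of_nat i + 1) * \<beta> (int i + 1)))"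
    using assms(1) by (subst sum.lessThan_Suc_shift) (simp add: mult_ac add.commute)
  have down: "(\<Sum>i<Suc p. (of_nat p - of_nat i) * v (Suc i) * \<beta> (int i)) =
      (\<Sum>i<Suc p. v i * ((of_nat p - of_nat i + 1) * \<beta> (int i - 1)))"
    using assms(2) by (subst (2) sum.lessThan_Suc_shift) (simp add: mult_ac)
  have "(\<Sum>i<Suc p. spin_action p A v i * \<beta> (int i)) =
     (\<Sum>i<Suc p. v i * (- (A $ 1 $ 1 * of_nat i + A $ 2 $ 2 * (of_nat p - of_nat i)) * \<beta> (int i)))
     - A $ 2 $ 1 * (\<Sum>i<Suc p. of_nat i * v (i - 1) * \<beta> (int i))
     - A $ 1 $ 2 * (\<Sum>i<Suc p. (of_nat p - of_nat i) * v (Suc i) * \<beta> (int i))"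
    unfolding sum_distrib_left sum_subtractf[symmetric]
    by (rule sum.cong) (simp_all add: spin_action_def algebra_simps)
  then show ?thesis unfolding up down sum_distrib_left sum_subtractf[symmetric]
    by (simp only: algebra_simps)
qed

text \<open>The standard formulas of the action on \<open>V\<^sub>p\<^sub>/\<^sub>2 \<otimes> V\<^sub>q\<^sub>/\<^sub>2\<close>. The second factor is the first one twisted by
\<open>D \<mapsto> - D\<^sup>T\<close>.\<close>

definition box_basis :: "(gl2HC \<Rightarrow> (HC \<Rightarrow> complex^2) \<Rightarrow> HC \<Rightarrow> complex^2) \<Rightarrow> int \<Rightarrow> int \<Rightarrow>
    (int \<Rightarrow> int \<Rightarrow> HC \<Rightarrow> complex^2) \<Rightarrow> bool" where
  "box_basis \<rho> p q b \<longleftrightarrow>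
    (\<forall>i\<in>{0..p}. \<forall>j\<in>{0..q}. b (- 1) j = 0 \<and> b (p + 1) j = 0 \<and> b i (- 1) = 0 \<and> b i (q + 1) = 0 \<and>
      (\<forall>A\<in>sl2. \<forall>D\<in>sl2. \<rho> (block_diag A D) (b i j) =
         scale_fun (- (A $ 1 $ 1 * of_int i + A $ 2 $ 2 * of_int (p - i))) (b i j)
       + scale_fun (- (A $ 2 $ 1 * of_int (i + 1))) (b (i + 1) j)
       + scale_fun (- (A $ 1 $ 2 * of_int (p - i + 1))) (b (i - 1) j)
       + scale_fun (D $ 1 $ 1 * of_int j + D $ 2 $ 2 * of_int (q - j)) (b i j)
       + scale_fun (D $ 1 $ 2 * of_int (j + 1)) (b i (j + 1))
       + scale_fun (D $ 2 $ 1 * of_int (q - j + 1)) (b i (j - 1))))"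

lemma sl2_sl2_iff: "X \<in> sl2_sl2 \<longleftrightarrow> (\<exists>A\<in>sl2. \<exists>D\<in>sl2. X = block_diag A D)"
  by (auto simp: sl2_sl2_def sl2_def)

definition box_indices :: "int \<Rightarrow> int \<Rightarrow> (nat \<times> nat) set" where
  "box_indices p q = {..<nat (p + 1)} \<times> {..<nat (q + 1)}"

lemma finite_box_indices: "finite (box_indices p q)"
  by (simp add: box_indices_def)

text \<open>One prospective summand. Independence is an assumption because for the vectors at hand it is proved for all
families at once.\<close>

locale box_module =
  fixes \<rho> :: "gl2HC \<Rightarrow> (HC \<Rightarrow> complex^2) \<Rightarrow> HC \<Rightarrow> complex^2" and p q :: int
    and b :: "int \<Rightarrow> int \<Rightarrow> HC \<Rightarrow> complex^2" and W :: "(HC \<Rightarrow> complex^2) set"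
  assumes box_basis: "box_basis \<rho> p q b"
    and independent: "(\<Sum>x\<in>box_indices p q. scale_fun (c x) (b (int (fst x)) (int (snd x)))) = 0 \<Longrightarrow>
      x \<in> box_indices p q \<Longrightarrow> c x = 0"
    and W_eq: "W = range (\<lambda>c. \<Sum>x\<in>box_indices p q. scale_fun (c x) (b (int (fst x)) (int (snd x))))"
    and linear: "X \<in> sl2_sl2 \<Longrightarrow> linear_on scale_fun scale_fun W (\<rho> X)"
begin

abbreviation "e x \<equiv> b (int (fst x)) (int (snd x))"

abbreviation "box_action \<equiv> external_action (spin_action (nat p)) (\<lambda>D. spin_action (nat q) (- transpose D))"

lemma e_mem: "x \<in> box_indices p q \<Longrightarrow> e x \<in> W"
  unfolding W_eq by (rule range_eqI[of _ _ "\<lambda>y. if y = x then 1 else 0"])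
    (simp only: combination_single[OF vector_space_scale_fun finite_box_indices] fs.scale_one)

lemma subspace_W: "fs.subspace W"
  unfolding W_eq by (rule subspace_range_combination[OF vector_space_scale_fun])

lemma e_nonzero: "x \<in> box_indices p q \<Longrightarrow> e x \<noteq> 0"
proof
  assume x: "x \<in> box_indices p q" and "e x = 0"
  then have "(\<Sum>y\<in>box_indices p q. scale_fun (if y = x then 1 else 0) (e y)) = 0"
    unfolding combination_single[OF vector_space_scale_fun finite_box_indices x] by (simp only: fs.scale_zero_right)
  from independent[OF this x] show False by simp
qed

lemma action:
  assumes "x \<in> box_indices p q" "A \<in> sl2" "D \<in> sl2"
  shows "\<rho> (block_diag A D) (e x) =
         scale_fun (- (A $ 1 $ 1 * of_int (int (fst x)) + A $ 2 $ 2 * of_int (p - int (fst x)))) (e x)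
       + scale_fun (- (A $ 2 $ 1 * of_int (int (fst x) + 1))) (b (int (fst x) + 1) (int (snd x)))
       + scale_fun (- (A $ 1 $ 2 * of_int (p - int (fst x) + 1))) (b (int (fst x) - 1) (int (snd x)))
       + scale_fun (D $ 1 $ 1 * of_int (int (snd x)) + D $ 2 $ 2 * of_int (q - int (snd x))) (e x)
       + scale_fun (D $ 1 $ 2 * of_int (int (snd x) + 1)) (b (int (fst x)) (int (snd x) + 1))
       + scale_fun (D $ 2 $ 1 * of_int (q - int (snd x) + 1)) (b (int (fst x)) (int (snd x) - 1))"
proof -
  have "int (fst x) \<in> {0..p}" "int (snd x) \<in> {0..q}" using assms(1) by (auto simp: box_indices_def)
  then show ?thesis using box_basis assms(2,3) unfolding box_basis_def by blast
qed

lemma boundary: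
  assumes "0 \<le> i" "i \<le> p" "0 \<le> j" "j \<le> q"
  shows "b (- 1) j = 0" "b (p + 1) j = 0" "b i (- 1) = 0" "b i (q + 1) = 0"
  using box_basis assms unfolding box_basis_def by auto

lemma neighbour_mem:
  assumes "0 \<le> i" "i \<le> p" "0 \<le> j" "j \<le> q"
  shows "b i j \<in> W" "b (i + 1) j \<in> W" "b (i - 1) j \<in> W" "b i (j + 1) \<in> W" "b i (j - 1) \<in> W"
proof -
  note z = boundary[OF assms]
  have m: "b i j \<in> W" if "0 \<le> i" "i \<le> p" "0 \<le> j" "j \<le> q" for i j
    using e_mem[of "(nat i, nat j)"] that by (simp add: box_indices_def nat_less_eq_zless)
  have 0: "0 \<in> W" by (rule fs.subspace_0[OF subspace_W])
  show "b i j \<in> W" using m assms by blast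
  show "b (i + 1) j \<in> W" using m[of "i + 1" j] assms z 0 by (cases "i = p") auto
  show "b (i - 1) j \<in> W" using m[of "i - 1" j] assms z 0 by (cases "i = 0") auto
  show "b i (j + 1) \<in> W" using m[of i "j + 1"] assms z 0 by (cases "j = q") auto
  show "b i (j - 1) \<in> W" using m[of i "j - 1"] assms z 0 by (cases "j = 0") auto
qed

lemma invariant: "X \<in> sl2_sl2 \<Longrightarrow> x \<in> box_indices p q \<Longrightarrow> \<rho> X (e x) \<in> W"
proof -
  assume X: "X \<in> sl2_sl2" and x: "x \<in> box_indices p q"
  then obtain A D where AD: "A \<in> sl2" "D \<in> sl2" "X = block_diag A D" unfolding sl2_sl2_iff by blast
  have r: "0 \<le> int (fst x)" "int (fst x) \<le> p" "0 \<le> int (snd x)" "int (snd x) \<le> q"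
    using x by (auto simp: box_indices_def)
  show ?thesis unfolding AD(3) action[OF x AD(1,2)]
    by (intro fs.subspace_add[OF subspace_W] fs.subspace_scale[OF subspace_W] neighbour_mem r)
qed

lemma submodule_W: "submodule scale_fun sl2_sl2 \<rho> W"
  by (rule submodule_of_combinations[OF vector_space_scale_fun finite_box_indices W_eq linear invariant])

text \<open>The diagonal matrices separate the weights, and the two pairs of root vectors move to the four neighbours of an index.\<close>

lemma irreducible_W:
  assumes pq: "0 \<le> p" "0 \<le> q"
  shows "irreducible_module scale_fun sl2_sl2 \<rho> W"
proof (rule irreducible_of_weights[OF vector_space_scale_fun finite_box_indices _ W_eq linear invariant _ _ e_nonzero])
  have "(0, 0) \<in> box_indices p q" using pq by (auto simp: box_indices_def)
  then show "box_indices p q \<noteq> {}" by blast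
  have X: "block_diag A D \<in> sl2_sl2" if "A \<in> sl2" "D \<in> sl2" for A D
    using that unfolding sl2_sl2_iff by blast
  show "\<exists>X\<in>sl2_sl2. \<exists>w. w x \<noteq> w y \<and> (\<forall>z\<in>box_indices p q. \<rho> X (e z) = scale_fun (w z) (e z))"
    if "x \<noteq> y" for x y
  proof (cases "fst x = fst y")
    case False
    have "\<rho> (block_diag sl2_h 0) (e z) = scale_fun (of_int p - 2 * of_nat (fst z)) (e z)" if "z \<in> box_indices p q" for z
      unfolding action[OF that sl2_elements(1,4)] by (simp add: scale_fun_def fun_eq_iff vec_eq_iff algebra_simps)
    then show ?thesis
      using False by (intro bexI[OF _ X[OF sl2_elements(1,4)]] exI[of _ "\<lambda>z. of_int p - 2 * of_nat (fst z)"]) auto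
  next
    case True
    then have "snd x \<noteq> snd y" using that by (simp add: prod_eq_iff)
    have "\<rho> (block_diag 0 sl2_h) (e z) = scale_fun (2 * of_nat (snd z) - of_int q) (e z)" if "z \<in> box_indices p q" for z
      unfolding action[OF that sl2_elements(4,1)] by (simp add: scale_fun_def fun_eq_iff vec_eq_iff algebra_simps)
    then show ?thesis
      using \<open>snd x \<noteq> snd y\<close> by (intro bexI[OF _ X[OF sl2_elements(4,1)]] exI[of _ "\<lambda>z. 2 * of_nat (snd z) - of_int q"]) auto
  qed
  fix J assume J: "J \<subseteq> box_indices p q" "J \<noteq> {}" and cl: "\<And>x y X c. x \<in> J \<Longrightarrow> y \<in> box_indices p q \<Longrightarrow>
      X \<in> sl2_sl2 \<Longrightarrow> c \<noteq> 0 \<Longrightarrow> \<rho> X (e x) = scale_fun c (e y) \<Longrightarrow> y \<in> J"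
  have bi: "(i, j) \<in> box_indices p q \<longleftrightarrow> i \<le> nat p \<and> j \<le> nat q" for i j
    using pq by (auto simp: box_indices_def)
  have up1: "(Suc i, j) \<in> J" if "(i, j) \<in> J" "i < nat p" for i j
  proof (rule cl[OF that(1) _ X[OF sl2_elements(3,4)]])
    have m: "(i, j) \<in> box_indices p q" using that J by blast
    show "(Suc i, j) \<in> box_indices p q" using m that by (simp add: bi)
    show "\<rho> (block_diag sl2_21 0) (e (i, j)) = scale_fun (- of_nat (Suc i)) (e (Suc i, j))"
      unfolding action[OF m sl2_elements(3,4)] by (simp add: scale_fun_def fun_eq_iff vec_eq_iff add.commute)
    show "- of_nat (Suc i) \<noteq> (0 :: complex)" by (simp del: of_nat_Suc)
  qed
  have down1: "(i, j) \<in> J" if "i < nat p" "(Suc i, j) \<in> J" for i j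
  proof (rule cl[OF that(2) _ X[OF sl2_elements(2,4)]])
    have m: "(Suc i, j) \<in> box_indices p q" using that J by blast
    show "(i, j) \<in> box_indices p q" using m that by (simp add: bi)
    show "\<rho> (block_diag sl2_12 0) (e (Suc i, j)) = scale_fun (- of_int (p - int i)) (e (i, j))"
      unfolding action[OF m sl2_elements(2,4)] by (simp add: scale_fun_def fun_eq_iff vec_eq_iff)
    show "- of_int (p - int i) \<noteq> (0 :: complex)" using that unfolding neg_equal_0_iff_equal of_int_eq_0_iff by simp
  qed
  have up2: "(i, Suc j) \<in> J" if "(i, j) \<in> J" "j < nat q" for i j
  proof (rule cl[OF that(1) _ X[OF sl2_elements(4,2)]])
    have m: "(i, j) \<in> box_indices p q" using that J by blast
    show "(i, Suc j) \<in> box_indices p q" using m that by (simp add: bi)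
    show "\<rho> (block_diag 0 sl2_12) (e (i, j)) = scale_fun (of_nat (Suc j)) (e (i, Suc j))"
      unfolding action[OF m sl2_elements(4,2)] by (simp add: scale_fun_def fun_eq_iff vec_eq_iff add.commute)
    show "of_nat (Suc j) \<noteq> (0 :: complex)" by (simp del: of_nat_Suc)
  qed
  have down2: "(i, j) \<in> J" if "j < nat q" "(i, Suc j) \<in> J" for i j
  proof (rule cl[OF that(2) _ X[OF sl2_elements(4,3)]])
    have m: "(i, Suc j) \<in> box_indices p q" using that J by blast
    show "(i, j) \<in> box_indices p q" using m that by (simp add: bi)
    show "\<rho> (block_diag 0 sl2_21) (e (i, Suc j)) = scale_fun (of_int (q - int j)) (e (i, j))"
      unfolding action[OF m sl2_elements(4,3)] by (simp add: scale_fun_def fun_eq_iff vec_eq_iff)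
    show "of_int (q - int j) \<noteq> (0 :: complex)" using that unfolding of_int_eq_0_iff by simp
  qed
  obtain i0 j0 where ij: "(i0, j0) \<in> J" using J(2) by auto
  then have le: "i0 \<le> nat p" "j0 \<le> nat q" using J(1) bi by blast+
  have 1: "i \<in> {i. (i, j0) \<in> J}" if "i \<le> nat p" for i
    by (rule interval_connected[of i0 _ "nat p"]) (use ij le up1 down1 that in blast)+
  have 2: "j \<in> {j. (i, j) \<in> J}" if "i \<le> nat p" "j \<le> nat q" for i j
    by (rule interval_connected[of j0 _ "nat q"]) (use 1[OF that(1)] le up2 down2 that in blast)+
  show "box_indices p q \<subseteq> J"
  proof
    fix x assume "x \<in> box_indices p q"
    then show "x \<in> J" using 2[of "fst x" "snd x"] bi[of "fst x" "snd x"] by simp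
  qed
qed

lemma equivariant:
  assumes A: "A \<in> sl2" and D: "D \<in> sl2"
  shows "(\<Sum>x\<in>box_indices p q. scale_fun (box_action A D F x) (e x)) =
    \<rho> (block_diag A D) (lincomb scale_fun e (box_indices p q) F)" (is "?lhs = ?rhs")
proof (cases "0 \<le> p \<and> 0 \<le> q")
  case False
  then have "box_indices p q = {}" by (auto simp: box_indices_def)
  moreover have "\<rho> (block_diag A D) (scale_fun 0 0) = scale_fun 0 (\<rho> (block_diag A D) 0)"
    using linear[of "block_diag A D"] A D fs.subspace_0[OF subspace_W] unfolding linear_on_def sl2_sl2_iff by blast
  ultimately show ?thesis by simp
next
  case True
  define P Q where "P = nat p" and "Q = nat q"
  have p: "p = int P" and q: "q = int Q" using True by (simp_all add: P_def Q_def)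
  have K: "box_indices p q = {..<Suc P} \<times> {..<Suc Q}"
    by (simp add: box_indices_def p q nat_add_distrib)
  have X: "block_diag A D \<in> sl2_sl2" using A D unfolding sl2_sl2_iff by blast
  show ?thesis
  proof (rule ext, unfold vec_eq_iff, intro allI)
    fix Z :: HC and k :: 2
    define \<beta> where "\<beta> i j = b i j Z $ k" for i j
    define l where "l i j = - (A $ 1 $ 1 * of_nat i + A $ 2 $ 2 * (of_nat P - of_nat i)) * \<beta> (int i) (int j)
       - A $ 2 $ 1 * (of_nat i + 1) * \<beta> (int i + 1) (int j)
       - A $ 1 $ 2 * (of_nat P - of_nat i + 1) * \<beta> (int i - 1) (int j)" for i j
    define r where "r i j =
       - ((- transpose D) $ 1 $ 1 * of_nat j + (- transpose D) $ 2 $ 2 * (of_nat Q - of_nat j)) * \<beta> (int i) (int j)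
       - (- transpose D) $ 2 $ 1 * (of_nat j + 1) * \<beta> (int i) (int j + 1)
       - (- transpose D) $ 1 $ 2 * (of_nat Q - of_nat j + 1) * \<beta> (int i) (int j - 1)" for i j
    have z1: "\<beta> (int P + 1) (int j) = 0" "\<beta> (- 1) (int j) = 0" if "j < Suc Q" for j
      using boundary[of 0 "int j"] that by (simp_all add: p q \<beta>_def)
    have z2: "\<beta> (int i) (int Q + 1) = 0" "\<beta> (int i) (- 1) = 0" if "i < Suc P" for i
      using boundary[of "int i" 0] that by (simp_all add: p q \<beta>_def)
    have "?lhs Z $ k = (\<Sum>i<Suc P. \<Sum>j<Suc Q. spin_action P A (\<lambda>i'. F (i', j)) i * \<beta> i j)
       + (\<Sum>i<Suc P. \<Sum>j<Suc Q. spin_action Q (- transpose D) (\<lambda>j'. F (i, j')) j * \<beta> i j)"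
      unfolding sum_scale_fun_apply K sum.distrib[symmetric] sum.cartesian_product
      by (simp add: external_action_def \<beta>_def P_def Q_def algebra_simps case_prod_beta)
    also have "(\<Sum>i<Suc P. \<Sum>j<Suc Q. spin_action P A (\<lambda>i'. F (i', j)) i * \<beta> i j) =
       (\<Sum>j<Suc Q. \<Sum>i<Suc P. spin_action P A (\<lambda>i'. F (i', j)) i * \<beta> i j)" by (rule sum.swap)
    also have "\<dots> = (\<Sum>j<Suc Q. \<Sum>i<Suc P. F (i, j) * l i j)"
      unfolding l_def by (rule sum.cong[OF refl], rule sum_spin_action) (use z1 in auto)
    also have "\<dots> = (\<Sum>i<Suc P. \<Sum>j<Suc Q. F (i, j) * l i j)" by (rule sum.swap)
    also have "(\<Sum>i<Suc P. \<Sum>j<Suc Q. spin_action Q (- transpose D) (\<lambda>j'. F (i, j')) j * \<beta> i j) =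
      (\<Sum>i<Suc P. \<Sum>j<Suc Q. F (i, j) * r i j)"
      unfolding r_def by (rule sum.cong[OF refl], rule sum_spin_action[where \<beta> = "\<beta> (int _)"]) (use z2 in auto)
    finally have L: "?lhs Z $ k = (\<Sum>i<Suc P. \<Sum>j<Suc Q. F (i, j) * l i j + F (i, j) * r i j)"
      unfolding sum.distrib .
    have "?rhs = (\<Sum>x\<in>box_indices p q. scale_fun (F x) (\<rho> (block_diag A D) (e x)))"
      by (rule linear_on_sum[OF vector_space_scale_fun vector_space_scale_fun subspace_W linear[OF X] e_mem])
    then have "?rhs Z $ k = (\<Sum>x\<in>box_indices p q. scale_fun (F x) (\<rho> (block_diag A D) (e x))) Z $ k"
      by (simp only:)
    also have "\<dots> = (\<Sum>x\<in>box_indices p q. F x * \<rho> (block_diag A D) (e x) Z $ k)"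
      unfolding sum_scale_fun_apply by simp
    also have "\<dots> = (\<Sum>x\<in>box_indices p q. case x of (i, j) \<Rightarrow> F (i, j) * l i j + F (i, j) * r i j)"
    proof (rule sum.cong[OF refl])
      fix x assume "x \<in> box_indices p q"
      from action[OF this A D]
      show "F x * \<rho> (block_diag A D) (e x) Z $ k = (case x of (i, j) \<Rightarrow> F (i, j) * l i j + F (i, j) * r i j)"
        by (cases x) (simp add: scale_fun_def \<beta>_def l_def r_def p q transpose_def algebra_simps)
    qed
    finally have R: "?rhs Z $ k = (\<Sum>x\<in>box_indices p q. case x of (i, j) \<Rightarrow> F (i, j) * l i j + F (i, j) * r i j)" .
    show "?lhs Z $ k = ?rhs Z $ k"
      unfolding L unfolding R unfolding K sum.cartesian_product by (rule refl)
  qed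
qed

lemma iso_W: "iso_V_box_V \<rho> W p q"
proof -
  let ?T = "coord_space ({..<nat (p + 1)} \<times> {..<nat (q + 1)})"
  let ?\<phi> = "\<lambda>F. \<Sum>x\<in>box_indices p q. scale_fun (F x) (e x)"
  have T: "?T = {F. \<forall>x. x \<notin> box_indices p q \<longrightarrow> F x = 0}"
    by (simp add: coord_space_def box_indices_def)
  have "bij_betw ?\<phi> ?T W"
  proof (rule bij_betw_imageI)
    show "inj_on ?\<phi> ?T"
    proof (rule inj_onI)
      fix F G assume FG: "F \<in> ?T" "G \<in> ?T" and "?\<phi> F = ?\<phi> G"
      then have "?\<phi> F - ?\<phi> G = 0" by simp
      then have 0: "(\<Sum>x\<in>box_indices p q. scale_fun (F x - G x) (e x)) = 0"
        by (simp only: sum_subtractf[symmetric] fs.scale_left_diff_distrib)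
      show "F = G"
      proof
        fix x
        show "F x = G x"
          using independent[OF 0, of x] FG unfolding T by (cases "x \<in> box_indices p q"; cases x) auto
      qed
    qed
    show "?\<phi> ` ?T = W"
    proof (intro equalityI subsetI)
      fix f assume "f \<in> W"
      then obtain c where f: "f = ?\<phi> c" unfolding W_eq by blast
      have fe: "f = ?\<phi> (\<lambda>x. if x \<in> box_indices p q then c x else 0)" unfolding f by (rule sum.cong) auto
      have "(\<lambda>x. if x \<in> box_indices p q then c x else 0) \<in> ?T" unfolding T by simp
      then show "f \<in> ?\<phi> ` ?T" unfolding fe by (rule imageI)
    qed (auto simp: W_eq)
  qed
  moreover have "?\<phi> (v + w) = ?\<phi> v + ?\<phi> w" for v w
    by (simp only: plus_fun_apply fs.scale_left_distrib sum.distrib)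
  moreover have "?\<phi> (scale_coords c v) = scale_fun c (?\<phi> v)" for c v
    by (simp only: scale_coords_def fs.scale_sum_right fs.scale_scale)
  ultimately have "bij_betw ?\<phi> ?T W \<and> linear_on scale_coords scale_fun ?T ?\<phi>"
    unfolding linear_on_def by blast
  moreover have "\<forall>A\<in>sl2. \<forall>D\<in>sl2. \<forall>F\<in>?T. ?\<phi> (box_action A D F) = \<rho> (block_diag A D) (?\<phi> F)"
    using equivariant by blast
  ultimately show ?thesis
    unfolding iso_V_box_V_def Let_def
    using is_V_spin_action[of p] is_V_dual[OF is_V_spin_action[of q]] by blast
qed

end

section \<open>Direct sums\<close>

lemma linear_on_subset: "linear_on s t U \<phi> \<Longrightarrow> W \<subseteq> U \<Longrightarrow> linear_on s t W \<phi>"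
  unfolding linear_on_def by blast

text \<open>Several families at once. The list \<open>pqs\<close> records twice the highest weights of the two factors; a family with a negative entry is
empty and yields the summand \<open>0\<close>.\<close>

locale box_decomposition =
  fixes \<rho> :: "gl2HC \<Rightarrow> (HC \<Rightarrow> complex^2) \<Rightarrow> HC \<Rightarrow> complex^2" and pqs :: "(int \<times> int) list"
    and b :: "nat \<Rightarrow> int \<Rightarrow> int \<Rightarrow> HC \<Rightarrow> complex^2" and U :: "(HC \<Rightarrow> complex^2) set"
  fixes K J e
  defines "K n \<equiv> box_indices (fst (pqs ! n)) (snd (pqs ! n))"
    and "J \<equiv> Sigma {..<length pqs} K"
    and "e n x \<equiv> b n (int (fst x)) (int (snd x))"
  assumes box_basis: "n < length pqs \<Longrightarrow> box_basis \<rho> (fst (pqs ! n)) (snd (pqs ! n)) (b n)"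
    and independent: "(\<Sum>y\<in>J. scale_fun (c y) (e (fst y) (snd y))) = 0 \<Longrightarrow> y \<in> J \<Longrightarrow> c y = 0"
    and U_eq: "U = range (\<lambda>c. \<Sum>y\<in>J. scale_fun (c y) (e (fst y) (snd y)))"
    and linear: "X \<in> sl2_sl2 \<Longrightarrow> linear_on scale_fun scale_fun U (\<rho> X)"
begin

definition W :: "nat \<Rightarrow> (HC \<Rightarrow> complex^2) set" where
  "W n = range (\<lambda>c. \<Sum>x\<in>K n. scale_fun (c x) (e n x))"

lemma finite_K: "finite (K n)"
  by (simp add: K_def finite_box_indices)

lemma finite_J: "finite J"
  by (simp add: J_def finite_K)

lemma subspace_U: "fs.subspace U"
  unfolding U_eq by (rule subspace_range_combination[OF vector_space_scale_fun])

lemma e_mem_U: "y \<in> J \<Longrightarrow> e (fst y) (snd y) \<in> U"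
  unfolding U_eq by (rule range_eqI[of _ _ "\<lambda>z. if z = y then 1 else 0"])
    (simp only: combination_single[OF vector_space_scale_fun finite_J] fs.scale_one)

lemma W_subset_U: "n < length pqs \<Longrightarrow> W n \<subseteq> U"
proof -
  assume n: "n < length pqs"
  have "e n x \<in> U" if "x \<in> K n" for x
    using e_mem_U[of "(n, x)"] n that by (simp add: J_def)
  then have "(\<Sum>x\<in>K n. scale_fun (c x) (e n x)) \<in> U" for c
    by (intro fs.subspace_sum[OF subspace_U] fs.subspace_scale[OF subspace_U])
  then show ?thesis unfolding W_def by blast
qed

lemma sum_J: "(\<Sum>y\<in>J. scale_fun (c y) (e (fst y) (snd y))) =
    (\<Sum>n<length pqs. \<Sum>x\<in>K n. scale_fun (c (n, x)) (e n x))"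
  unfolding J_def by (subst sum.Sigma) (simp_all add: finite_K case_prod_beta)

lemma independent_family:
  assumes "(\<Sum>n<length pqs. \<Sum>x\<in>K n. scale_fun (c n x) (e n x)) = 0" "n < length pqs" "x \<in> K n"
  shows "c n x = 0"
proof -
  have "(\<Sum>y\<in>J. scale_fun ((\<lambda>(n, x). c n x) y) (e (fst y) (snd y))) = 0"
    unfolding sum_J using assms(1) by simp
  from independent[OF this, of "(n, x)"] show ?thesis using assms(2,3) by (simp add: J_def)
qed

lemma box_module_W: "n < length pqs \<Longrightarrow> box_module \<rho> (fst (pqs ! n)) (snd (pqs ! n)) (b n) (W n)"
proof (rule box_module.intro)
  assume n: "n < length pqs"
  show "box_basis \<rho> (fst (pqs ! n)) (snd (pqs ! n)) (b n)" by (rule box_basis[OF n])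
  show "linear_on scale_fun scale_fun (W n) (\<rho> X)" if "X \<in> sl2_sl2" for X
    by (rule linear_on_subset[OF linear[OF that] W_subset_U[OF n]])
  show "W n = range (\<lambda>c. \<Sum>x\<in>box_indices (fst (pqs ! n)) (snd (pqs ! n)). scale_fun (c x) (b n (int (fst x)) (int (snd x))))"
    unfolding W_def K_def e_def ..
  fix c x
  assume 0: "(\<Sum>x\<in>box_indices (fst (pqs ! n)) (snd (pqs ! n)). scale_fun (c x) (b n (int (fst x)) (int (snd x)))) = 0"
    and x: "x \<in> box_indices (fst (pqs ! n)) (snd (pqs ! n))"
  have "(\<Sum>k<length pqs. \<Sum>x\<in>K k. scale_fun (if k = n then c x else 0) (e k x)) =
    (\<Sum>k<length pqs. if k = n then \<Sum>x\<in>K n. scale_fun (c x) (e n x) else 0)"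
    by (rule sum.cong) auto
  also have "\<dots> = (\<Sum>x\<in>K n. scale_fun (c x) (e n x))" using n by simp
  also have "\<dots> = 0" using 0 unfolding K_def e_def .
  finally show "c x = 0" using independent_family[of "\<lambda>k x. if k = n then c x else 0" n x] n x by (simp add: K_def)
qed

lemma decomposition_unique:
  assumes "\<And>n. n < length pqs \<Longrightarrow> w n \<in> W n" "\<And>n. n < length pqs \<Longrightarrow> w' n \<in> W n"
    and "(\<Sum>n<length pqs. w n) = (\<Sum>n<length pqs. w' n)" "n < length pqs"
  shows "w n = w' n"
proof -
  have "\<exists>c. w n - w' n = (\<Sum>x\<in>K n. scale_fun (c x) (e n x))" if n: "n < length pqs" for n
  proof -
    obtain c d where "w n = (\<Sum>x\<in>K n. scale_fun (c x) (e n x))" "w' n = (\<Sum>x\<in>K n. scale_fun (d x) (e n x))"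
      using assms(1)[OF n] assms(2)[OF n] unfolding W_def by blast
    then have "w n - w' n = (\<Sum>x\<in>K n. scale_fun (c x - d x) (e n x))"
      by (simp only: fs.scale_left_diff_distrib sum_subtractf)
    then show ?thesis by (rule exI[where x = "\<lambda>x. c x - d x"])
  qed
  then obtain c where c: "\<And>n. n < length pqs \<Longrightarrow> w n - w' n = (\<Sum>x\<in>K n. scale_fun (c n x) (e n x))"
    by metis
  have "(\<Sum>n<length pqs. \<Sum>x\<in>K n. scale_fun (c n x) (e n x)) = (\<Sum>n<length pqs. w n - w' n)"
    by (rule sum.cong) (simp_all only: c lessThan_iff)
  also have "\<dots> = 0" using assms(3) by (simp only: sum_subtractf diff_self)
  finally have "c n x = 0" if "x \<in> K n" for x using independent_family assms(4) that by blast
  then have "\<forall>x\<in>K n. scale_fun (c n x) (e n x) = 0" by (metis fs.scale_zero_left)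
  then have "(\<Sum>x\<in>K n. scale_fun (c n x) (e n x)) = 0" by (rule sum.neutral)
  then show ?thesis using c[OF assms(4)] by (simp only: right_minus_eq)
qed

lemma bij_betw_sum: "bij_betw (\<lambda>w. \<Sum>i<length pqs. w i) (\<Pi>\<^sub>E i\<in>{..<length pqs}. map W [0..<length pqs] ! i) U"
proof (rule bij_betw_imageI)
  have P: "(\<Pi>\<^sub>E i\<in>{..<length pqs}. map W [0..<length pqs] ! i) = (\<Pi>\<^sub>E i\<in>{..<length pqs}. W i)"
    by (rule PiE_cong) simp
  show "inj_on (\<lambda>w. \<Sum>i<length pqs. w i) (\<Pi>\<^sub>E i\<in>{..<length pqs}. map W [0..<length pqs] ! i)"
    unfolding P
  proof (rule inj_onI)
    fix w w' assume w: "w \<in> (\<Pi>\<^sub>E i\<in>{..<length pqs}. W i)" "w' \<in> (\<Pi>\<^sub>E i\<in>{..<length pqs}. W i)"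
      and eq: "(\<Sum>i<length pqs. w i) = (\<Sum>i<length pqs. w' i)"
    show "w = w'"
    proof (rule PiE_ext[OF w])
      fix n assume "n \<in> {..<length pqs}"
      then have n: "n < length pqs" by simp
      show "w n = w' n"
        by (rule decomposition_unique[OF _ _ eq n]) (use w in \<open>auto simp only: PiE_iff lessThan_iff\<close>)
    qed
  qed
  show "(\<lambda>w. \<Sum>i<length pqs. w i) ` (\<Pi>\<^sub>E i\<in>{..<length pqs}. map W [0..<length pqs] ! i) = U"
    unfolding P
  proof (intro equalityI subsetI)
    fix f assume "f \<in> (\<lambda>w. \<Sum>i<length pqs. w i) ` (\<Pi>\<^sub>E i\<in>{..<length pqs}. W i)"
    then obtain w where w: "w \<in> (\<Pi>\<^sub>E i\<in>{..<length pqs}. W i)" and f: "f = (\<Sum>i<length pqs. w i)" by blast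
    show "f \<in> U" unfolding f
    proof (rule fs.subspace_sum[OF subspace_U])
      fix i assume "i \<in> {..<length pqs}"
      then show "w i \<in> U" using PiE_mem[OF w] W_subset_U[of i] by blast
    qed
  next
    fix f assume "f \<in> U"
    then obtain c where f: "f = (\<Sum>n<length pqs. \<Sum>x\<in>K n. scale_fun (c (n, x)) (e n x))"
      unfolding U_eq sum_J by blast
    let ?w = "restrict (\<lambda>n. \<Sum>x\<in>K n. scale_fun (c (n, x)) (e n x)) {..<length pqs}"
    have wP: "?w \<in> (\<Pi>\<^sub>E i\<in>{..<length pqs}. W i)"
      unfolding restrict_PiE_iff by (auto simp only: W_def)
    have fe: "f = (\<Sum>i<length pqs. ?w i)"
      unfolding f by (rule sum.cong) simp_all
    show "f \<in> (\<lambda>w. \<Sum>i<length pqs. w i) ` (\<Pi>\<^sub>E i\<in>{..<length pqs}. W i)"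
      unfolding fe using wP by (rule imageI)
  qed
qed

theorem decomposes: "decomposes_into \<rho> U pqs"
proof -
  have "\<forall>i<length pqs. case pqs ! i of (p, q) \<Rightarrow>
          submodule scale_fun sl2_sl2 \<rho> (map W [0..<length pqs] ! i) \<and> iso_V_box_V \<rho> (map W [0..<length pqs] ! i) p q \<and>
          (0 \<le> p \<and> 0 \<le> q \<longrightarrow> irreducible_module scale_fun sl2_sl2 \<rho> (map W [0..<length pqs] ! i))"
  proof (intro allI impI)
    fix i assume i: "i < length pqs"
    then have "map W [0..<length pqs] ! i = W i" by simp
    then show "case pqs ! i of (p, q) \<Rightarrow>
          submodule scale_fun sl2_sl2 \<rho> (map W [0..<length pqs] ! i) \<and> iso_V_box_V \<rho> (map W [0..<length pqs] ! i) p q \<and>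
          (0 \<le> p \<and> 0 \<le> q \<longrightarrow> irreducible_module scale_fun sl2_sl2 \<rho> (map W [0..<length pqs] ! i))"
      using box_module.submodule_W[OF box_module_W[OF i]] box_module.iso_W[OF box_module_W[OF i]]
        box_module.irreducible_W[OF box_module_W[OF i]]
      unfolding case_prod_beta by simp
  qed
  then show ?thesis
    unfolding decomposes_into_def using bij_betw_sum
    by (intro exI[of _ "map W [0..<length pqs]"] conjI) simp_all
qed

theorem submodule_U: "submodule scale_fun sl2_sl2 \<rho> U"
proof (rule submodule_of_combinations[OF vector_space_scale_fun finite_J U_eq linear])
  fix X y assume X: "X \<in> sl2_sl2" and y: "y \<in> J"
  then have n: "fst y < length pqs" and x: "snd y \<in> box_indices (fst (pqs ! fst y)) (snd (pqs ! fst y))"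
    by (auto simp: J_def K_def)
  from box_module.invariant[OF box_module_W[OF n] X x] show "\<rho> X (e (fst y) (snd y)) \<in> U"
    using W_subset_U[OF n] unfolding e_def by blast
qed

theorem dim_U: "fs.dim U = (\<Sum>n<length pqs. nat (fst (pqs ! n) + 1) * nat (snd (pqs ! n) + 1))"
proof -
  let ?e = "\<lambda>y. e (fst y) (snd y)"
  have inj: "inj_on ?e J"
  proof (rule inj_onI)
    fix y z assume yz: "y \<in> J" "z \<in> J" "?e y = ?e z"
    have "(\<Sum>x\<in>J. scale_fun ((if x = y then 1 else 0) - (if x = z then 1 else 0)) (?e x)) =
      (\<Sum>x\<in>J. scale_fun (if x = y then 1 else 0) (?e x)) - (\<Sum>x\<in>J. scale_fun (if x = z then 1 else 0) (?e x))"
      by (simp only: fs.scale_left_diff_distrib sum_subtractf)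
    also have "\<dots> = 0"
      unfolding combination_single[OF vector_space_scale_fun finite_J yz(1)]
        combination_single[OF vector_space_scale_fun finite_J yz(2)] yz(3) by (rule diff_self)
    finally show "y = z" using independent[of "\<lambda>x. (if x = y then 1 else 0) - (if x = z then 1 else 0)", OF _ yz(1)]
      by (auto split: if_splits)
  qed
  have "fs.independent (?e ` J)"
  proof (rule fs.independent_if_scalars_zero)
    show "finite (?e ` J)" using finite_J by simp
    fix g x assume 0: "(\<Sum>x\<in>?e ` J. scale_fun (g x) x) = 0" and "x \<in> ?e ` J"
    then obtain y where y: "y \<in> J" "x = ?e y" by blast
    have "(\<Sum>y\<in>J. scale_fun (g (?e y)) (?e y)) = 0" using 0 by (simp only: sum.reindex[OF inj] o_def)
    from independent[OF this y(1)] show "g x = 0" using y(2) by simp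
  qed
  moreover have "fs.span (?e ` J) = U"
  proof
    show "fs.span (?e ` J) \<subseteq> U" by (rule fs.span_minimal[OF _ subspace_U]) (use e_mem_U in blast)
    have "(\<Sum>y\<in>J. scale_fun (c y) (?e y)) \<in> fs.span (?e ` J)" for c
      by (intro fs.span_sum fs.span_scale fs.span_base imageI)
    then show "U \<subseteq> fs.span (?e ` J)" unfolding U_eq by blast
  qed
  ultimately have "fs.dim U = card (?e ` J)" by (metis fs.dim_span_eq_card_independent)
  also have "\<dots> = card J" by (rule card_image[OF inj])
  also have "\<dots> = (\<Sum>n<length pqs. card (K n))" unfolding J_def by (rule card_SigmaI) (simp_all add: finite_K)
  finally show ?thesis by (simp add: K_def box_indices_def)
qed

end

section \<open>The exponential of a block diagonal matrix\<close>

definition mat_power :: "complex^'n^'n \<Rightarrow> nat \<Rightarrow> complex^'n^'n" where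
  "mat_power X k = (((**) X ^^ k) (mat 1))"

lemma mat_power_simps: "mat_power X 0 = mat 1" "mat_power X (Suc k) = X ** mat_power X k"
  by (simp_all add: mat_power_def)

lemma mat_power_scaleR:
  fixes X :: "complex^'n^'n"
  shows "mat_power (t *\<^sub>R X) k = t ^ k *\<^sub>R mat_power X k"
proof (induction k)
  case (Suc k)
  have "(t *\<^sub>R X) ** (s *\<^sub>R Y) = (t * s) *\<^sub>R (X ** Y)" for s and Y :: "complex^'n^'n"
    by (simp only: vec_eq_iff matrix_matrix_mult_def vec_lambda_beta vector_scaleR_component
        mult_scaleR_right mult_scaleR_left scaleR_sum_right scaleR_scaleR mult.commute simp_thms)
  then show ?case using Suc by (simp add: mat_power_simps)
qed (simp add: mat_power_simps)

lemma norm_mat_power_le: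
  fixes X :: "complex^'n^'n"
  obtains K where "0 < K" "\<And>k. norm (mat_power X k) \<le> K ^ k * norm (mat 1 :: complex^'n^'n)"
proof -
  have "X ** (r *\<^sub>R Y) = r *\<^sub>R (X ** Y)" for r and Y :: "complex^'n^'n"
    by (simp only: vec_eq_iff matrix_matrix_mult_def vec_lambda_beta vector_scaleR_component
        mult_scaleR_right scaleR_sum_right simp_thms)
  then have "linear (\<lambda>Y :: complex^'n^'n. X ** Y)"
    by (intro linearI matrix_add_ldistrib)
  then have "bounded_linear (\<lambda>Y :: complex^'n^'n. X ** Y)"
    by (simp only: linear_conv_bounded_linear)
  then have "\<exists>K>0. \<forall>Y :: complex^'n^'n. norm (X ** Y) \<le> norm Y * K"
    by (rule bounded_linear.pos_bounded)
  then obtain K where K: "0 < K" "\<And>Y :: complex^'n^'n. norm (X ** Y) \<le> norm Y * K" by blast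
  have "norm (mat_power X k) \<le> K ^ k * norm (mat 1 :: complex^'n^'n)" for k
  proof (induction k)
    case (Suc k)
    have "norm (mat_power X (Suc k)) \<le> norm (mat_power X k) * K" using K(2) by (simp add: mat_power_simps)
    also have "\<dots> \<le> K ^ k * norm (mat 1 :: complex^'n^'n) * K" using Suc K(1) by (simp add: mult_right_mono)
    finally show ?case by (simp add: mult_ac)
  qed (simp add: mat_power_simps)
  with K(1) show thesis by (rule that)
qed

lemma summable_matrix_exp:
  fixes X :: "complex^'n^'n"
  shows "summable (\<lambda>k. norm ((1 / fact k) *\<^sub>R mat_power X k))"
proof -
  obtain K where K: "0 < K" "\<And>k. norm (mat_power X k) \<le> K ^ k * norm (mat 1 :: complex^'n^'n)"
    using norm_mat_power_le[of X] by blast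
  have "summable (\<lambda>k. (inverse (fact k) * K ^ k) * norm (mat 1 :: complex^'n^'n))"
    by (intro summable_mult2 summable_exp)
  then show ?thesis
  proof (rule summable_comparison_test_ev[rotated])
    have "norm (norm ((1 / fact k) *\<^sub>R mat_power X k)) \<le> (inverse (fact k) * K ^ k) * norm (mat 1 :: complex^'n^'n)" for k
      using mult_left_mono[OF K(2)[of k], of "inverse (fact k)"] by (simp add: divide_inverse mult_ac)
    then show "\<forall>\<^sub>F k in sequentially. norm (norm ((1 / fact k) *\<^sub>R mat_power X k)) \<le>
        (inverse (fact k) * K ^ k) * norm (mat 1 :: complex^'n^'n)" by simp
  qed
qed

lemma matrix_exp_nth:
  fixes X :: "complex^'n^'n"
  shows "matrix_exp (t *\<^sub>R X) $ i $ j = (\<Sum>k. (mat_power X k $ i $ j / fact k) * of_real t ^ k)"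
  and summable_matrix_exp_nth: "summable (\<lambda>k. (mat_power X k $ i $ j / fact k) * of_real t ^ k)"
proof -
  have s: "summable (\<lambda>k. (1 / fact k) *\<^sub>R mat_power (t *\<^sub>R X) k)"
    by (rule summable_norm_cancel[OF summable_matrix_exp])
  have bl: "bounded_linear (\<lambda>Y :: complex^'n^'n. Y $ i $ j)"
    by (intro bounded_linear_compose[OF bounded_linear_vec_nth] bounded_linear_vec_nth)
  have e: "((1 / fact k) *\<^sub>R mat_power (t *\<^sub>R X) k) $ i $ j = (mat_power X k $ i $ j / fact k) * of_real t ^ k" for k
    unfolding mat_power_scaleR by (simp add: scaleR_conv_of_real[where 'a = complex])
  show "matrix_exp (t *\<^sub>R X) $ i $ j = (\<Sum>k. (mat_power X k $ i $ j / fact k) * of_real t ^ k)"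
    unfolding matrix_exp_def mat_power_def[symmetric] bounded_linear.suminf[OF bl s] e ..
  show "summable (\<lambda>k. (mat_power X k $ i $ j / fact k) * of_real t ^ k)"
    using bounded_linear.summable[OF bl s] unfolding e .
qed

lemma matrix_exp_0: "matrix_exp (0 *\<^sub>R X) = mat 1"
  unfolding vec_eq_iff matrix_exp_nth of_real_0 powser_zero by (simp add: mat_power_simps)

text \<open>The actions are differentiated at \<open>t = 0\<close>, so it is enough to differentiate the power series of each entry there.\<close>

lemma matrix_exp_nth_has_derivative:
  "((\<lambda>t. matrix_exp (t *\<^sub>R X) $ i $ j) has_vector_derivative X $ i $ j) (at 0)"
proof -
  define c where "c k = mat_power X k $ i $ j / fact k" for k
  have "summable (\<lambda>k. c k * z ^ k)" for z
  proof (rule powser_inside)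
    show "summable (\<lambda>k. c k * of_real (norm z + 1) ^ k)"
      unfolding c_def by (rule summable_matrix_exp_nth)
  qed simp
  then have "((\<lambda>z. \<Sum>k. c k * z ^ k) has_field_derivative (\<Sum>k. diffs c k * 0 ^ k)) (at 0)"
    by (rule termdiffs_strong_converges_everywhere)
  also have "(\<Sum>k. diffs c k * 0 ^ k) = X $ i $ j"
    by (simp add: powser_zero diffs_def c_def mat_power_simps)
  finally have "((\<lambda>z. \<Sum>k. c k * z ^ k) has_field_derivative X $ i $ j) (at (of_real 0))" by simp
  from has_vector_derivative_real_field[OF this, of UNIV]
  show ?thesis unfolding matrix_exp_nth c_def[symmetric] by (simp add: o_def)
qed

lemma sum_UNIV_Plus: "(\<Sum>x\<in>UNIV. g x) = (\<Sum>i\<in>UNIV. g (Inl i)) + (\<Sum>j\<in>UNIV. g (Inr j))"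
  for g :: "'a::finite + 'b::finite \<Rightarrow> 'c::comm_monoid_add"
  unfolding UNIV_Plus_UNIV[symmetric] by (subst sum.Plus) simp_all

lemma block_diag_nth:
  "block_diag A D $ Inl i $ Inl j = A $ i $ j" "block_diag A D $ Inr i $ Inr j = D $ i $ j"
  "block_diag A D $ Inl i $ Inr j = 0" "block_diag A D $ Inr i $ Inl j = 0"
  by (simp_all add: block_diag_def)

lemma forall_sum_index: "(\<forall>x :: 'a + 'b. P x) \<longleftrightarrow> (\<forall>i. P (Inl i)) \<and> (\<forall>j. P (Inr j))"
  by (metis sum.exhaust)

lemma block_diag_mult: "block_diag A D ** block_diag P Q = block_diag (A ** P) (D ** Q)"
  by (simp add: vec_eq_iff forall_sum_index block_diag_nth matrix_matrix_mult_def sum_UNIV_Plus)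

lemma mat_1_block_diag: "mat 1 = block_diag (mat 1) (mat 1)"
  by (simp add: vec_eq_iff forall_sum_index block_diag_nth mat_def)

lemma mat_power_block_diag: "mat_power (block_diag A D) k = block_diag (mat_power A k) (mat_power D k)"
  by (induction k) (simp_all add: mat_power_simps block_diag_mult mat_1_block_diag)

lemma matrix_exp_block_diag:
  "matrix_exp (t *\<^sub>R block_diag A D) = block_diag (matrix_exp (t *\<^sub>R A)) (matrix_exp (t *\<^sub>R D))"
  by (simp add: vec_eq_iff forall_sum_index block_diag_nth matrix_exp_nth mat_power_block_diag)

lemma block_blk:
  "blk11 (block_diag A D) = A" "blk12 (block_diag A D) = 0" "blk21 (block_diag A D) = 0" "blk22 (block_diag A D) = D"
  by (simp_all add: vec_eq_iff blk11_def blk12_def blk21_def blk22_def block_diag_nth)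

lemma matrix_inv_unique: "A ** B = mat 1 \<Longrightarrow> B ** A = mat 1 \<Longrightarrow> matrix_inv A = B"
proof -
  assume a: "A ** B = mat 1" "B ** A = mat 1"
  then have "invertible A" unfolding invertible_def by blast
  then have "matrix_inv A ** (A ** B) = B" by (simp add: matrix_mul_assoc matrix_inv_left_inverse)
  then show ?thesis by (simp add: a)
qed

lemma matrix_inv_2:
  assumes "det (A :: HC) \<noteq> 0"
  shows "matrix_inv A = cscale (inverse (det A)) (vector [vector [A $ 2 $ 2, - A $ 1 $ 2], vector [- A $ 2 $ 1, A $ 1 $ 1]])"
proof (rule matrix_inv_unique)
  have e: "A $ 1 $ 1 * A $ 2 $ 2 - A $ 1 $ 2 * A $ 2 $ 1 = det A" by (simp add: det_2)
  have d: "inverse (det A) * (A $ 1 $ 1 * A $ 2 $ 2) - inverse (det A) * (A $ 1 $ 2 * A $ 2 $ 1) = 1"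
    using assms by (simp add: e right_diff_distrib[symmetric])
  show "A ** cscale (inverse (det A)) (vector [vector [A $ 2 $ 2, - A $ 1 $ 2], vector [- A $ 2 $ 1, A $ 1 $ 1]]) = mat 1"
    using d by (simp add: vec_eq_iff forall_2 matrix_matrix_mult_def sum_2 mat_def mult_ac) 
  show "cscale (inverse (det A)) (vector [vector [A $ 2 $ 2, - A $ 1 $ 2], vector [- A $ 2 $ 1, A $ 1 $ 1]]) ** A = mat 1"
    using d by (simp add: vec_eq_iff forall_2 matrix_matrix_mult_def sum_2 mat_def mult_ac)
qed

lemma matrix_inv_block_diag:
  assumes "det A \<noteq> 0" "det D \<noteq> 0"
  shows "matrix_inv (block_diag A D) = block_diag (matrix_inv A) (matrix_inv D)"
proof (rule matrix_inv_unique)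
  have i: "invertible A" "invertible D" using assms by (simp_all add: invertible_det_nz)
  show "block_diag A D ** block_diag (matrix_inv A) (matrix_inv D) = mat 1"
    by (simp add: block_diag_mult matrix_inv_right_inverse i mat_1_block_diag)
  show "block_diag (matrix_inv A) (matrix_inv D) ** block_diag A D = mat 1"
    by (simp add: block_diag_mult matrix_inv_left_inverse i mat_1_block_diag)
qed

section \<open>Differentiation of the group actions\<close>

lemma has_derivative_vecI:
  fixes f :: "'a::real_normed_vector \<Rightarrow> ('b::euclidean_space)^'n"
  assumes "\<And>i. ((\<lambda>x. f x $ i) has_derivative (\<lambda>h. f' h $ i)) (at a within S)"
  shows "(f has_derivative f') (at a within S)"
proof (rule has_derivative_componentwise_within[THEN iffD2], rule ballI)
  fix v :: "'b^'n" assume "v \<in> Basis"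
  then obtain i u where v: "v = axis i u" by (auto simp: Basis_vec_def)
  show "((\<lambda>x. f x \<bullet> v) has_derivative (\<lambda>x. f' x \<bullet> v)) (at a within S)"
    unfolding v inner_axis
    by (rule bounded_linear.has_derivative[OF bounded_linear_inner_left assms])
qed

lemma has_vector_derivative_vecI:
  fixes f :: "real \<Rightarrow> ('b::euclidean_space)^'n"
  assumes "\<And>i. ((\<lambda>x. f x $ i) has_vector_derivative f' $ i) (at a within S)"
  shows "(f has_vector_derivative f') (at a within S)"
  unfolding has_vector_derivative_def
  by (rule has_derivative_vecI) (use assms in \<open>simp add: has_vector_derivative_def\<close>)

lemma has_vector_derivative_nth:
  assumes "((f :: real \<Rightarrow> ('b::euclidean_space)^'n) has_vector_derivative f') F"
  shows "((\<lambda>x. f x $ i) has_vector_derivative f' $ i) F"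
  by (rule bounded_linear.has_vector_derivative[OF bounded_linear_vec_nth assms])

lemma has_vector_derivative_grad:
  assumes "(c has_vector_derivative C) (at t)" "has_grad g G (c t)"
  shows "((\<lambda>s. g (c s)) has_vector_derivative pairing G C) (at t)"
proof -
  have "((\<lambda>s. g (c s)) has_derivative (\<lambda>h. pairing G (h *\<^sub>R C))) (at t)"
    using has_derivative_compose[of c "\<lambda>h. h *\<^sub>R C" t UNIV g "pairing G"] assms
    by (simp add: has_vector_derivative_def has_grad_def)
  moreover have "pairing G (h *\<^sub>R C) = h *\<^sub>R pairing G C" for h
    by (simp add: pairing_def algebra_simps)
  ultimately show ?thesis by (simp add: has_vector_derivative_def)
qed

lemma has_vector_derivative_matrix_mult:
  fixes c d :: "real \<Rightarrow> HC"
  assumes "(c has_vector_derivative C) (at t)" "(d has_vector_derivative D) (at t)"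
  shows "((\<lambda>s. c s ** d s) has_vector_derivative (c t ** D + C ** d t)) (at t)"
proof (intro has_vector_derivative_vecI)
  fix i j
  have c: "((\<lambda>s. c s $ i $ k) has_vector_derivative C $ i $ k) (at t)" for i k
    by (intro has_vector_derivative_nth assms)
  have d: "((\<lambda>s. d s $ i $ k) has_vector_derivative D $ i $ k) (at t)" for i k
    by (intro has_vector_derivative_nth assms)
  have "((\<lambda>s. c s $ i $ 1 * d s $ 1 $ j + c s $ i $ 2 * d s $ 2 $ j) has_vector_derivative
      (c t $ i $ 1 * D $ 1 $ j + C $ i $ 1 * d t $ 1 $ j) + (c t $ i $ 2 * D $ 2 $ j + C $ i $ 2 * d t $ 2 $ j)) (at t)"
    by (intro has_vector_derivative_add has_vector_derivative_mult c d)
  then show "((\<lambda>s. (c s ** d s) $ i $ j) has_vector_derivative (c t ** D + C ** d t) $ i $ j) (at t)"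
    by (simp add: matrix_matrix_mult_def sum_2 algebra_simps)
qed

lemma mat_1_nth: "mat 1 $ i $ j = (if i = j then 1 else 0)"
  by (simp add: mat_def)

lemma has_vector_derivative_inverse_det:
  fixes c :: "real \<Rightarrow> HC"
  assumes "(c has_vector_derivative C) (at 0)" "c 0 = mat 1"
  shows "((\<lambda>s. inverse (det (c s))) has_vector_derivative - trace C) (at 0)"
proof -
  have d: "det (c 0) \<noteq> 0" using assms(2) by simp
  have "((\<lambda>s. det (c s) powi (- 1)) has_vector_derivative pairing (cscale (of_int (- 1) * det (c 0) powi (- 1 - 1)) (cofactor (c 0))) C) (at 0)"
    by (rule has_vector_derivative_grad[OF assms(1)]) (rule has_grad_powi[OF has_grad_det d])
  then show ?thesis
    by (simp add: assms(2) pairing_def cofactor_def mat_1_nth trace_def sum_2 power_int_minus)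
qed

text \<open>The formula for the inverse is available only near \<open>0\<close>, which suffices for a derivative at \<open>0\<close>.\<close>

lemma eventually_unit_curve:
  assumes "(c has_vector_derivative C) (at (0 :: real))" "c 0 = mat 1"
  shows "\<forall>\<^sub>F s in nhds 0. det (c s :: HC) \<noteq> 0"
proof -
  have "isCont c 0" using assms(1) by (rule has_vector_derivative_continuous)
  then have "(c \<longlongrightarrow> mat 1) (at 0)" using assms(2) by (simp add: isCont_def)
  from topological_tendstoD[OF this open_units] show ?thesis
    unfolding eventually_nhds_conv_at using assms(2) by simp
qed

lemma has_vector_derivative_matrix_inv:
  fixes c :: "real \<Rightarrow> HC"
  assumes "(c has_vector_derivative C) (at 0)" "c 0 = mat 1"
  shows "((\<lambda>s. matrix_inv (c s)) has_vector_derivative - C) (at 0)"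
proof -
  let ?adj = "\<lambda>M :: HC. vector [vector [M $ 2 $ 2, - M $ 1 $ 2], vector [- M $ 2 $ 1, M $ 1 $ 1]] :: HC"
  have c: "((\<lambda>s. c s $ i $ k) has_vector_derivative C $ i $ k) (at 0)" for i k
    by (intro has_vector_derivative_nth assms)
  have adj: "((\<lambda>s. ?adj (c s) $ i $ j) has_vector_derivative ?adj C $ i $ j) (at 0)" for i j
    using exhaust_2[of i] exhaust_2[of j] c has_vector_derivative_minus[OF c] by auto
  have "((\<lambda>s. cscale (inverse (det (c s))) (?adj (c s))) has_vector_derivative - C) (at 0)"
  proof (intro has_vector_derivative_vecI)
    fix i j
    have "((\<lambda>s. inverse (det (c s)) * ?adj (c s) $ i $ j) has_vector_derivative
      inverse (det (c 0)) * ?adj C $ i $ j + (- trace C) * ?adj (c 0) $ i $ j) (at 0)"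
      by (intro has_vector_derivative_mult has_vector_derivative_inverse_det assms adj)
    moreover have "inverse (det (c 0)) * ?adj C $ i $ j + (- trace C) * ?adj (c 0) $ i $ j = (- C) $ i $ j"
      using exhaust_2[of i] exhaust_2[of j] by (auto simp: assms(2) trace_def sum_2 mat_1_nth)
    ultimately show "((\<lambda>s. cscale (inverse (det (c s))) (?adj (c s)) $ i $ j) has_vector_derivative (- C) $ i $ j) (at 0)"
      by simp
  qed
  moreover have "\<forall>\<^sub>F s in nhds 0. cscale (inverse (det (c s))) (?adj (c s)) = matrix_inv (c s)"
    using eventually_unit_curve[OF assms] by eventually_elim (simp add: matrix_inv_2)
  ultimately show ?thesis
    using assms(2) by (subst has_vector_derivative_cong_ev[where g = "\<lambda>s. cscale (inverse (det (c s))) (?adj (c s))"])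
      (auto simp: matrix_inv_2 elim: eventually_mono)
qed

lemma matrix_exp_has_vector_derivative:
  fixes X :: HC
  shows "((\<lambda>t. matrix_exp (t *\<^sub>R X)) has_vector_derivative X) (at 0)"
  by (intro has_vector_derivative_vecI matrix_exp_nth_has_derivative)

lemma matrix_inv_mat_1: "matrix_inv (mat 1 :: HC) = mat 1"
  by (rule matrix_inv_unique) simp_all

lemma matrix_inv_matrix_inv: "det (A :: HC) \<noteq> 0 \<Longrightarrow> matrix_inv (matrix_inv A) = A"
  by (rule matrix_inv_unique) (simp_all add: matrix_inv_left_inverse matrix_inv_right_inverse invertible_det_nz)

context
  fixes A D Z :: HC and f :: "HC \<Rightarrow> complex^2" and f'
  assumes A: "A \<in> sl2" and D: "D \<in> sl2" and f: "(f has_derivative f') (at Z)"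
begin

abbreviation "eA \<equiv> \<lambda>t. matrix_exp (t *\<^sub>R A)"
abbreviation "eD \<equiv> \<lambda>t. matrix_exp (t *\<^sub>R D)"

lemma exp0: "eA 0 = mat 1" "eD 0 = mat 1"
  by (rule matrix_exp_0)+

lemma orbit_derivative:
  "((\<lambda>t. f (matrix_inv (eA t) ** (Z ** eD t))) has_vector_derivative f' (Z ** D - A ** Z)) (at 0)"
proof -
  have "((\<lambda>t. matrix_inv (eA t) ** (Z ** eD t)) has_vector_derivative
     matrix_inv (eA 0) ** (Z ** D + 0 ** eD 0) + (- A) ** (Z ** eD 0)) (at 0)"
    by (intro has_vector_derivative_matrix_mult has_vector_derivative_matrix_inv has_vector_derivative_const
        matrix_exp_has_vector_derivative exp0)
  moreover have "matrix_inv (eA 0) ** (Z ** D + 0 ** eD 0) + (- A) ** (Z ** eD 0) = Z ** D - A ** Z"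
    unfolding exp0 matrix_inv_mat_1
    by (simp add: vec_eq_iff forall_2 matrix_matrix_mult_def sum_2 mat_1_nth)
  ultimately have P: "((\<lambda>t. matrix_inv (eA t) ** (Z ** eD t)) has_vector_derivative Z ** D - A ** Z) (at 0)"
    by simp
  have Z: "matrix_inv (eA 0) ** (Z ** eD 0) = Z" unfolding exp0 matrix_inv_mat_1 by simp
  have "((f \<circ> (\<lambda>t. matrix_inv (eA t) ** (Z ** eD t))) has_vector_derivative f' (Z ** D - A ** Z)) (at 0)"
    by (rule vector_derivative_diff_chain_within[OF P has_derivative_at_withinI])
      (use f Z in simp)
  then show ?thesis by (simp add: o_def)
qed

lemma pi_l_derivative:
  "vector_derivative (\<lambda>t. pi_l (matrix_exp (t *\<^sub>R block_diag A D)) f Z) (at 0) = A *v f Z + f' (Z ** D - A ** Z)"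
proof -
  have trA: "trace A = 0" using A by (simp add: sl2_def quat_Re_def)
  have F: "((\<lambda>t. f (matrix_inv (eA t) ** (Z ** eD t)) $ k) has_vector_derivative f' (Z ** D - A ** Z) $ k) (at 0)" for k
    by (intro has_vector_derivative_nth orbit_derivative)
  have M: "((\<lambda>t. eA t $ i $ j) has_vector_derivative A $ i $ j) (at 0)" for i j
    by (intro has_vector_derivative_nth matrix_exp_has_vector_derivative)
  have "((\<lambda>t. inverse (det (eA t)) *s (eA t *v f (matrix_inv (eA t) ** (Z ** eD t)))) has_vector_derivative
      (A *v f Z + f' (Z ** D - A ** Z))) (at 0)"
  proof (rule has_vector_derivative_vecI)
    fix k :: 2
    have "((\<lambda>t. inverse (det (eA t)) * (eA t $ k $ 1 * f (matrix_inv (eA t) ** (Z ** eD t)) $ 1 + eA t $ k $ 2 * f (matrix_inv (eA t) ** (Z ** eD t)) $ 2))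
      has_vector_derivative (inverse (det (eA 0)) * ((eA 0 $ k $ 1 * f' (Z ** D - A ** Z) $ 1 + A $ k $ 1 * f (matrix_inv (eA 0) ** (Z ** eD 0)) $ 1)
        + (eA 0 $ k $ 2 * f' (Z ** D - A ** Z) $ 2 + A $ k $ 2 * f (matrix_inv (eA 0) ** (Z ** eD 0)) $ 2))
      + (- trace A) * (eA 0 $ k $ 1 * f (matrix_inv (eA 0) ** (Z ** eD 0)) $ 1 + eA 0 $ k $ 2 * f (matrix_inv (eA 0) ** (Z ** eD 0)) $ 2))) (at 0)"
      by (intro has_vector_derivative_mult has_vector_derivative_add F M has_vector_derivative_inverse_det
          matrix_exp_has_vector_derivative exp0)
    then show "((\<lambda>t. (inverse (det (eA t)) *s (eA t *v f (matrix_inv (eA t) ** (Z ** eD t)))) $ k) has_vector_derivative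
      (A *v f Z + f' (Z ** D - A ** Z)) $ k) (at 0)"
      using exhaust_2[of k] unfolding exp0 matrix_inv_mat_1 trA
      by (auto simp: matrix_vector_mult_def sum_2 mat_1_nth algebra_simps)
  qed
  moreover have "pi_l (matrix_exp (t *\<^sub>R block_diag A D)) f Z =
     inverse (det (eA t)) *s (eA t *v f (matrix_inv (eA t) ** (Z ** eD t)))" for t
    by (simp add: pi_l_def Let_def matrix_exp_block_diag block_blk)
  ultimately show ?thesis by (simp add: vector_derivative_at)
qed

text \<open>Inverting the block diagonal matrix blockwise gives the same orbit of \<open>Z\<close> as for the left action, while \<open>e\<^sup>-\<^sup>t\<^sup>D\<close>
acts on the values; this is the source of the sign.\<close>

lemma pi_r_derivative:
  "vector_derivative (\<lambda>t. pi_r (matrix_exp (t *\<^sub>R block_diag A D)) f Z) (at 0) = f' (Z ** D - A ** Z) - f Z v* D"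
proof -
  have trD: "trace D = 0" using D by (simp add: sl2_def quat_Re_def)
  have F: "((\<lambda>t. f (matrix_inv (eA t) ** (Z ** eD t)) $ k) has_vector_derivative f' (Z ** D - A ** Z) $ k) (at 0)" for k
    by (intro has_vector_derivative_nth orbit_derivative)
  have I: "((\<lambda>t. matrix_inv (eD t)) has_vector_derivative - D) (at 0)"
    by (intro has_vector_derivative_matrix_inv matrix_exp_has_vector_derivative exp0)
  have M: "((\<lambda>t. matrix_inv (eD t) $ i $ j) has_vector_derivative (- D) $ i $ j) (at 0)" for i j
    by (intro has_vector_derivative_nth I)
  have I0: "matrix_inv (eD 0) = mat 1" unfolding exp0 by (rule matrix_inv_mat_1)
  have "((\<lambda>t. inverse (det (matrix_inv (eD t))) *s (f (matrix_inv (eA t) ** (Z ** eD t)) v* matrix_inv (eD t))) has_vector_derivative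
      (f' (Z ** D - A ** Z) - f Z v* D)) (at 0)"
  proof (rule has_vector_derivative_vecI)
    fix k :: 2
    have "((\<lambda>t. inverse (det (matrix_inv (eD t))) * (matrix_inv (eD t) $ 1 $ k * f (matrix_inv (eA t) ** (Z ** eD t)) $ 1 + matrix_inv (eD t) $ 2 $ k * f (matrix_inv (eA t) ** (Z ** eD t)) $ 2))
      has_vector_derivative (inverse (det (matrix_inv (eD 0))) * ((matrix_inv (eD 0) $ 1 $ k * f' (Z ** D - A ** Z) $ 1 + (- D) $ 1 $ k * f (matrix_inv (eA 0) ** (Z ** eD 0)) $ 1)
        + (matrix_inv (eD 0) $ 2 $ k * f' (Z ** D - A ** Z) $ 2 + (- D) $ 2 $ k * f (matrix_inv (eA 0) ** (Z ** eD 0)) $ 2))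
      + (- trace (- D)) * (matrix_inv (eD 0) $ 1 $ k * f (matrix_inv (eA 0) ** (Z ** eD 0)) $ 1 + matrix_inv (eD 0) $ 2 $ k * f (matrix_inv (eA 0) ** (Z ** eD 0)) $ 2))) (at 0)"
      by (intro has_vector_derivative_mult has_vector_derivative_add F M has_vector_derivative_inverse_det I I0)
    moreover have "trace (- D) = 0" using trD by (simp add: trace_def sum_negf)
    ultimately show "((\<lambda>t. (inverse (det (matrix_inv (eD t))) *s (f (matrix_inv (eA t) ** (Z ** eD t)) v* matrix_inv (eD t))) $ k) has_vector_derivative
      (f' (Z ** D - A ** Z) - f Z v* D) $ k) (at 0)"
      using exhaust_2[of k] unfolding I0 exp0 matrix_inv_mat_1
      by (auto simp: vector_matrix_mult_def sum_2 mat_1_nth algebra_simps)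
  qed
  moreover have "\<forall>\<^sub>F t in nhds 0. pi_r (matrix_exp (t *\<^sub>R block_diag A D)) f Z =
     inverse (det (matrix_inv (eD t))) *s (f (matrix_inv (eA t) ** (Z ** eD t)) v* matrix_inv (eD t))"
    using eventually_unit_curve[OF matrix_exp_has_vector_derivative exp0(1)]
      eventually_unit_curve[OF matrix_exp_has_vector_derivative exp0(2)]
    by eventually_elim
      (simp add: pi_r_def Let_def matrix_exp_block_diag matrix_inv_block_diag block_blk matrix_inv_matrix_inv matrix_mul_assoc)
  ultimately have "((\<lambda>t. pi_r (matrix_exp (t *\<^sub>R block_diag A D)) f Z) has_vector_derivative (f' (Z ** D - A ** Z) - f Z v* D)) (at 0)"
    by (subst has_vector_derivative_cong_ev) (auto elim: eventually_mono dest: eventually_nhds_x_imp_x)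
  then show ?thesis by (rule vector_derivative_at)
qed

end

section \<open>The Lie algebra action on the basis\<close>

text \<open>The infinitesimal form of \<open>g(e\<^sup>-\<^sup>t\<^sup>A Z e\<^sup>t\<^sup>D)\<close>, that is, of both actions without their effect on the values.\<close>

definition flow :: "HC \<Rightarrow> HC \<Rightarrow> (HC \<Rightarrow> complex) \<Rightarrow> HC \<Rightarrow> complex" where
  "flow A D g Z = pairing (\<chi> a b. pd a b g Z) (Z ** D - A ** Z)"

lemma flow_eq_0: "det Z = 0 \<Longrightarrow> flow A D g Z = 0"
  by (simp add: flow_def pairing_def pd_def on_units_def)

lemma flow_add: "g \<in> laurent_ring \<Longrightarrow> h \<in> laurent_ring \<Longrightarrow>
    flow A D (\<lambda>Z. g Z + h Z) Z = flow A D g Z + flow A D h Z"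
  by (simp add: flow_def pairing_def pd_add algebra_simps)

lemma flow_scale: "g \<in> laurent_ring \<Longrightarrow> flow A D (\<lambda>Z. c * g Z) Z = c * flow A D g Z"
  by (simp add: flow_def pairing_def pd_scale algebra_simps)

lemma laurent_has_derivative:
  assumes "f \<in> laurent_vectors" "det Z \<noteq> 0"
  shows "(f has_derivative (\<lambda>H. \<chi> k. pairing (\<chi> a b. pd a b (\<lambda>Y. f Y $ k) Z) H)) (at Z)"
  by (rule has_derivative_vecI)
    (use has_grad_pd[OF laurent_vectorsD[OF assms(1)] assms(2)] in \<open>simp add: has_grad_def\<close>)

lemma differentiated_pi_l:
  assumes "f \<in> laurent_vectors" "A \<in> sl2" "D \<in> sl2"
  shows "differentiated pi_l (block_diag A D) f = (\<lambda>Z. A *v f Z + (\<chi> k. flow A D (\<lambda>Y. f Y $ k) Z))"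
proof
  fix Z
  show "differentiated pi_l (block_diag A D) f Z = A *v f Z + (\<chi> k. flow A D (\<lambda>Y. f Y $ k) Z)"
  proof (cases "det Z = 0")
    case True
    then show ?thesis
      by (simp add: differentiated_def on_units_def laurent_vectors_eq_0[OF assms(1)] flow_eq_0 zero_vec_def[symmetric])
  next
    case False
    then show ?thesis
      using pi_l_derivative[OF assms(2,3) laurent_has_derivative[OF assms(1) False]]
      by (simp add: differentiated_def flow_def)
  qed
qed

lemma differentiated_pi_r:
  assumes "f \<in> laurent_vectors" "A \<in> sl2" "D \<in> sl2"
  shows "differentiated pi_r (block_diag A D) f = (\<lambda>Z. (\<chi> k. flow A D (\<lambda>Y. f Y $ k) Z) - f Z v* D)"
proof
  fix Z
  show "differentiated pi_r (block_diag A D) f Z = (\<chi> k. flow A D (\<lambda>Y. f Y $ k) Z) - f Z v* D"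
  proof (cases "det Z = 0")
    case True
    then show ?thesis
      by (simp add: differentiated_def on_units_def laurent_vectors_eq_0[OF assms(1)] flow_eq_0 zero_vec_def[symmetric])
  next
    case False
    then show ?thesis
      using pi_r_derivative[OF assms(2,3) laurent_has_derivative[OF assms(1) False]]
      by (simp add: differentiated_def flow_def)
  qed
qed

lemma linear_differentiated_pi_l:
  assumes "X \<in> sl2_sl2" "U \<subseteq> laurent_vectors"
  shows "linear_on scale_fun scale_fun U (differentiated pi_l X)"
proof (rule linear_on_subset[OF _ assms(2)])
  obtain A D where X: "A \<in> sl2" "D \<in> sl2" "X = block_diag A D" using assms(1) unfolding sl2_sl2_iff by blast
  have "f + g \<in> laurent_vectors" "scale_fun c f \<in> laurent_vectors" if "f \<in> laurent_vectors" "g \<in> laurent_vectors" for f g c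
    using that subspace_laurent_vectors by (auto simp only: fs.subspace_def)
  then show "linear_on scale_fun scale_fun laurent_vectors (differentiated pi_l X)"
    unfolding linear_on_def X(3)
    by (auto simp: differentiated_pi_l X(1,2) fun_eq_iff vec_eq_iff scale_fun_def flow_add flow_scale
        laurent_vectorsD matrix_vector_mult_def sum_2 algebra_simps)
qed

text \<open>The vector field is a combination of the polarisation operators on rows and on columns. Since both traces vanish, the
contributions of \<open>N\<^sup>r\<close> cancel.\<close>

lemma flow_Nmcoeff:
  assumes "A \<in> sl2" "D \<in> sl2"
  shows "flow A D (Nmcoeff r m i j) Z =
     - (A $ 1 $ 1 * (2 * of_int i - of_nat m)) * Nmcoeff r m i j Z
     - A $ 2 $ 1 * ((of_int i + 1) * Nmcoeff r m (i + 1) j Z)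
     - A $ 1 $ 2 * ((of_nat m - of_int i + 1) * Nmcoeff r m (i - 1) j Z)
     + D $ 1 $ 1 * (2 * of_int j - of_nat m) * Nmcoeff r m i j Z
     + D $ 1 $ 2 * ((of_int j + 1) * Nmcoeff r m i (j + 1) Z)
     + D $ 2 $ 1 * ((of_nat m - of_int j + 1) * Nmcoeff r m i (j - 1) Z)"
proof (cases "det Z = 0")
  case True
  then show ?thesis by (simp add: flow_eq_0 Nmcoeff_def on_units_def)
next
  case False
  define G where "G a b = pd a b (Nmcoeff r m i j) Z" for a b
  have "flow A D (Nmcoeff r m i j) Z =
     - (A $ 1 $ 1 * (Z $ 1 $ 1 * G 1 1 + Z $ 1 $ 2 * G 1 2))
     - A $ 2 $ 2 * (Z $ 2 $ 1 * G 2 1 + Z $ 2 $ 2 * G 2 2)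
     - A $ 2 $ 1 * (Z $ 1 $ 1 * G 2 1 + Z $ 1 $ 2 * G 2 2)
     - A $ 1 $ 2 * (Z $ 2 $ 1 * G 1 1 + Z $ 2 $ 2 * G 1 2)
     + D $ 1 $ 1 * (Z $ 1 $ 1 * G 1 1 + Z $ 2 $ 1 * G 2 1)
     + D $ 2 $ 2 * (Z $ 1 $ 2 * G 1 2 + Z $ 2 $ 2 * G 2 2)
     + D $ 1 $ 2 * (Z $ 1 $ 1 * G 1 2 + Z $ 2 $ 1 * G 2 2)
     + D $ 2 $ 1 * (Z $ 1 $ 2 * G 1 1 + Z $ 2 $ 2 * G 2 1)"
    by (simp add: flow_def pairing_def G_def[symmetric] matrix_matrix_mult_def sum_2 algebra_simps)
  then show ?thesis
    using assms unfolding G_def Nmcoeff_row[OF False] Nmcoeff_col[OF False] sl2_iff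
    by (simp add: algebra_simps)
qed

lemma box_basis_bvec:
  "box_basis (differentiated pi_l) (width k m) m (\<lambda>i j. bvec (k, r, nat m, i, j))"
  unfolding box_basis_def
proof (intro ballI conjI)
  fix i j assume i: "i \<in> {0..width k m}" and j: "j \<in> {0..m}"
  then have m: "int (nat m) = m" by simp
  show "bvec (k, r, nat m, - 1, j) = 0" "bvec (k, r, nat m, width k m + 1, j) = 0"
    "bvec (k, r, nat m, i, - 1) = 0" "bvec (k, r, nat m, i, m + 1) = 0"
    using m by (cases k; simp add: fun_eq_iff vec_eq_iff forall_2 Nmcoeff_outside width_def)+
  fix A D assume A: "A \<in> sl2" and D: "D \<in> sl2"
  have a: "A $ 2 $ 2 = - A $ 1 $ 1" "D $ 2 $ 2 = - D $ 1 $ 1" using A D by (simp_all add: sl2_iff)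
  obtain n where mn: "m = int n" using j by (metis atLeastAtMost_iff nonneg_int_cases order_trans)
  have n: "flow A D (\<lambda>Y. - Nmcoeff r n (i - 1) j Y) Z = - flow A D (Nmcoeff r n (i - 1) j) Z" for Z
    using flow_scale[OF Nmcoeff_laurent, of A D "- 1"] by simp
  show "differentiated pi_l (block_diag A D) (bvec (k, r, nat m, i, j)) =
         scale_fun (- (A $ 1 $ 1 * of_int i + A $ 2 $ 2 * of_int (width k m - i))) (bvec (k, r, nat m, i, j))
       + scale_fun (- (A $ 2 $ 1 * of_int (i + 1))) (bvec (k, r, nat m, i + 1, j))
       + scale_fun (- (A $ 1 $ 2 * of_int (width k m - i + 1))) (bvec (k, r, nat m, i - 1, j))
       + scale_fun (D $ 1 $ 1 * of_int j + D $ 2 $ 2 * of_int (m - j)) (bvec (k, r, nat m, i, j))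
       + scale_fun (D $ 1 $ 2 * of_int (j + 1)) (bvec (k, r, nat m, i, j + 1))
       + scale_fun (D $ 2 $ 1 * of_int (m - j + 1)) (bvec (k, r, nat m, i, j - 1))"
    unfolding differentiated_pi_l[OF bvec_laurent A D]
  proof (rule ext, unfold vec_eq_iff, rule allI)
    fix Z and l :: 2
    show "(A *v bvec (k, r, nat m, i, j) Z + (\<chi> l. flow A D (\<lambda>Y. bvec (k, r, nat m, i, j) Y $ l) Z)) $ l =
        (scale_fun (- (A $ 1 $ 1 * of_int i + A $ 2 $ 2 * of_int (width k m - i))) (bvec (k, r, nat m, i, j))
       + scale_fun (- (A $ 2 $ 1 * of_int (i + 1))) (bvec (k, r, nat m, i + 1, j))
       + scale_fun (- (A $ 1 $ 2 * of_int (width k m - i + 1))) (bvec (k, r, nat m, i - 1, j))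
       + scale_fun (D $ 1 $ 1 * of_int j + D $ 2 $ 2 * of_int (m - j)) (bvec (k, r, nat m, i, j))
       + scale_fun (D $ 1 $ 2 * of_int (j + 1)) (bvec (k, r, nat m, i, j + 1))
       + scale_fun (D $ 2 $ 1 * of_int (m - j + 1)) (bvec (k, r, nat m, i, j - 1))) Z $ l"
    proof (cases k)
      case True
      then show ?thesis using exhaust_2[of l]
        by (elim disjE) (simp_all add: mn matrix_vector_mult_def sum_2 scale_fun_def n flow_Nmcoeff[OF A D] a width_def,
            simp_all add: algebra_simps)
    next
      case False
      then show ?thesis using exhaust_2[of l]
        by (elim disjE) (simp_all add: mn matrix_vector_mult_def sum_2 scale_fun_def flow_scale[OF Nmcoeff_laurent]
            flow_Nmcoeff[OF A D] a width_def, simp_all add: algebra_simps)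
    qed
  qed
qed

section \<open>Transposition\<close>

text \<open>Transposing the argument exchanges rows and columns, \<open>\<nabla>\<close> and its right version, and the two
actions, if \<open>(A, D)\<close> is replaced by \<open>(- D\<^sup>T, - A\<^sup>T)\<close>. All results on rows are obtained from those on columns in this way.\<close>

definition transposed :: "(HC \<Rightarrow> 'a) \<Rightarrow> HC \<Rightarrow> 'a" where
  "transposed f Z = f (transpose Z)"

lemma transposed_transposed [simp]: "transposed (transposed f) = f"
  by (simp add: fun_eq_iff transposed_def)

lemma transposed_nth: "(\<lambda>Z. transposed f Z $ k) = transposed (\<lambda>Z. f Z $ k)"
  by (simp add: fun_eq_iff transposed_def)

lemma laurent_transposed: "g \<in> laurent_ring \<Longrightarrow> transposed g \<in> laurent_ring"
proof -
  assume "g \<in> laurent_ring"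
  then have "g \<in> Nmcoeff_span" by (rule laurent_ring_subset_Nmcoeff_span)
  then show ?thesis
  proof (induction rule: Nmcoeff_span.induct)
    case (add g c r m i j)
    have "transposed (\<lambda>Z. c * Nmcoeff r m i j Z + g Z) = (\<lambda>Z. c * Nmcoeff r m j i Z + transposed g Z)"
      by (simp add: fun_eq_iff transposed_def Nmcoeff_transpose)
    also have "\<dots> \<in> laurent_ring" by (intro laurent_ring.add laurent_scale Nmcoeff_laurent add.IH)
    finally show ?case .
  qed (simp add: transposed_def[abs_def] laurent_zero)
qed

lemma has_grad_transposed:
  assumes "has_grad g G (transpose Z)"
  shows "has_grad (transposed g) (transpose G) Z"
proof -
  have "linear (transpose :: HC \<Rightarrow> HC)"
    by (rule linearI) (simp_all add: vec_eq_iff transpose_def)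
  then have "(transpose has_derivative (transpose :: HC \<Rightarrow> HC)) (at Z)"
    by (simp add: linear_conv_bounded_linear bounded_linear_imp_has_derivative)
  from has_derivative_compose[OF this, of g "pairing G"] assms
  have "((\<lambda>Z. g (transpose Z)) has_derivative (\<lambda>H. pairing G (transpose H))) (at Z)"
    by (simp add: has_grad_def)
  moreover have "pairing G (transpose H) = pairing (transpose G) H" for H
    by (simp add: pairing_def transpose_def)
  ultimately show ?thesis by (simp add: has_grad_def transposed_def[abs_def])
qed

lemma pd_transposed:
  assumes "g \<in> laurent_ring"
  shows "pd a b (transposed g) = transposed (pd b a g)"
proof (rule pd_eqI[where G = "\<lambda>a b. transposed (pd b a g)"])
  show "transposed (pd b a g) \<in> laurent_ring" by (intro laurent_transposed pd_laurent assms)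
  fix Z :: HC assume "det Z \<noteq> 0"
  then have "det (transpose Z) \<noteq> 0" by (simp add: det_transpose)
  from has_grad_transposed[OF has_grad_pd[OF assms this]]
  show "has_grad (transposed g) (\<chi> a b. transposed (pd b a g) Z) Z"
    by (rule has_grad_eq) (simp add: vec_eq_iff transpose_def transposed_def)
qed

lemma laplace_transposed: "g \<in> laurent_ring \<Longrightarrow> laplace (transposed g) = transposed (laplace g)"
  by (simp add: fun_eq_iff laplace_def pd_transposed pd_laurent laurent_transposed transposed_def)

lemma laurent_vectors_transposed: "f \<in> laurent_vectors \<Longrightarrow> transposed f \<in> laurent_vectors"
  by (simp add: laurent_vectors_def transposed_nth laurent_transposed)

lemma vlaplace_transposed: "f \<in> laurent_vectors \<Longrightarrow> vlaplace (transposed f) = transposed (vlaplace f)"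
  by (simp add: fun_eq_iff vlaplace_def vec_eq_iff transposed_nth laplace_transposed laurent_vectorsD)
    (simp add: transposed_def vlaplace_def)

lemma transposed_spaceU: "transposed f \<in> spaceU' \<longleftrightarrow> f \<in> spaceU"
proof -
  have L: "transposed f \<in> laurent_vectors \<longleftrightarrow> f \<in> laurent_vectors"
    using laurent_vectors_transposed[of f] laurent_vectors_transposed[of "transposed f"] by auto
  have "(\<forall>Z a. (\<Sum>b\<in>UNIV. pd a b (\<lambda>Y. vlaplace (transposed f) Y $ b) Z) = 0) \<longleftrightarrow>
      (\<forall>Z a. (\<Sum>b\<in>UNIV. pd b a (\<lambda>Y. vlaplace f Y $ b) Z) = 0)" if f: "f \<in> laurent_vectors"
  proof -
    have "pd a b (\<lambda>Y. vlaplace (transposed f) Y $ b) Z = pd b a (\<lambda>Y. vlaplace f Y $ b) (transpose Z)" for a b Z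
      by (simp add: vlaplace_transposed f transposed_nth pd_transposed vlaplace_laurent laurent_vectorsD)
        (simp add: transposed_def)
    then have e: "(\<Sum>b\<in>UNIV. pd a b (\<lambda>Y. vlaplace (transposed f) Y $ b) Z) =
        (\<Sum>b\<in>UNIV. pd b a (\<lambda>Y. vlaplace f Y $ b) (transpose Z))" for a Z by (simp only:)
    show ?thesis
    proof (intro iffI allI)
      fix Z a assume "\<forall>Z a. (\<Sum>b\<in>UNIV. pd a b (\<lambda>Y. vlaplace (transposed f) Y $ b) Z) = 0"
      then show "(\<Sum>b\<in>UNIV. pd b a (\<lambda>Y. vlaplace f Y $ b) Z) = 0"
        using e[of a "transpose Z"] by simp
    qed (simp add: e)
  qed
  then show ?thesis unfolding spaceU_iff spaceU'_iff using L by blast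
qed

lemma homogeneous_transposed: "homogeneous d (transposed f) \<longleftrightarrow> homogeneous d f"
proof -
  have "homogeneous d (transposed f)" if "homogeneous d f" for f
  proof -
    have "transpose (cscale c Z) = cscale c (transpose Z)" for c and Z :: HC
      by (simp add: vec_eq_iff transpose_def)
    then show ?thesis using that by (simp add: homogeneous_def transposed_def det_transpose)
  qed
  from this[of f] this[of "transposed f"] show ?thesis by auto
qed

lemma U'_deg_eq_transposed: "U'_deg d = transposed ` U_deg d"
proof (intro equalityI subsetI)
  fix g assume "g \<in> U'_deg d"
  then have "transposed g \<in> U_deg d"
    using transposed_spaceU[of "transposed g"] homogeneous_transposed[of d g] by (simp add: U_deg_def U'_deg_def)
  then show "g \<in> transposed ` U_deg d" by (rule image_eqI[rotated]) simp
next
  fix g assume "g \<in> transposed ` U_deg d"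
  then show "g \<in> U'_deg d"
    by (auto simp: U_deg_def U'_deg_def transposed_spaceU homogeneous_transposed)
qed

lemma differentiated_pi_r_transposed:
  assumes f: "f \<in> laurent_vectors" and A: "A \<in> sl2" and D: "D \<in> sl2"
  shows "differentiated pi_r (block_diag A D) (transposed f) =
    transposed (differentiated pi_l (block_diag (- transpose D) (- transpose A)) f)"
proof -
  have AD: "- transpose D \<in> sl2" "- transpose A \<in> sl2"
    using A D by (simp_all add: neg_transpose_sl2)
  have "flow A D (transposed g) Z = flow (- transpose D) (- transpose A) g (transpose Z)" if "g \<in> laurent_ring" for g Z
    by (simp add: flow_def pairing_def pd_transposed that)
      (simp add: transposed_def transpose_def matrix_matrix_mult_def sum_2 algebra_simps)
  then have fl: "flow A D (\<lambda>Y. transposed f Y $ k) Z = flow (- transpose D) (- transpose A) (\<lambda>Y. f Y $ k) (transpose Z)" for k Z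
    unfolding transposed_nth using laurent_vectorsD[OF f] by blast
  have "f Z v* D = - ((- transpose D) *v f Z)" for Z
    by (simp add: vec_eq_iff vector_matrix_mult_def matrix_vector_mult_def transpose_def sum_2)
  then show ?thesis
    unfolding differentiated_pi_l[OF f AD] differentiated_pi_r[OF laurent_vectors_transposed[OF f] A D] fl
    by (simp add: fun_eq_iff transposed_def add.commute)
qed

text \<open>The twist \<open>(A, D) \<mapsto> (- D\<^sup>T, - A\<^sup>T)\<close> carries the standard formulas to themselves with both factors exchanged.\<close>

lemma box_basis_transposed:
  assumes b: "box_basis (differentiated pi_l) p q b" and L: "\<And>i j. b i j \<in> laurent_vectors"
  shows "box_basis (differentiated pi_r) q p (\<lambda>i j. transposed (b j i))"
  unfolding box_basis_def
proof (intro ballI conjI)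
  fix i j assume ij: "i \<in> {0..q}" "j \<in> {0..p}"
  note B = bspec[OF bspec[OF b[unfolded box_basis_def] ij(2)] ij(1)]
  have t0: "transposed (0 :: HC \<Rightarrow> complex^2) = 0" by (simp add: fun_eq_iff transposed_def)
  show "transposed (b j (- 1)) = 0" "transposed (b j (q + 1)) = 0" "transposed (b (- 1) i) = 0" "transposed (b (p + 1) i) = 0"
    using B t0 by metis+
  fix A D assume A: "A \<in> sl2" and D: "D \<in> sl2"
  have AD: "- transpose D \<in> sl2" "- transpose A \<in> sl2"
    using A D by (simp_all add: neg_transpose_sl2)
  have e: "(- transpose M) $ a $ b = - M $ b $ a" for M :: HC and a b by (simp add: transpose_def)
  have act: "differentiated pi_l (block_diag (- transpose D) (- transpose A)) (b j i) =
         scale_fun (- ((- D $ 1 $ 1) * of_int j + (- D $ 2 $ 2) * of_int (p - j))) (b j i)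
       + scale_fun (- ((- D $ 1 $ 2) * of_int (j + 1))) (b (j + 1) i)
       + scale_fun (- ((- D $ 2 $ 1) * of_int (p - j + 1))) (b (j - 1) i)
       + scale_fun ((- A $ 1 $ 1) * of_int i + (- A $ 2 $ 2) * of_int (q - i)) (b j i)
       + scale_fun ((- A $ 2 $ 1) * of_int (i + 1)) (b j (i + 1))
       + scale_fun ((- A $ 1 $ 2) * of_int (q - i + 1)) (b j (i - 1))"
    using B AD unfolding e[symmetric] by blast
  show "differentiated pi_r (block_diag A D) (transposed (b j i)) =
         scale_fun (- (A $ 1 $ 1 * of_int i + A $ 2 $ 2 * of_int (q - i))) (transposed (b j i))
       + scale_fun (- (A $ 2 $ 1 * of_int (i + 1))) (transposed (b j (i + 1)))
       + scale_fun (- (A $ 1 $ 2 * of_int (q - i + 1))) (transposed (b j (i - 1)))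
       + scale_fun (D $ 1 $ 1 * of_int j + D $ 2 $ 2 * of_int (p - j)) (transposed (b j i))
       + scale_fun (D $ 1 $ 2 * of_int (j + 1)) (transposed (b (j + 1) i))
       + scale_fun (D $ 2 $ 1 * of_int (p - j + 1)) (transposed (b (j - 1) i))"
    unfolding differentiated_pi_r_transposed[OF L A D] act
    by (simp add: fun_eq_iff transposed_def scale_fun_def vec_eq_iff algebra_simps)
qed

section \<open>The decomposition\<close>

text \<open>A basis enumerated by an arbitrary index set becomes one enumerated by family and position, along a bijection \<open>\<psi>\<close>.\<close>

lemma box_decompositionI:
  fixes b :: "nat \<Rightarrow> int \<Rightarrow> int \<Rightarrow> HC \<Rightarrow> complex^2" and \<epsilon> :: "'v \<Rightarrow> HC \<Rightarrow> complex^2"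
  defines "J pqs \<equiv> Sigma {..<length pqs} (\<lambda>n. box_indices (fst (pqs ! n)) (snd (pqs ! n)))"
  assumes basis: "\<And>n. n < length pqs \<Longrightarrow> box_basis \<rho> (fst (pqs ! n)) (snd (pqs ! n)) (b n)"
    and bij: "bij_betw \<psi> (J pqs) V"
    and b: "\<And>y. y \<in> J pqs \<Longrightarrow> b (fst y) (int (fst (snd y))) (int (snd (snd y))) = \<epsilon> (\<psi> y)"
    and indep: "\<And>c v. (\<Sum>v\<in>V. scale_fun (c v) (\<epsilon> v)) = 0 \<Longrightarrow> v \<in> V \<Longrightarrow> c v = 0"
    and U: "U = range (\<lambda>c. \<Sum>v\<in>V. scale_fun (c v) (\<epsilon> v))"
    and lin: "\<And>X. X \<in> sl2_sl2 \<Longrightarrow> linear_on scale_fun scale_fun U (\<rho> X)"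
  shows "box_decomposition \<rho> pqs b U"
proof -
  have sum1: "(\<Sum>y\<in>J pqs. scale_fun (c y) (b (fst y) (int (fst (snd y))) (int (snd (snd y))))) =
      (\<Sum>y\<in>J pqs. scale_fun (c y) (\<epsilon> (\<psi> y)))" for c
    by (rule sum.cong) (simp_all only: b)
  have inv: "the_inv_into (J pqs) \<psi> (\<psi> y) = y" if "y \<in> J pqs" for y
    by (rule the_inv_into_f_f[OF bij_betw_imp_inj_on[OF bij] that])
  have sum2: "(\<Sum>y\<in>J pqs. scale_fun (c (\<psi> y)) (\<epsilon> (\<psi> y))) = (\<Sum>v\<in>V. scale_fun (c v) (\<epsilon> v))" for c
    by (rule sum.reindex_bij_betw[OF bij])
  have sum3: "(\<Sum>y\<in>J pqs. scale_fun (c y) (\<epsilon> (\<psi> y))) =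
      (\<Sum>v\<in>V. scale_fun (c (the_inv_into (J pqs) \<psi> v)) (\<epsilon> v))" for c
    unfolding sum2[symmetric] by (rule sum.cong) (simp_all only: inv)
  show ?thesis
  proof (rule box_decomposition.intro, fold J_def)
    show "box_basis \<rho> (fst (pqs ! n)) (snd (pqs ! n)) (b n)" if "n < length pqs" for n
      by (rule basis[OF that])
    show "linear_on scale_fun scale_fun U (\<rho> X)" if "X \<in> sl2_sl2" for X by (rule lin[OF that])
    show "c y = 0" if "(\<Sum>y\<in>J pqs. scale_fun (c y) (b (fst y) (int (fst (snd y))) (int (snd (snd y))))) = 0" "y \<in> J pqs" for c y
    proof -
      have "\<psi> y \<in> V" using bij_betwE[OF bij] that(2) by blast
      from indep[OF that(1)[unfolded sum1 sum3] this] show ?thesis using inv[OF that(2)] by simp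
    qed
    show "U = range (\<lambda>c. \<Sum>y\<in>J pqs. scale_fun (c y) (b (fst y) (int (fst (snd y))) (int (snd (snd y)))))"
      unfolding sum1 U
    proof (intro equalityI subsetI)
      fix f assume "f \<in> range (\<lambda>c. \<Sum>v\<in>V. scale_fun (c v) (\<epsilon> v))"
      then obtain c where f: "f = (\<Sum>v\<in>V. scale_fun (c v) (\<epsilon> v))" by blast
      show "f \<in> range (\<lambda>c. \<Sum>y\<in>J pqs. scale_fun (c y) (\<epsilon> (\<psi> y)))"
        unfolding f sum2[symmetric] by (rule range_eqI[where x = "\<lambda>y. c (\<psi> y)"]) (rule refl)
    next
      fix f assume "f \<in> range (\<lambda>c. \<Sum>y\<in>J pqs. scale_fun (c y) (\<epsilon> (\<psi> y)))"
      then obtain c where f: "f = (\<Sum>y\<in>J pqs. scale_fun (c y) (\<epsilon> (\<psi> y)))" by blast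
      show "f \<in> range (\<lambda>c. \<Sum>v\<in>V. scale_fun (c v) (\<epsilon> v))"
        unfolding f sum3 by (rule range_eqI[where x = "\<lambda>v. c (the_inv_into (J pqs) \<psi> v)"]) (rule refl)
    qed
  qed
qed

text \<open>Twice the highest weights of the two factors, block by block.\<close>

definition U_shape :: "int \<Rightarrow> (int \<times> int) list" where
  "U_shape d = map (\<lambda>(k, r, m). (width k m, m)) (U_blocks d)"

definition U_index :: "int \<Rightarrow> nat \<Rightarrow> int \<Rightarrow> int \<Rightarrow> idx" where
  "U_index d n i j = (case U_blocks d ! n of (k, r, m) \<Rightarrow> (k, r, nat m, i, j))"

abbreviation "swap_shape \<equiv> map (\<lambda>(p, q). (q, p))"

lemma distinct_U_blocks: "distinct (map (\<lambda>(k, r, m). (k, r)) (U_blocks d))"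
  by (simp add: U_blocks_def)

lemma U_index_bij:
  "bij_betw (\<lambda>(n, i, j). U_index d n (int i) (int j))
     (Sigma {..<length (U_shape d)} (\<lambda>n. box_indices (fst (U_shape d ! n)) (snd (U_shape d ! n)))) (U_basis d)"
proof (rule bij_betw_imageI)
  let ?J = "Sigma {..<length (U_shape d)} (\<lambda>n. box_indices (fst (U_shape d ! n)) (snd (U_shape d ! n)))"
  have J: "(n, i, j) \<in> ?J \<longleftrightarrow> n < length (U_blocks d) \<and>
     (case U_blocks d ! n of (k, r, m) \<Rightarrow> int i \<le> width k m \<and> int j \<le> m)" for n i j
    by (auto simp: U_shape_def box_indices_def case_prod_beta)
  show "inj_on (\<lambda>(n, i, j). U_index d n (int i) (int j)) ?J"
  proof (rule inj_onI)
    fix y y'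
    assume mem: "y \<in> ?J" "y' \<in> ?J"
      and eq0: "(\<lambda>(n, i, j). U_index d n (int i) (int j)) y = (\<lambda>(n, i, j). U_index d n (int i) (int j)) y'"
    obtain n i j n' i' j' where yy: "y = (n, i, j)" "y' = (n', i', j')" by (metis prod.exhaust)
    have eq: "U_index d n (int i) (int j) = U_index d n' (int i') (int j')" using eq0 yy by simp
    have n: "n < length (U_blocks d)" "n' < length (U_blocks d)" using mem unfolding yy J by blast+
    have "map (\<lambda>(k, r, m). (k, r)) (U_blocks d) ! n = map (\<lambda>(k, r, m). (k, r)) (U_blocks d) ! n'"
      using eq n by (auto simp: U_index_def split: prod.splits)
    then have "n = n'" using nth_eq_iff_index_eq[OF distinct_U_blocks] n by simp
    then show "y = y'" using eq unfolding yy by (auto simp: U_index_def split: prod.splits)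
  qed
  show "(\<lambda>(n, i, j). U_index d n (int i) (int j)) ` ?J = U_basis d"
  proof (intro equalityI subsetI)
    fix v assume "v \<in> (\<lambda>(n, i, j). U_index d n (int i) (int j)) ` ?J"
    then obtain n i j where v: "v = U_index d n (int i) (int j)" and y: "(n, i, j) \<in> ?J" by auto
    then have "v \<in> block (U_blocks d ! n)" "U_blocks d ! n \<in> set (U_blocks d)"
      unfolding J by (auto simp: U_index_def block_def split: prod.splits)
    then show "v \<in> U_basis d" unfolding U_basis_eq by blast
  next
    fix v assume "v \<in> U_basis d"
    then obtain n where n: "n < length (U_blocks d)" and v: "v \<in> block (U_blocks d ! n)"
      unfolding U_basis_eq by (auto simp: in_set_conv_nth)
    obtain k r m where b: "U_blocks d ! n = (k, r, m)" by (metis prod.exhaust)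
    from v obtain i j where ij: "v = (k, r, nat m, i, j)" "0 \<le> i" "i \<le> width k m" "0 \<le> j" "j \<le> m"
      unfolding b block_def by auto
    have "(n, nat i, nat j) \<in> ?J" unfolding J using n b ij by simp
    moreover have "v = (\<lambda>(n, i, j). U_index d n (int i) (int j)) (n, nat i, nat j)"
      using ij by (simp add: U_index_def b)
    ultimately show "v \<in> (\<lambda>(n, i, j). U_index d n (int i) (int j)) ` ?J" by (rule rev_image_eqI)
  qed
qed

lemma finite_U_basis: "finite (U_basis d)"
  unfolding U_basis_eq by (auto simp: block_def)

lemma U_basis_independent:
  "lincomb scale_fun bvec (U_basis d) c = 0 \<Longrightarrow> v \<in> U_basis d \<Longrightarrow> c v = 0"
  by (rule bvec_independent[OF finite_U_basis]) (auto simp: U_basis_def)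

lemma U_deg_subset_laurent: "U_deg d \<subseteq> laurent_vectors"
  by (auto simp: U_deg_def spaceU_iff)

lemma box_decomposition_U:
  "box_decomposition (differentiated pi_l) (U_shape d) (\<lambda>n i j. bvec (U_index d n i j)) (U_deg d)"
proof (rule box_decompositionI[where \<psi> = "\<lambda>(n, i, j). U_index d n (int i) (int j)"
      and V = "U_basis d" and \<epsilon> = bvec, OF _ U_index_bij _ _ U_deg_eq[OF finite_U_basis]])
  fix n assume "n < length (U_shape d)"
  then show "box_basis (differentiated pi_l) (fst (U_shape d ! n)) (snd (U_shape d ! n)) (\<lambda>i j. bvec (U_index d n i j))"
    by (auto simp: U_shape_def U_index_def box_basis_bvec split: prod.splits)
next
  show "linear_on scale_fun scale_fun (U_deg d) (differentiated pi_l X)" if "X \<in> sl2_sl2" for X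
    by (rule linear_differentiated_pi_l[OF that U_deg_subset_laurent])
  show "c v = 0" if "lincomb scale_fun bvec (U_basis d) c = 0" "v \<in> U_basis d" for c v
    using that by (rule U_basis_independent)
qed (auto simp: case_prod_beta)

lemma transposed_sum:
  "transposed (lincomb scale_fun e V c) = (\<Sum>v\<in>V. scale_fun (c v) (transposed (e v)))"
  by (rule ext) (simp only: transposed_def sum_scale_fun_apply)

lemma linear_differentiated_pi_r:
  assumes "X \<in> sl2_sl2"
  shows "linear_on scale_fun scale_fun (U'_deg d) (differentiated pi_r X)"
proof -
  obtain A D where X: "A \<in> sl2" "D \<in> sl2" "X = block_diag A D" using assms unfolding sl2_sl2_iff by blast
  let ?Y = "block_diag (- transpose D) (- transpose A)"
  have "?Y \<in> sl2_sl2" unfolding sl2_sl2_iff using X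
    by (intro bexI[of _ "- transpose D"] bexI[of _ "- transpose A"])
      (simp_all add: neg_transpose_sl2)
  from linear_differentiated_pi_l[OF this order_refl]
  have add: "\<And>f g. f \<in> laurent_vectors \<Longrightarrow> g \<in> laurent_vectors \<Longrightarrow>
      differentiated pi_l ?Y (f + g) = differentiated pi_l ?Y f + differentiated pi_l ?Y g"
    and sc: "\<And>c f. f \<in> laurent_vectors \<Longrightarrow> differentiated pi_l ?Y (scale_fun c f) = scale_fun c (differentiated pi_l ?Y f)"
    unfolding linear_on_def by blast+
  have t: "transposed (f + g) = transposed f + transposed g" "transposed (scale_fun c f) = scale_fun c (transposed f)"
    for f g :: "HC \<Rightarrow> complex^2" and c
    by (simp_all add: fun_eq_iff transposed_def scale_fun_def)
  have cl: "f + g \<in> laurent_vectors" "scale_fun c f \<in> laurent_vectors"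
    if "f \<in> laurent_vectors" "g \<in> laurent_vectors" for f g c
    using that subspace_laurent_vectors unfolding fs.subspace_def by blast+
  note r = differentiated_pi_r_transposed[OF _ X(1,2)]
  show ?thesis
    unfolding linear_on_def U'_deg_eq_transposed ball_simps X(3) t[symmetric]
  proof (intro conjI ballI allI)
    fix f g assume fg: "f \<in> U_deg d" "g \<in> U_deg d"
    then have L: "f \<in> laurent_vectors" "g \<in> laurent_vectors" using U_deg_subset_laurent by blast+
    show "differentiated pi_r (block_diag A D) (transposed (f + g)) =
       differentiated pi_r (block_diag A D) (transposed f) + differentiated pi_r (block_diag A D) (transposed g)"
      unfolding r[OF L(1)] r[OF L(2)] r[OF cl(1)[OF L]] add[OF L] unfolding t ..
  next
    fix c f assume "f \<in> U_deg d"
    then have L: "f \<in> laurent_vectors" using U_deg_subset_laurent by blast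
    show "differentiated pi_r (block_diag A D) (transposed (scale_fun c f)) =
       scale_fun c (differentiated pi_r (block_diag A D) (transposed f))"
      unfolding r[OF L] r[OF cl(2)[OF L L]] sc[OF L] unfolding t ..
  qed
qed

lemma box_decomposition_U':
  "box_decomposition (differentiated pi_r) (swap_shape (U_shape d))
     (\<lambda>n i j. transposed (bvec (U_index d n j i))) (U'_deg d)"
proof (rule box_decompositionI[where \<psi> = "\<lambda>(n, i, j). U_index d n (int j) (int i)"
      and V = "U_basis d" and \<epsilon> = "\<lambda>v. transposed (bvec v)"])
  fix n assume n: "n < length (swap_shape (U_shape d))"
  have "box_basis (differentiated pi_l) (fst (U_shape d ! n)) (snd (U_shape d ! n)) (\<lambda>i j. bvec (U_index d n i j))"
    using box_decomposition.box_basis[OF box_decomposition_U] n by simp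
  from box_basis_transposed[OF this bvec_laurent] n
  show "box_basis (differentiated pi_r) (fst (swap_shape (U_shape d) ! n)) (snd (swap_shape (U_shape d) ! n))
      (\<lambda>i j. transposed (bvec (U_index d n j i)))" by (simp add: case_prod_beta)
next
  let ?J = "Sigma {..<length (U_shape d)} (\<lambda>n. box_indices (fst (U_shape d ! n)) (snd (U_shape d ! n)))"
  let ?J' = "Sigma {..<length (swap_shape (U_shape d))} (\<lambda>n. box_indices (fst (swap_shape (U_shape d) ! n)) (snd (swap_shape (U_shape d) ! n)))"
  have "bij_betw (\<lambda>(n, i, j). (n, j, i)) ?J' ?J"
    by (rule bij_betw_byWitness[where f' = "\<lambda>(n, i, j). (n, j, i)"])
      (auto simp: box_indices_def case_prod_beta)
  from bij_betw_trans[OF this U_index_bij]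
  have "bij_betw ((\<lambda>(n, i, j). U_index d n (int i) (int j)) \<circ> (\<lambda>(n, i, j). (n, j, i))) ?J' (U_basis d)" .
  moreover have "(\<lambda>(n, i, j). U_index d n (int i) (int j)) \<circ> (\<lambda>(n, i, j). (n, j, i)) =
      (\<lambda>(n, i, j). U_index d n (int j) (int i))" by auto
  ultimately show "bij_betw (\<lambda>(n, i, j). U_index d n (int j) (int i)) ?J' (U_basis d)"
    by (simp only:)
next
  fix c v assume 0: "(\<Sum>v\<in>U_basis d. scale_fun (c v) (transposed (bvec v))) = 0" and v: "v \<in> U_basis d"
  have "transposed (transposed (lincomb scale_fun bvec (U_basis d) c)) = transposed (0 :: HC \<Rightarrow> complex^2)"
    unfolding transposed_sum 0 ..
  then have "lincomb scale_fun bvec (U_basis d) c = 0"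
    unfolding transposed_transposed by (simp add: fun_eq_iff transposed_def)
  then show "c v = 0" using v by (rule U_basis_independent)
next
  show "U'_deg d = range (\<lambda>c. \<Sum>v\<in>U_basis d. scale_fun (c v) (transposed (bvec v)))"
    unfolding U'_deg_eq_transposed U_deg_eq[OF finite_U_basis] image_image transposed_sum ..
next
  show "linear_on scale_fun scale_fun (U'_deg d) (differentiated pi_r X)" if "X \<in> sl2_sl2" for X
    by (rule linear_differentiated_pi_r[OF that])
qed (auto simp: case_prod_beta)

text \<open>Truncation at \<open>0\<close> is harmless in the dimension count because one of the factors is then \<open>0\<close>.\<close>

lemma int_nat_mult: "0 \<le> x \<Longrightarrow> int (nat x) * int (nat (x - 1)) = x * (x - 1)"
  by (cases "x = 0") auto

lemma U_shape_dim:
  "(\<Sum>n<length (U_shape d). int (nat (fst (U_shape d ! n) + 1) * nat (snd (U_shape d ! n) + 1))) = 3 * d^2 + 3 * d + 2"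
proof (cases "0 \<le> d")
  case True
  then show ?thesis
    using int_nat_mult[of d]
    by (simp add: U_shape_def U_blocks_def width_def eval_nat_numeral lessThan_Suc algebra_simps)
next
  case False
  then show ?thesis
    using int_nat_mult[of "- d - 1"]
    by (cases "d = - 1") (simp_all add: U_shape_def U_blocks_def width_def eval_nat_numeral lessThan_Suc algebra_simps)
qed

theorem proposition28:
  "(\<forall>d. submodule scale_fun sl2_sl2 (differentiated pi_l) (U_deg d)) \<and>
   (\<forall>n::nat. let k = int n in
      decomposes_into (differentiated pi_l) (U_deg k)
        [(k + 1, k), (k - 1, k), (k - 1, k - 2)] \<and>
      decomposes_into (differentiated pi_l) (U_deg (- k - 1))
        [(k, k + 1), (k, k - 1), (k - 2, k - 1)]) \<and>
   (\<forall>d. submodule scale_fun sl2_sl2 (differentiated pi_r) (U'_deg d)) \<and>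
   (\<forall>n::nat. let k = int n in
      decomposes_into (differentiated pi_r) (U'_deg k)
        [(k, k + 1), (k, k - 1), (k - 2, k - 1)] \<and>
      decomposes_into (differentiated pi_r) (U'_deg (- k - 1))
        [(k + 1, k), (k - 1, k), (k - 1, k - 2)]) \<and>
   (\<forall>d. int (vector_space.dim scale_fun (U_deg d)) = 3 * d^2 + 3 * d + 2 \<and>
        int (vector_space.dim scale_fun (U'_deg d)) = 3 * d^2 + 3 * d + 2)"
proof (intro conjI allI)
  note U = box_decomposition_U and U' = box_decomposition_U'
  fix d
  show "submodule scale_fun sl2_sl2 (differentiated pi_l) (U_deg d)"
    by (rule box_decomposition.submodule_U[OF U])
  show "submodule scale_fun sl2_sl2 (differentiated pi_r) (U'_deg d)"
    by (rule box_decomposition.submodule_U[OF U'])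
  show "int (vector_space.dim scale_fun (U_deg d)) = 3 * d^2 + 3 * d + 2"
    unfolding box_decomposition.dim_U[OF U] U_shape_dim[symmetric] by simp
  show "int (vector_space.dim scale_fun (U'_deg d)) = 3 * d^2 + 3 * d + 2"
    unfolding box_decomposition.dim_U[OF U'] U_shape_dim[symmetric] by (simp add: case_prod_beta mult.commute)
next
  fix n :: nat
  have shape: "U_shape (int n) = [(int n + 1, int n), (int n - 1, int n), (int n - 1, int n - 2)]"
    "U_shape (- int n - 1) = [(int n, int n + 1), (int n, int n - 1), (int n - 2, int n - 1)]"
    by (simp_all add: U_shape_def U_blocks_def width_def)
  show "let k = int n in
      decomposes_into (differentiated pi_l) (U_deg k) [(k + 1, k), (k - 1, k), (k - 1, k - 2)] \<and>
      decomposes_into (differentiated pi_l) (U_deg (- k - 1)) [(k, k + 1), (k, k - 1), (k - 2, k - 1)]"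
    using box_decomposition.decomposes[OF box_decomposition_U, of "int n"]
      box_decomposition.decomposes[OF box_decomposition_U, of "- int n - 1"]
    unfolding Let_def shape by blast
  show "let k = int n in
      decomposes_into (differentiated pi_r) (U'_deg k) [(k, k + 1), (k, k - 1), (k - 2, k - 1)] \<and>
      decomposes_into (differentiated pi_r) (U'_deg (- k - 1)) [(k + 1, k), (k - 1, k), (k - 1, k - 2)]"
    using box_decomposition.decomposes[OF box_decomposition_U', of "int n"]
      box_decomposition.decomposes[OF box_decomposition_U', of "- int n - 1"]
    unfolding Let_def shape by simp
qed

end
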